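(* Let $n\ge2$ and $d\ge1$, let $f=x_0^n+x_1^2+\dots+x_d^2\in\mathbb{Z}[[x_0,\dots,x_d]]$, and for each integer $m\ge 1$ set $$a_{m,n}=\begin{cases}\frac12-\frac1n & m\text{ even},\\ \frac1n & m\text{ odd},\end{cases}\qquad c_{m,n}=(-1)^{\lfloor m/2\rfloor}\frac{2^{m-3}\,n}{m!}.$$ Then the limit $h$-function of $f$ is given on $[0,1]$ by $$h_{f,\infty}(x)=\begin{cases}x+c_{d+1,n}\bigl(E_{d+1}(x+a_{d+1,n})-E_{d+1}(-x+a_{d+1,n})\bigr)& x\in[0,a_{d+1,n}],\\ x+c_{d+1,n}\bigl(E_{d+1}(x+a_{d+1,n})+E_{d+1}(-x+1+a_{d+1,n})\bigr)& x\in[a_{d+1,n},1-a_{d+1,n}],\\ x+c_{d+1,n}\bigl(-E_{d+1}(x-1+a_{d+1,n})+E_{d+1}(-x+1+a_{d+1,n})\bigr)& x\in[1-a_{d+1,n},1],\end{cases}$$ where $E_k$ is the $k$-th Euler polynomial.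
   Context: The Euler polynomials $E_k(x)\in\mathbb{Q}[x]$ are defined by $\dfrac{2e^{zx}}{e^z+1}=\sum_{k\ge0}E_k(x)\dfrac{z^k}{k!}$. For a field $k$ of characteristic $p>0$ and $f$ in the maximal ideal of $S=k[[x_0,\dots,x_d]]$, the $h$-function is $h_f(x)=\lim_{e\to\infty}\frac{1}{p^{e(d+1)}}\ell\bigl(S/(f^{\lceil xp^e\rceil},x_0^{p^e},\dots,x_d^{p^e})\bigr)$, where a non-positive power of an ideal is the unit ideal. For $f\in\mathbb{Z}[[x_0,\dots,x_d]]$, the limit $h$-function is $h_{f,\infty}(x)=\lim_{p\to\infty}h_{f_p}(x)$, where $f_p\in\mathbb{F}_p[[x_0,\dots,x_d]]$ is the reduction of $f$ mod $p$ (provided the limit exists; existence is part of the claim). *)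

theory Defs
  imports
    "HOL-Algebra.Algebra"
    "HOL-Number_Theory.Residues"
    "HOL-Computational_Algebra.Formal_Power_Series"
    "HOL-Library.Multiset"
    "HOL-Library.Extended_Nat"
begin

section \<open>Euler polynomials\<close>

text \<open>
  The identity \<open>2 e\<^sup>z\<^sup>x / (e\<^sup>z + 1) = (\<Sum>k. E\<^sub>k(x) z\<^sup>k / k!)\<close> of formal power series in \<open>z\<close>,
  for real \<open>x\<close>; the denominator has constant term 2, so it is a unit.
\<close>

definition euler_poly :: "nat \<Rightarrow> real \<Rightarrow> real" where
  "euler_poly k x = fact k * fps_nth (2 * fps_exp x / (fps_exp 1 + 1)) k"


section \<open>Formal power series in several variables\<close>

text \<open>
  As in \<^theory>\<open>HOL-Algebra.Indexed_Polynomials\<close>, a monomial is the multiset of its variables,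
  so the product of monomials is the sum of multisets and divisibility is \<open>\<subseteq>#\<close>.
  A power series is its coefficient function, which vanishes on monomials that involve a variable
  outside \<open>V\<close>. The set \<open>V\<close> is meant to be finite.
\<close>

definition power_series_ring ::
    "('a, 'b) ring_scheme \<Rightarrow> 'v set \<Rightarrow> ('v multiset \<Rightarrow> 'a) ring" where
  "power_series_ring R V =
    \<lparr>carrier = {F. (\<forall>m. F m \<in> carrier R) \<and> (\<forall>m. \<not> set_mset m \<subseteq> V \<longrightarrow> F m = \<zero>\<^bsub>R\<^esub>)},
     monoid.mult = (\<lambda>F G m. \<Oplus>\<^bsub>R\<^esub>a \<in> {a. a \<subseteq># m}. F a \<otimes>\<^bsub>R\<^esub> G (m - a)),
     one = (\<lambda>m. if m = {#} then \<one>\<^bsub>R\<^esub> else \<zero>\<^bsub>R\<^esub>),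
     ring.zero = (\<lambda>m. \<zero>\<^bsub>R\<^esub>),
     ring.add = (\<lambda>F G m. F m \<oplus>\<^bsub>R\<^esub> G m)\<rparr>"

definition ps_var :: "('a, 'b) ring_scheme \<Rightarrow> 'v \<Rightarrow> 'v multiset \<Rightarrow> 'a" where
  "ps_var R i = (\<lambda>m. if m = {#i#} then \<one>\<^bsub>R\<^esub> else \<zero>\<^bsub>R\<^esub>)"

text \<open>Coefficientwise reduction of integral power series to the ring with coefficients in
  \<^term>\<open>residue_ring (int p)\<close>, whose elements are the representatives \<open>0, \<dots>, p - 1\<close>.\<close>

definition reduce_mod :: "nat \<Rightarrow> ('v multiset \<Rightarrow> int) \<Rightarrow> 'v multiset \<Rightarrow> int" where
  "reduce_mod p F = (\<lambda>m. F m mod int p)"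


section \<open>Length of a module\<close>

definition module_length :: "('a, 'b) ring_scheme \<Rightarrow> ('a, 'c, 'd) module_scheme \<Rightarrow> enat" where
  "module_length R M =
     Sup {enat n | n. \<exists>N. (\<forall>i\<le>n. submodule (N i) R M) \<and> (\<forall>i<n. N i \<subset> N (Suc i))}"

definition quotient_module :: "('a, 'b) ring_scheme \<Rightarrow> 'a set \<Rightarrow> ('a, 'a set) module" where
  "quotient_module R I =
    \<lparr>carrier = carrier (R Quot I),
     monoid.mult = monoid.mult (R Quot I),
     one = \<one>\<^bsub>R Quot I\<^esub>,
     ring.zero = \<zero>\<^bsub>R Quot I\<^esub>,
     ring.add = ring.add (R Quot I),
     smult = (\<lambda>a Y. (I +>\<^bsub>R\<^esub> a) \<otimes>\<^bsub>R Quot I\<^esub> Y)\<rparr>"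


section \<open>The h-function\<close>

definition ring_characteristic :: "('a, 'b) ring_scheme \<Rightarrow> nat" where
  "ring_characteristic R = group.ord (add_monoid R) \<one>\<^bsub>R\<^esub>"

text \<open>
  \<open>(f\<^sup>a, x\<^sub>0\<^sup>q, \<dots>, x\<^sub>d\<^sup>q)\<close> in \<open>k[[x\<^sub>0, \<dots>, x\<^sub>d]]\<close>. For \<open>a \<le> 0\<close> the conversion \<^const>\<open>nat\<close> turns the
  exponent into 0, so that the ideal is the unit ideal.
\<close>

definition h_ideal ::
    "('a, 'b) ring_scheme \<Rightarrow> nat \<Rightarrow> (nat multiset \<Rightarrow> 'a) \<Rightarrow> int \<Rightarrow> nat \<Rightarrow> (nat multiset \<Rightarrow> 'a) set" where
  "h_ideal k d f a q =
     (let S = power_series_ring k {..d}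
      in genideal S ({f [^]\<^bsub>S\<^esub> nat a} \<union> (\<lambda>i. ps_var k i [^]\<^bsub>S\<^esub> q) ` {..d}))"

text \<open>
  Here \<open>k\<close> is a field of positive characteristic and \<open>f\<close> lies in the maximal ideal of
  \<open>k[[x\<^sub>0, \<dots>, x\<^sub>d]]\<close>. The lengths are finite, since the ideals contain a power of every variable.
\<close>

definition h_function ::
    "('a, 'b) ring_scheme \<Rightarrow> nat \<Rightarrow> (nat multiset \<Rightarrow> 'a) \<Rightarrow> real \<Rightarrow> real" where
  "h_function k d f x =
     (let S = power_series_ring k {..d}; p = ring_characteristic k
      in lim (\<lambda>e. real (the_enat (module_length S
                     (quotient_module S (h_ideal k d f \<lceil>x * real p ^ e\<rceil> (p ^ e)))))
                  / real p ^ (e * (d + 1))))"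

abbreviation primes_at_top :: "nat filter" where
  "primes_at_top \<equiv> inf at_top (principal {p. Factorial_Ring.prime p})"

definition limit_h_function :: "nat \<Rightarrow> (nat multiset \<Rightarrow> int) \<Rightarrow> real \<Rightarrow> real" where
  "limit_h_function d f x =
     Lim primes_at_top (\<lambda>p. h_function (residue_ring (int p)) d (reduce_mod p f) x)"


section \<open>The constants in the formula\<close>

definition a_const :: "nat \<Rightarrow> nat \<Rightarrow> real" where
  "a_const m n = (if even m then 1 / 2 - 1 / real n else 1 / real n)"

definition c_const :: "nat \<Rightarrow> nat \<Rightarrow> real" where
  "c_const m n = (- 1) ^ (m div 2) * (2 powi (int m - 3) * real n / fact m)"

end

theory Submission
  imports Defs "HOL-Number_Theory.Number_Theory" "HOL-Library.Function_Algebras"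
    "HOL-Analysis.Elementary_Metric_Spaces"
begin

text \<open>
  Over \<open>\<bbbF>\<^sub>p\<close> the quotient \<open>S/(x\<^sub>0\<^sup>q, \<dots>, x\<^sub>d\<^sup>q)\<close> is isomorphic, as an \<open>S\<close>-module, to its dual, the module of
  functions from the box of monomials with exponents below \<open>q\<close> to the \<open>p\<close>-torsion of \<open>\<rat>/\<int>\<close>, on which
  the variables act by translation. Hence the length of \<open>S/(f\<^sup>a, x\<^sub>0\<^sup>q, \<dots>, x\<^sub>d\<^sup>q)\<close> is the dimension \<open>\<phi>\<^sub>d(a)\<close>
  of the kernel of \<open>f\<^sup>a\<close> on this module. Since \<open>f\<^sup>p\<close> is obtained from \<open>f\<close> by substituting \<open>x\<^sub>i\<^sup>p\<close> for \<open>x\<^sub>i\<close>,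
  these lengths for \<open>p q\<close> and \<open>p a\<close> are \<open>p\<^sup>d\<^sup>+\<^sup>1\<close> times those for \<open>q\<close> and \<open>a\<close>; so the sequence defining the
  h-function decreases, and its limit is squeezed between two adjacent values for \<open>q = p\<close>.

  For \<open>q = p = 2 h + 1\<close> write \<open>f + y\<^sup>2\<close> as \<open>g + Y\<close> with \<open>Y = y\<^sup>2\<close>. The kernels \<open>K(a, b)\<close> of
  \<open>(g + Y)\<^sup>a\<close> and \<open>Y\<^sup>b\<close> on sequences satisfy, as in the Clebsch-Gordan rule,
  \<open>dim K(a + 1, b + 1) = dim K(a, b) + \<phi>\<^sub>d(a + b + 1)\<close> for \<open>a + b < p\<close>, which yields
  \<open>\<phi>\<^sub>d\<^sub>+\<^sub>1(a) = \<Sum>\<^sub>j \<phi>\<^sub>d(j)\<close> over \<open>h - a < j \<le> h + a\<close> for \<open>a \<le> h\<close>, while a duality relates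
  \<open>\<phi>\<^sub>d\<^sub>+\<^sub>1(a)\<close> to \<open>\<phi>\<^sub>d\<^sub>+\<^sub>1(p - a)\<close>. In the limit the limit functions satisfy
  \<open>\<Phi>\<^sub>d\<^sub>+\<^sub>1(x) = \<integral> \<Phi>\<^sub>d\<close> over \<open>[1/2 - x, 1/2 + x]\<close>, and so does the formula in terms of Euler polynomials because of
  \<open>E\<^sub>k' = k E\<^sub>k\<^sub>-\<^sub>1\<close> and their symmetries. The recursion starts with
  \<open>\<Phi>\<^sub>0(x) = min (n x) 1\<close>, which only enters through its symmetrization under \<open>x \<mapsto> 1 - x\<close>.
\<close>

subsection \<open>Finite torsion groups\<close>

text \<open>Scalars of \<open>F_p\<close> act on a \<open>p\<close>-torsion group through natural
  representatives; this keeps all vector spaces inside the type class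
  \<open>ab_group_add\<close>.\<close>

primrec smul :: "nat \<Rightarrow> 'a::comm_monoid_add \<Rightarrow> 'a" where
  "smul 0 x = 0"
| "smul (Suc k) x = x + smul k x"

lemma smul_zero [simp]: "smul k 0 = 0"
  by (induction k) auto

lemma smul_add: "smul (j + k) x = smul j x + smul k x"
  by (induction j) (auto simp: add.assoc)

lemma smul_mult: "smul (j * k) x = smul j (smul k x)"
  by (induction j) (auto simp: smul_add)

lemma smul_distrib: "smul k (x + y) = smul k x + smul k y"
  by (induction k) (auto simp: ac_simps)

lemma smul_uminus: "smul k (- x) = - smul k x" for x :: "'a::ab_group_add"
  by (induction k) auto

lemma smul_diff: "smul k (x - y) = smul k x - smul k y" for x :: "'a::ab_group_add"
  using smul_distrib[of k x "- y"] by (simp add: smul_uminus)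

lemma smul_fun: "smul k F m = smul k (F m)"
  by (induction k) auto

lemma additive_smul: "additive f \<Longrightarrow> f (smul k x) = smul k (f x)"
  by (induction k) (auto simp: additive.zero additive.add)

lemma additive_funpow: "additive f \<Longrightarrow> additive (f ^^ k)"
  for f :: "'a::ab_group_add \<Rightarrow> 'a"
  by (induction k) (simp_all add: additive_def)

lemma smul_mod:
  assumes "smul p x = 0"
  shows "smul (k mod p) x = smul k x"
proof -
  have "smul k x = smul (k div p * p + k mod p) x"
    by simp
  also have "\<dots> = smul (k mod p) x"
    unfolding smul_add smul_mult assms by simp
  finally show ?thesis by simp
qed

text \<open>Division by a scalar: \<open>c\<close> is an inverse of \<open>k\<close> modulo
  \<open>p\<close>. For \<open>p = 0\<close> coprimality forces \<open>k = 1\<close>.\<close>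

lemma smul_inverse:
  assumes "coprime k p" "smul p x = 0"
  shows "\<exists>c. smul c (smul k x) = x"
proof (cases "p = 0")
  case True
  with assms have "k = 1" by simp
  then show ?thesis
    by (intro exI[of _ 1]) simp
next
  case False
  obtain c where c: "[k * c = 1] (mod p)"
    using cong_solve_coprime_nat[OF assms(1)] by auto
  have "smul c (smul k x) = smul ((k * c) mod p) x"
    unfolding smul_mod[OF assms(2)] by (simp add: smul_mult[symmetric] mult.commute)
  also have "\<dots> = smul 1 x"
    using c smul_mod[OF assms(2), of 1] by (simp only: unique_euclidean_semiring_class.cong_def)
  finally show ?thesis by auto
qed

lemma smul_cancel:
  assumes "coprime k p" "smul p x = 0" "smul k x = 0"
  shows "x = 0"
  using smul_inverse[OF assms(1,2)] assms(3) by auto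

definition subgrp :: "'a::ab_group_add set \<Rightarrow> bool" where
  "subgrp A \<longleftrightarrow> 0 \<in> A \<and> (\<forall>x\<in>A. \<forall>y\<in>A. x - y \<in> A)"

lemma subgrp_zero: "subgrp A \<Longrightarrow> 0 \<in> A"
  and subgrp_diff: "subgrp A \<Longrightarrow> x \<in> A \<Longrightarrow> y \<in> A \<Longrightarrow> x - y \<in> A"
  by (auto simp: subgrp_def)

lemma subgrp_uminus: "subgrp A \<Longrightarrow> x \<in> A \<Longrightarrow> - x \<in> A"
  using subgrp_diff[of A 0 x] subgrp_zero[of A] by simp

lemma subgrp_add: "subgrp A \<Longrightarrow> x \<in> A \<Longrightarrow> y \<in> A \<Longrightarrow> x + y \<in> A"
  using subgrp_diff[of A x "- y"] subgrp_uminus[of A y] by simp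

lemma subgrp_smul: "subgrp A \<Longrightarrow> x \<in> A \<Longrightarrow> smul k x \<in> A"
  by (induction k) (auto simp: subgrp_zero subgrp_add)

lemma subgrp_sum: "subgrp A \<Longrightarrow> (\<And>i. i \<in> I \<Longrightarrow> f i \<in> A) \<Longrightarrow> sum f I \<in> A"
  by (induction I rule: infinite_finite_induct) (auto simp: subgrp_zero subgrp_add)

lemma subgrp_image: "subgrp A \<Longrightarrow> additive f \<Longrightarrow> subgrp (f ` A)"
  unfolding subgrp_def
  by (auto simp: additive.diff[symmetric] intro: image_eqI[OF additive.zero[symmetric]])

lemma subgrp_kernel: "subgrp A \<Longrightarrow> additive f \<Longrightarrow> subgrp {x \<in> A. f x = 0}"
  unfolding subgrp_def by (auto simp: additive.diff additive.zero)

lemma subgrp_vimage: "subgrp A \<Longrightarrow> subgrp B \<Longrightarrow> additive f \<Longrightarrow> subgrp {x \<in> A. f x \<in> B}"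
  unfolding subgrp_def by (auto simp: additive.diff additive.zero)

text \<open>The fibres are the cosets of the kernel. With cardinalities in the place of dimensions
  over \<open>F_p\<close>, this serves as rank-nullity.\<close>

lemma card_image_times_kernel:
  assumes "finite A" "subgrp A" "additive f"
  shows "card A = card (f ` A) * card {x \<in> A. f x = 0}"
proof -
  have fib: "card {x \<in> A. f x = y} = card {x \<in> A. f x = 0}" if "y \<in> f ` A" for y
  proof -
    from that obtain a where a: "a \<in> A" "y = f a" by auto
    have "bij_betw (\<lambda>x. x - a) {x \<in> A. f x = y} {x \<in> A. f x = 0}"
      by (rule bij_betwI[where g = "\<lambda>x. x + a"])
         (use a assms in \<open>auto simp: subgrp_diff subgrp_add additive.diff additive.add\<close>)
    then show ?thesis by (rule bij_betw_same_card)
  qed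
  have "card A = card (\<Union>y\<in>f ` A. {x \<in> A. f x = y})"
    by (intro arg_cong[where f = card]) auto
  also have "\<dots> = (\<Sum>y\<in>f ` A. card {x \<in> A. f x = y})"
    using assms(1) by (intro card_UN_disjoint) auto
  also have "\<dots> = card (f ` A) * card {x \<in> A. f x = 0}"
    by (simp add: fib)
  finally show ?thesis .
qed

text \<open>The preimage of \<open>B\<close> maps onto \<open>B\<close> and contains the whole
  kernel, so rank-nullity applies to it.\<close>

lemma card_vimage_additive:
  assumes "finite A" "subgrp A" "additive f" "subgrp B" "B \<subseteq> f ` A"
  shows "card {x \<in> A. f x \<in> B} = card B * card {x \<in> A. f x = 0}"
proof -
  have "f ` {x \<in> A. f x \<in> B} = B"
    using assms(5) by auto
  moreover have "{x \<in> {x \<in> A. f x \<in> B}. f x = 0} = {x \<in> A. f x = 0}"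
    using assms(4) by (auto simp: subgrp_zero)
  ultimately show ?thesis
    using card_image_times_kernel[of "{x \<in> A. f x \<in> B}" f] assms
    by (simp add: subgrp_vimage)
qed

section \<open>Binomial theorem and Frobenius for commuting additive operators\<close>

lemma funpow_commute:
  assumes "\<And>x. f (g x) = g (f x)"
  shows "(f ^^ a) ((g ^^ b) x) = (g ^^ b) ((f ^^ a) x)"
proof -
  have 1: "f ((g ^^ b) x) = (g ^^ b) (f x)" for x
    by (induction b) (auto simp: assms)
  show ?thesis
    by (induction a) (auto simp: 1)
qed

lemma funpow_add_apply: "(f ^^ (a + b)) x = (f ^^ a) ((f ^^ b) x)"
  by (simp add: funpow_add)

lemma funpow_zero_mono:
  fixes f :: "'a::ab_group_add \<Rightarrow> 'a"
  assumes "additive f" "(f ^^ a) x = 0" "a \<le> b"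
  shows "(f ^^ b) x = 0"
proof -
  have "(f ^^ b) x = (f ^^ (b - a)) ((f ^^ a) x)"
    using assms(3) by (simp flip: funpow_add_apply)
  then show ?thesis
    using assms(1,2) by (simp add: additive.zero[OF additive_funpow])
qed

lemma funpow_binomial:
  assumes "additive f" "additive g" "\<And>x. f (g x) = g (f x)"
  shows "((\<lambda>x. f x + g x) ^^ k) x = (\<Sum>i\<le>k. smul (k choose i) ((f ^^ i) ((g ^^ (k - i)) x)))"
proof (induction k)
  case (Suc k)
  let ?t = "\<lambda>i j. (f ^^ i) ((g ^^ j) x)"
  have fg: "g ((f ^^ i) y) = (f ^^ i) (g y)" for i y
    using funpow_commute[of f g i 1 y] assms(3) by simp
  have "((\<lambda>x. f x + g x) ^^ Suc k) x =
      (\<Sum>i\<le>k. smul (k choose i) (?t (Suc i) (k - i))) + (\<Sum>i\<le>k. smul (k choose i) (?t i (Suc (k - i))))"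
    by (simp add: Suc additive.sum[OF assms(1)] additive.sum[OF assms(2)]
        additive_smul[OF assms(1)] additive_smul[OF assms(2)] fg)
  also have "(\<Sum>i\<le>k. smul (k choose i) (?t (Suc i) (k - i))) =
      (\<Sum>i\<le>k. smul (k choose i) (?t (Suc i) (Suc k - Suc i)))"
    by simp
  \<comment> \<open>The added summand \<open>i = Suc k\<close> vanishes with
    \<open>k choose Suc k\<close>; splitting off \<open>i = 0\<close> then aligns both sums for
    Pascal's rule.\<close>
  also have "(\<Sum>i\<le>k. smul (k choose i) (?t i (Suc (k - i)))) =
      (\<Sum>i\<le>Suc k. smul (k choose i) (?t i (Suc k - i)))"
    by (simp add: Suc_diff_le binomial_eq_0)
  also have "\<dots> = ?t 0 (Suc k) + (\<Sum>i\<le>k. smul (k choose Suc i) (?t (Suc i) (Suc k - Suc i)))"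
    by (subst sum.atMost_Suc_shift) simp
  also have "(\<Sum>i\<le>k. smul (k choose i) (?t (Suc i) (Suc k - Suc i))) + \<dots> =
      ?t 0 (Suc k) + (\<Sum>i\<le>k. smul (Suc k choose Suc i) (?t (Suc i) (Suc k - Suc i)))"
    by (simp add: smul_add sum.distrib add.left_commute)
  also have "\<dots> = (\<Sum>i\<le>Suc k. smul (Suc k choose i) (?t i (Suc k - i)))"
    by (subst sum.atMost_Suc_shift) simp
  finally show ?case .
qed simp

text \<open>The inner binomial coefficients are divisible by \<open>p\<close>, so their terms vanish
  on the torsion element \<open>x\<close>.\<close>

lemma funpow_prime_add:
  assumes "additive f" "additive g" "\<And>x. f (g x) = g (f x)"
    and "Factorial_Ring.prime p" "smul p x = 0"
  shows "((\<lambda>x. f x + g x) ^^ p) x = (f ^^ p) x + (g ^^ p) x"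
proof -
  have p: "p > 0" using assms(4) by (simp add: prime_gt_0_nat)
  have z: "smul (p choose i) ((f ^^ i) ((g ^^ (p - i)) x)) = 0" if "i \<in> {0<..<p}" for i
  proof -
    have "p dvd (p choose i)"
      using assms(4) that by (intro dvd_choose_prime) auto
    then obtain c where "p choose i = c * p" by (metis dvd_def mult.commute)
    then show ?thesis
      using assms by (simp add: smul_mult additive_smul[symmetric] additive_funpow additive.zero)
  qed
  have "{..p} = insert 0 (insert p {0<..<p})" by auto
  then show ?thesis
    unfolding funpow_binomial[OF assms(1-3)] using p
    by (simp add: z add.commute)
qed

subsection \<open>Sequences over a torsion group with a nilpotent operator\<close>

text \<open>In the application \<open>A\<close> is the dual space of a box of side \<open>p\<close>
  and \<open>g\<close> the action of the series in the variables present so far. Nilpotency of order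
  \<open>p\<close> is what turns \<open>(g + Y)^p\<close> into \<open>Y^p\<close>.\<close>

locale nilpotent_operator =
  fixes A :: "'a::ab_group_add set" and g :: "'a \<Rightarrow> 'a" and p :: nat
  assumes prime_p: "Factorial_Ring.prime p"
    and finite_A: "finite A" and subgrp_A: "subgrp A"
    and torsion_A: "x \<in> A \<Longrightarrow> smul p x = 0"
    and additive_g: "additive g" and g_closed: "x \<in> A \<Longrightarrow> g x \<in> A"
    and nilpotent_g: "x \<in> A \<Longrightarrow> (g ^^ p) x = 0"
begin

text \<open>A sequence \<open>U\<close> stands for the linear map from \<open>F_p[Y]\<close> to
  \<open>A\<close> with \<open>Y^j \<mapsto> U j\<close>. On these maps \<open>Y\<close> acts as
  \<open>shift\<close>, \<open>g\<close> as \<open>lift\<close> and \<open>g + Y\<close> as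
  \<open>gshift\<close>.\<close>

definition seqs :: "(nat \<Rightarrow> 'a) set" where
  "seqs = {U. \<forall>j. U j \<in> A}"

definition shift :: "(nat \<Rightarrow> 'a) \<Rightarrow> nat \<Rightarrow> 'a" where
  "shift U = (\<lambda>j. U (Suc j))"

definition lift :: "(nat \<Rightarrow> 'a) \<Rightarrow> nat \<Rightarrow> 'a" where
  "lift U = (\<lambda>j. g (U j))"

definition gshift :: "(nat \<Rightarrow> 'a) \<Rightarrow> nat \<Rightarrow> 'a" where
  "gshift U = (\<lambda>j. g (U j) + U (Suc j))"

definition seq_kernel :: "nat \<Rightarrow> nat \<Rightarrow> (nat \<Rightarrow> 'a) set" where
  "seq_kernel a b = {U \<in> seqs. (gshift ^^ a) U = 0 \<and> (shift ^^ b) U = 0}"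

lemma additive_shift: "additive shift" and additive_lift: "additive lift"
  and additive_gshift: "additive gshift"
  by (unfold_locales; simp add: shift_def lift_def gshift_def fun_eq_iff additive.add[OF additive_g])+

lemmas additive_ops = additive_shift additive_lift additive_gshift additive_g
  additive_funpow[OF additive_shift] additive_funpow[OF additive_lift]
  additive_funpow[OF additive_gshift] additive_funpow[OF additive_g]

lemma funpow_shift: "(shift ^^ k) U = (\<lambda>j. U (j + k))"
  by (induction k) (auto simp: shift_def)

lemma funpow_lift: "(lift ^^ k) U = (\<lambda>j. (g ^^ k) (U j))"
  by (induction k) (auto simp: lift_def)

lemma funpow_shift_zero_iff: "(shift ^^ b) U = 0 \<longleftrightarrow> (\<forall>j\<ge>b. U j = 0)"
  by (auto simp: funpow_shift fun_eq_iff) (metis le_add_diff_inverse2)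

lemma subgrp_seqs: "subgrp seqs"
  using subgrp_A by (auto simp: subgrp_def seqs_def)

lemma shift_seqs: "U \<in> seqs \<Longrightarrow> shift U \<in> seqs"
  and gshift_seqs: "U \<in> seqs \<Longrightarrow> gshift U \<in> seqs"
  by (auto simp: seqs_def shift_def lift_def gshift_def g_closed subgrp_add[OF subgrp_A])

lemma funpow_shift_seqs: "U \<in> seqs \<Longrightarrow> (shift ^^ k) U \<in> seqs"
  by (induction k) (auto simp: shift_seqs)

lemma funpow_gshift_seqs: "U \<in> seqs \<Longrightarrow> (gshift ^^ k) U \<in> seqs"
  by (induction k) (auto simp: gshift_seqs)

lemma funpow_g_closed: "x \<in> A \<Longrightarrow> (g ^^ k) x \<in> A"
  by (induction k) (auto simp: g_closed)

lemma shift_lift: "shift (lift U) = lift (shift U)"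
  by (simp add: shift_def lift_def)

lemma gshift_eq: "gshift = (\<lambda>U. lift U + shift U)"
  by (simp add: gshift_def lift_def shift_def fun_eq_iff)

lemma gshift_shift: "gshift (shift U) = shift (gshift U)"
  by (simp add: shift_def gshift_def)

lemma torsion_seqs: "U \<in> seqs \<Longrightarrow> smul p U = 0"
  by (auto simp: seqs_def fun_eq_iff smul_fun torsion_A)

lemma funpow_gshift_prime: "U \<in> seqs \<Longrightarrow> (gshift ^^ p) U = (shift ^^ p) U"
  using funpow_prime_add[OF additive_lift additive_shift shift_lift[symmetric] prime_p torsion_seqs]
  by (simp add: gshift_eq) (simp add: funpow_lift nilpotent_g seqs_def fun_eq_iff)

lemma finite_seqs: "finite {U \<in> seqs. (shift ^^ b) U = 0}"
proof -
  have "finite {U. \<forall>j. (j \<in> {..<b} \<longrightarrow> U j \<in> A) \<and> (j \<notin> {..<b} \<longrightarrow> U j = 0)}"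
    by (rule finite_set_of_finite_funs) (auto simp: finite_A)
  then show ?thesis
    by (rule rev_finite_subset) (auto simp: funpow_shift_zero_iff seqs_def)
qed

lemma finite_seq_kernel: "finite (seq_kernel a b)"
  by (rule finite_subset[OF _ finite_seqs[of b]]) (auto simp: seq_kernel_def)

lemma subgrp_seq_kernel: "subgrp (seq_kernel a b)"
proof -
  have "seq_kernel a b = {U \<in> {U \<in> seqs. (gshift ^^ a) U = 0}. (shift ^^ b) U = 0}"
    by (auto simp: seq_kernel_def)
  show ?thesis
    unfolding \<open>_ = _\<close> by (intro subgrp_kernel subgrp_seqs additive_ops)
qed

lemma seq_kernel_zero: "seq_kernel 0 b = {0}" "seq_kernel a 0 = {0}"
  using subgrp_zero[OF subgrp_seqs] by (auto simp: seq_kernel_def additive_ops additive.zero)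

text \<open>Since \<open>g = (g + Y) - Y\<close>, the power \<open>g^(a+b-1)\<close> lies in the
  ideal generated by \<open>(g + Y)^a\<close> and \<open>Y^b\<close>. Peeling off one factor
  \<open>g\<close> lowers either \<open>a\<close> or \<open>b\<close>, hence the induction on
  \<open>a + b\<close>. The truncated exponent at \<open>a = b = 0\<close> is harmless because
  \<open>U = 0\<close> there.\<close>

lemma g_power_seq_kernel:
  "(gshift ^^ a) U = 0 \<Longrightarrow> (shift ^^ b) U = 0 \<Longrightarrow> (lift ^^ (a + b - 1)) U = 0"
proof (induction "a + b" arbitrary: a b U rule: less_induct)
  case less
  show ?case
  proof (cases "a = 0 \<or> b = 0")
    case True
    then have "U = 0" using less.prems by auto
    then show ?thesis by (simp add: additive.zero additive_ops)
  next
    case False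
    then obtain a' b' where ab: "a = Suc a'" "b = Suc b'" by (metis not0_implies_Suc)
    have 1: "(lift ^^ (a + b' - 1)) (shift U) = 0"
    proof (rule less.hyps)
      show "(gshift ^^ a) (shift U) = 0"
        using less.prems(1) funpow_commute[of gshift shift a 1 U]
        by (simp add: gshift_shift additive.zero additive_ops)
      show "(shift ^^ b') (shift U) = 0"
        using less.prems(2) by (simp add: ab funpow_swap1)
    qed (simp add: ab)
    have 2: "(lift ^^ (a' + b - 1)) (gshift U) = 0"
    proof (rule less.hyps)
      show "(gshift ^^ a') (gshift U) = 0"
        using less.prems(1) by (simp add: ab funpow_swap1)
      show "(shift ^^ b) (gshift U) = 0"
        using less.prems(2) funpow_commute[of gshift shift 1 b U]
        by (simp add: gshift_shift additive.zero additive_ops)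
    qed (simp add: ab)
    have "lift U = gshift U - shift U"
      by (simp add: gshift_eq)
    then have "(lift ^^ (a' + b')) (lift U) = 0"
      using 1 2 additive.diff[OF additive_funpow[OF additive_lift]] by (simp add: ab)
    then show ?thesis
      by (simp add: ab funpow_swap1)
  qed
qed

text \<open>The operators \<^term>\<open>shift\<close> and \<open>theta\<close> generate a Weyl algebra: \<open>theta\<close> is adjoint to the
  derivation \<open>d/dY\<close> for the residue pairing between polynomials in \<open>Y\<close> and sequences. At \<open>j = 0\<close> the truncated index
  is harmless because of the factor \<open>j\<close>.\<close>

definition theta :: "(nat \<Rightarrow> 'a) \<Rightarrow> nat \<Rightarrow> 'a" where
  "theta U = (\<lambda>j. smul j (U (j - 1)))"

lemma additive_theta: "additive theta"
  by unfold_locales (simp add: theta_def fun_eq_iff smul_distrib)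

lemma theta_seqs: "U \<in> seqs \<Longrightarrow> theta U \<in> seqs"
  by (auto simp: seqs_def theta_def subgrp_smul[OF subgrp_A])

text \<open>The Weyl relation \<open>[shift, theta] = 1\<close>, adjoint to the product rule. As
  \<open>theta\<close> commutes with \<open>lift\<close>, \<open>gshift\<close> satisfies it
  too.\<close>

lemma shift_theta: "shift (theta U) = theta (shift U) + U"
proof
  fix j show "shift (theta U) j = (theta (shift U) + U) j"
    by (cases j) (simp_all add: shift_def theta_def add.commute)
qed

lemma gshift_theta: "gshift (theta U) = theta (gshift U) + U"
proof -
  have "lift (theta U) = theta (lift U)"
    by (simp add: lift_def theta_def additive_smul additive_ops)
  then show ?thesis
    by (simp add: gshift_eq shift_theta additive.add[OF additive_theta] add.assoc)
qed

text \<open>Iterated Weyl relation, dual to the power rule for derivatives.\<close>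

lemma funpow_theta:
  assumes "additive f" "\<And>U. f (theta U) = theta (f U) + U"
  shows "(f ^^ Suc k) (theta U) = theta ((f ^^ Suc k) U) + smul (Suc k) ((f ^^ k) U)"
proof (induction k)
  case (Suc k)
  have "(f ^^ Suc (Suc k)) (theta U) = f (theta ((f ^^ Suc k) U) + smul (Suc k) ((f ^^ k) U))"
    by (metis Suc funpow.simps(2) o_apply)
  also have "\<dots> = theta (f ((f ^^ Suc k) U)) + (f ^^ Suc k) U + smul (Suc k) (f ((f ^^ k) U))"
    by (simp only: assms(2) additive.add[OF assms(1)] additive_smul[OF assms(1)])
  finally show ?case
    by (simp only: funpow.simps o_apply smul.simps add.assoc)
qed (simp add: assms)

lemma coprime_prime_less: "0 < k \<Longrightarrow> k < p \<Longrightarrow> coprime k p"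
  using prime_p by (metis coprime_commute nat_dvd_not_less prime_imp_coprime)

text \<open>By the Weyl relation \<open>theta\<close> raises both exponents by one. Conversely,
  \<open>U\<close> with \<open>U 0 = 0\<close> is divided by its indices, which are invertible up to
  \<open>b < p\<close>; it remains to see that the quotient \<open>V\<close> is killed by
  \<open>(g + Y)^a\<close>.\<close>

lemma theta_image:
  assumes "a + b < p"
  shows "theta ` seq_kernel a b = {U \<in> seq_kernel (Suc a) (Suc b). U 0 = 0}"
proof (intro subset_antisym subsetI)
  fix U assume "U \<in> theta ` seq_kernel a b"
  then obtain V where V: "V \<in> seq_kernel a b" "U = theta V" by auto
  then have "(gshift ^^ Suc a) (theta V) = 0" "(shift ^^ Suc b) (theta V) = 0"
    using funpow_theta[OF additive_gshift gshift_theta, of a V]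
      funpow_theta[OF additive_shift shift_theta, of b V]
    by (simp_all add: seq_kernel_def additive.zero[OF additive_gshift] additive.zero[OF additive_shift]
        additive.zero[OF additive_theta])
  then show "U \<in> {U \<in> seq_kernel (Suc a) (Suc b). U 0 = 0}"
    using V by (auto simp: seq_kernel_def theta_seqs) (simp add: theta_def)
next
  fix U assume "U \<in> {U \<in> seq_kernel (Suc a) (Suc b). U 0 = 0}"
  then have U: "U \<in> seqs" "(gshift ^^ Suc a) U = 0" "\<And>j. j \<ge> Suc b \<Longrightarrow> U j = 0" "U 0 = 0"
    unfolding seq_kernel_def funpow_shift_zero_iff by auto
  have "\<exists>c. smul c (smul (Suc j) (U (Suc j))) = U (Suc j)" if "j < b" for j
    using U(1) that assms by (intro smul_inverse[of _ p] torsion_A coprime_prime_less) (auto simp: seqs_def)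
  then obtain c where c: "\<And>j. j < b \<Longrightarrow> smul (c j) (smul (Suc j) (U (Suc j))) = U (Suc j)"
    by metis
  define V where "V = (\<lambda>j. if j < b then smul (c j) (U (Suc j)) else 0)"
  have V: "V \<in> seqs"
    using U(1) by (auto simp: V_def seqs_def subgrp_smul[OF subgrp_A] subgrp_zero[OF subgrp_A])
  have UV: "U = theta V"
  proof
    fix j show "U j = theta V j"
    proof (cases j)
      case (Suc i)
      show ?thesis
      proof (cases "i < b")
        case True
        have "theta V j = smul (Suc i * c i) (U (Suc i))"
          using True by (simp only: theta_def V_def Suc smul_mult if_True diff_Suc_1)
        also have "\<dots> = smul (c i) (smul (Suc i) (U (Suc i)))"
          by (simp only: mult.commute[of "Suc i"] smul_mult)
        also have "\<dots> = U j"
          by (simp only: c[OF True] Suc)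
        finally show ?thesis by (rule sym)
      qed (use U(3)[of j] Suc in \<open>simp add: theta_def V_def\<close>)
    qed (use U(4) in \<open>simp add: theta_def\<close>)
  qed
  define W where "W = (gshift ^^ a) V"
  have W: "W \<in> seqs"
    using V by (simp add: W_def funpow_gshift_seqs)
  have "(shift ^^ b) V = 0"
    by (simp add: funpow_shift_zero_iff V_def)
  then have "(shift ^^ b) W = 0"
    unfolding W_def using funpow_commute[of gshift shift a b V]
    by (simp add: gshift_shift additive.zero additive_ops)
  then have Wb: "W j = 0" if "j \<ge> b" for j
    using that by (simp add: funpow_shift_zero_iff)
  \<comment> \<open>With \<open>(g + Y)^(a+1) U = 0\<close> the commutation rule becomes a
    recurrence for \<open>W = (g + Y)^a V\<close>: at index \<open>j\<close> it reads
    \<open>j g(W (j-1)) + (j + a + 1) W j = 0\<close>.\<close>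
  have "(gshift ^^ Suc a) (theta V) = theta ((gshift ^^ Suc a) V) + smul (Suc a) ((gshift ^^ a) V)"
    by (rule funpow_theta[OF additive_gshift gshift_theta])
  then have rel: "theta (gshift W) + smul (Suc a) W = 0"
    using U(2) by (simp add: W_def UV)
  \<comment> \<open>For \<open>j < b\<close> the factor \<open>j + a + 1\<close> is at most
    \<open>a + b < p\<close>, hence invertible; for \<open>j \<ge> b\<close> the term is zero
    already.\<close>
  have "W j = 0" for j
  proof (induction j)
    case 0
    have "smul (Suc a) (W 0) = 0"
      using fun_cong[OF rel, of 0] unfolding plus_fun_apply zero_fun_apply smul_fun
      by (simp add: theta_def del: smul.simps(2))
    then show ?case
      using W assms smul_cancel[of "Suc a" p "W 0"] Wb[of 0] coprime_prime_less[of "Suc a"] torsion_A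
      by (cases "b = 0") (auto simp: seqs_def)
  next
    case (Suc j)
    have "smul (Suc j) (g (W j) + W (Suc j)) + smul (Suc a) (W (Suc j)) = 0"
      using fun_cong[OF rel, of "Suc j"] by (simp add: theta_def gshift_def smul_fun)
    then have "smul (Suc j + Suc a) (W (Suc j)) = 0"
      unfolding smul_add Suc by (simp add: additive.zero additive_ops)
    then show ?case
      using W assms smul_cancel[of "Suc j + Suc a" p "W (Suc j)"] Wb[of "Suc j"]
        coprime_prime_less[of "Suc j + Suc a"] torsion_A
      by (cases "Suc j < b") (auto simp: seqs_def)
  qed
  then have "V \<in> seq_kernel a b"
    using V \<open>(shift ^^ b) V = 0\<close> by (auto simp: seq_kernel_def W_def)
  then show "U \<in> theta ` seq_kernel a b"
    by (simp add: UV)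
qed

text \<open>The entry \<open>U j\<close> is recovered from \<open>theta U (j + 1)\<close> by
  dividing by \<open>j + 1 \<le> b < p\<close>.\<close>

lemma inj_on_theta:
  assumes "b < p"
  shows "inj_on theta (seq_kernel a b)"
proof (rule inj_onI)
  fix U V assume UV: "U \<in> seq_kernel a b" "V \<in> seq_kernel a b" "theta U = theta V"
  show "U = V"
  proof
    fix j show "U j = V j"
    proof (cases "j < b")
      case True
      have "smul (Suc j) (U j - V j) = 0"
        using fun_cong[OF UV(3), of "Suc j"] by (simp add: theta_def smul_diff del: smul.simps)
      moreover have "U j - V j \<in> A"
        using UV by (auto simp: seq_kernel_def seqs_def subgrp_diff[OF subgrp_A])
      ultimately show ?thesis
        using smul_cancel[of "Suc j" p "U j - V j"] coprime_prime_less[of "Suc j"] True assms torsion_A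
        by auto
    qed (use UV in \<open>auto simp: seq_kernel_def funpow_shift_zero_iff\<close>)
  qed
qed

text \<open>In the residue pairing, the sequence below is the functional
  \<open>F \<mapsto> [Y\<^sup>b] (F / (g + Y)\<^sup>a\<^sup>+\<^sup>1)\<close>, multiplied by \<open>g\<^sup>a\<^sup>+\<^sup>b\<^sup>+\<^sup>1\<close>.\<close>

definition section_seq :: "nat \<Rightarrow> nat \<Rightarrow> 'a \<Rightarrow> nat \<Rightarrow> 'a" where
  "section_seq b a w = (\<lambda>j. if j \<le> b then
     (if even j then id else uminus) (smul ((a + b - j) choose a) ((g ^^ j) w)) else 0)"

text \<open>Multiplication by \<open>g + Y\<close> cancels one factor of the denominator, and the
  normalizing power for \<open>a + 1\<close> has one \<open>g\<close> more than that for
  \<open>a\<close>; this \<open>g\<close> is the \<open>lift\<close>. For \<open>j < b\<close> the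
  identity is Pascal's rule.\<close>

lemma gshift_section_seq:
  "gshift (section_seq b (Suc a) w) = lift (section_seq b a w)"
proof
  fix j
  consider "j > b" | "j = b" | "j < b" by linarith
  then show "gshift (section_seq b (Suc a) w) j = lift (section_seq b a w) j"
  proof cases
    case 3
    obtain N where N: "a + b - j = N" "Suc a + b - j = Suc N" "Suc a + b - Suc j = N"
      using 3 by auto
    show ?thesis
      using 3 unfolding gshift_def lift_def section_seq_def N binomial_Suc_Suc smul_add
      by (auto simp: additive_smul[OF additive_g] additive.minus[OF additive_g]
          additive.add[OF additive_g] additive.diff[OF additive_g])
  qed (auto simp: gshift_def lift_def section_seq_def additive_smul[OF additive_g]
          additive.minus[OF additive_g] additive.zero[OF additive_g])
qed

lemma section_seq_in_seqs: "w \<in> A \<Longrightarrow> section_seq b a w \<in> seqs"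
  by (auto simp: section_seq_def seqs_def subgrp_zero[OF subgrp_A] subgrp_uminus[OF subgrp_A]
      subgrp_smul[OF subgrp_A] funpow_g_closed)

text \<open>With the denominator cleared, the functional is \<open>F \<mapsto> [Y^b] F\<close> up to
  sign, times \<open>g^(a+b+1)\<close>. So \<open>section_seq\<close> lies in the kernel of
  \<open>(g + Y)^(a+1)\<close> as soon as \<open>g^(a+b+1) w = 0\<close>.\<close>

lemma funpow_gshift_section_seq:
  "(gshift ^^ Suc a) (section_seq b a w) =
     (\<lambda>j. if j = b then (if even b then id else uminus) ((g ^^ (a + b + 1)) w) else 0)"
proof (induction a)
  case 0
  show ?case
    by (auto simp: section_seq_def gshift_def fun_eq_iff additive.minus[OF additive_g]
        additive.zero[OF additive_g])
next
  case (Suc a)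
  have "(gshift ^^ Suc (Suc a)) (section_seq b (Suc a) w) =
      (gshift ^^ Suc a) (lift (section_seq b a w))"
    by (simp only: funpow_Suc_right o_apply gshift_section_seq)
  also have "\<dots> = lift ((gshift ^^ Suc a) (section_seq b a w))"
    using funpow_commute[of gshift lift "Suc a" 1]
    by (simp add: gshift_eq shift_lift additive.add[OF additive_lift])
  finally show ?case
    unfolding Suc by (auto simp: lift_def fun_eq_iff additive.minus[OF additive_g]
        additive.zero[OF additive_g])
qed

text \<open>The values are restricted by \<open>g_power_seq_kernel\<close>. All of them occur:
  \<open>section_seq b a x\<close> has the value \<open>((a + b) choose a) x\<close> at 0, and this
  coefficient is invertible modulo \<open>p\<close> because \<open>a + b < p\<close>.\<close>

lemma eval_image:
  assumes "a + b < p"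
  shows "(\<lambda>U. U 0) ` seq_kernel (Suc a) (Suc b) = {x \<in> A. (g ^^ (a + b + 1)) x = 0}"
proof (intro subset_antisym subsetI)
  fix x assume "x \<in> (\<lambda>U. U 0) ` seq_kernel (Suc a) (Suc b)"
  then obtain U where U: "U \<in> seq_kernel (Suc a) (Suc b)" "x = U 0" by auto
  then have "(lift ^^ (Suc a + Suc b - 1)) U = 0"
    by (intro g_power_seq_kernel) (auto simp: seq_kernel_def)
  then have "(lift ^^ (a + b + 1)) U 0 = 0"
    by (simp del: funpow.simps)
  then show "x \<in> {x \<in> A. (g ^^ (a + b + 1)) x = 0}"
    using U by (simp add: seq_kernel_def seqs_def funpow_lift del: funpow.simps)
next
  fix x assume x: "x \<in> {x \<in> A. (g ^^ (a + b + 1)) x = 0}"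
  have "coprime ((a + b) choose a) p"
  proof -
    have "\<not> p dvd fact (a + b)"
      using prime_p assms by (simp add: prime_dvd_fact_iff)
    moreover have "((a + b) choose a) dvd fact (a + b)"
      using binomial_fact_lemma[of a "a + b"] by (metis dvd_triv_right le_add1)
    ultimately have "\<not> p dvd ((a + b) choose a)"
      by (meson dvd_trans)
    then show ?thesis
      using prime_p by (metis coprime_commute prime_imp_coprime)
  qed
  then obtain c where c: "smul c (smul ((a + b) choose a) x) = x"
    using smul_inverse torsion_A x by blast
  define U where "U = smul c (section_seq b a x)"
  have "U 0 = x"
    using c by (simp add: U_def smul_fun section_seq_def)
  moreover have "U \<in> seqs"
    using x by (simp add: U_def subgrp_smul[OF subgrp_seqs] section_seq_in_seqs)
  moreover have "(gshift ^^ Suc a) (section_seq b a x) = 0"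
    unfolding funpow_gshift_section_seq using x by (auto simp: fun_eq_iff)
  then have "(gshift ^^ Suc a) U = 0"
    unfolding U_def by (subst additive_smul[OF additive_ops(7)]) simp
  moreover have "(shift ^^ Suc b) U = 0"
    by (simp add: funpow_shift_zero_iff U_def smul_fun section_seq_def del: funpow.simps)
  ultimately show "x \<in> (\<lambda>U. U 0) ` seq_kernel (Suc a) (Suc b)"
    by (auto simp: seq_kernel_def simp del: funpow.simps)
qed

text \<open>Rank-nullity for evaluation at 0: the image is given by \<open>eval_image\<close>, and
  the kernel is a copy of \<open>seq_kernel a b\<close> through \<open>theta\<close>.\<close>

lemma card_seq_kernel_Suc:
  assumes "a + b < p"
  shows "card (seq_kernel (Suc a) (Suc b)) =
    card {x \<in> A. (g ^^ (a + b + 1)) x = 0} * card (seq_kernel a b)"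
proof -
  have "additive (\<lambda>U::nat \<Rightarrow> 'a. U 0)"
    by unfold_locales simp
  then show ?thesis
    using card_image_times_kernel[OF finite_seq_kernel subgrp_seq_kernel, of "\<lambda>U. U 0" "Suc a" "Suc b"]
      card_image[OF inj_on_theta[of b a]] assms
    by (simp add: eval_image[OF assms] theta_image[OF assms, symmetric])
qed

section \<open>Surjectivity of the operators, sizes of their kernels, and duality\<close>

lemma surj_shift: "U \<in> seqs \<Longrightarrow> \<exists>V\<in>seqs. shift V = U"
  by (rule bexI[of _ "\<lambda>j. U (j - 1)"]) (auto simp: shift_def seqs_def)

lemma surj_gshift:
  assumes "U \<in> seqs" "w \<in> A"
  shows "\<exists>V\<in>seqs. gshift V = U \<and> V 0 = w"
proof -
  define V where "V = rec_nat w (\<lambda>j v. U j - g v)"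
  have "V j \<in> A" for j
    using assms by (induction j) (auto simp: V_def seqs_def subgrp_diff[OF subgrp_A] g_closed)
  then show ?thesis
    by (intro bexI[of _ V]) (auto simp: seqs_def gshift_def V_def)
qed

lemma surj_funpow_shift: "U \<in> seqs \<Longrightarrow> \<exists>V\<in>seqs. (shift ^^ k) V = U"
  by (induction k arbitrary: U) (simp, metis funpow.simps(2) o_apply surj_shift)

lemma surj_funpow_gshift: "U \<in> seqs \<Longrightarrow> \<exists>V\<in>seqs. (gshift ^^ k) V = U"
  by (induction k arbitrary: U)
     (simp, metis funpow.simps(2) o_apply surj_gshift subgrp_zero[OF subgrp_A])

lemma card_seqs: "card {U \<in> seqs. (shift ^^ b) U = 0} = card A ^ b"
proof -
  have "bij_betw (\<lambda>f j. if j < b then f j else 0) ({..<b} \<rightarrow>\<^sub>E A) {U \<in> seqs. (shift ^^ b) U = 0}"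
    by (rule bij_betwI[where g = "\<lambda>U. restrict U {..<b}"])
       (unfold funpow_shift_zero_iff, auto simp: seqs_def PiE_def extensional_def fun_eq_iff
         subgrp_zero[OF subgrp_A] restrict_def not_less)
  then show ?thesis
    by (simp add: bij_betw_same_card[symmetric] card_PiE)
qed

text \<open>\<open>(g + Y)^a\<close> is monic in \<open>Y\<close>, so its kernel consists of the
  solutions of a recurrence of order \<open>a\<close>.\<close>

lemma gshift_kernel_eqI:
  assumes "(gshift ^^ a) U = 0" "U \<in> seqs" "\<And>j. j < a \<Longrightarrow> U j = 0"
  shows "U = 0"
  using assms
proof (induction a arbitrary: U)
  case (Suc a)
  have "gshift U = 0"
  proof (rule Suc.IH)
    show "(gshift ^^ a) (gshift U) = 0"
      using Suc.prems(1) by (simp only: funpow_Suc_right o_apply)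
  qed (use Suc.prems in \<open>auto simp: gshift_seqs\<close>, simp add: gshift_def additive.zero[OF additive_g])
  then have "g (U j) + U (Suc j) = 0" for j
    by (simp add: gshift_def fun_eq_iff)
  then have "U j = 0" for j
    by (induction j) (use Suc.prems(3)[of 0] in \<open>auto simp: additive.zero[OF additive_g], metis add_0 additive.zero[OF additive_g]\<close>)
  then show ?case by auto
qed simp

text \<open>For \<open>a \<le> p\<close> the kernel lies in that of \<open>(g + Y)^p = Y^p\<close>,
  which makes it finite.\<close>

lemma gshift_kernel_imp:
  "a \<le> p \<Longrightarrow> U \<in> seqs \<Longrightarrow> (gshift ^^ a) U = 0 \<Longrightarrow> (shift ^^ p) U = 0"
  using funpow_gshift_prime[of U] funpow_zero_mono[OF additive_gshift, of a U p] by simp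

lemma finite_gshift_kernel: "a \<le> p \<Longrightarrow> finite {U \<in> seqs. (gshift ^^ a) U = 0}"
  by (rule finite_subset[OF _ finite_seqs[of p]]) (auto simp: gshift_kernel_imp)

text \<open>Surjectivity of \<open>gshift\<close> splits the kernel of its power into
  \<open>a\<close> layers, each a copy of the kernel of \<open>gshift\<close>; a sequence there is
  determined by its initial value, an arbitrary element of \<open>A\<close>.\<close>

lemma card_gshift_kernel:
  "a \<le> p \<Longrightarrow> card {U \<in> seqs. (gshift ^^ a) U = 0} = card A ^ a"
proof (induction a)
  case 0
  have eq: "{U \<in> seqs. (gshift ^^ 0) U = 0} = {0}"
    using subgrp_zero[OF subgrp_seqs] by auto
  show ?case unfolding eq by simp
next
  case (Suc a)
  let ?K = "\<lambda>a. {U \<in> seqs. (gshift ^^ a) U = 0}"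
  have add: "additive (\<lambda>U::nat \<Rightarrow> 'a. U 0)"
    by unfold_locales simp
  have "card (?K 1) = card ((\<lambda>U. U 0) ` ?K 1) * card {U \<in> ?K 1. U 0 = 0}"
    using Suc.prems finite_gshift_kernel[of 1]
    by (intro card_image_times_kernel subgrp_kernel subgrp_seqs additive_ops add) auto
  moreover have "(\<lambda>U. U 0) ` ?K 1 = A"
    using surj_gshift[OF subgrp_zero[OF subgrp_seqs]] by (auto simp: seqs_def image_iff)
  moreover have "{U \<in> ?K 1. U 0 = 0} = {0}"
    using gshift_kernel_eqI[of 1] subgrp_zero[OF subgrp_seqs] by (auto simp: additive.zero[OF additive_gshift])
  ultimately have K1: "card (?K 1) = card A" by simp
  have "card {U \<in> ?K (Suc a). (gshift ^^ a) U \<in> ?K 1} = card (?K 1) * card {U \<in> ?K (Suc a). (gshift ^^ a) U = 0}"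
  proof (rule card_vimage_additive)
    show "?K 1 \<subseteq> (gshift ^^ a) ` ?K (Suc a)"
    proof
      fix U assume U: "U \<in> ?K 1"
      then obtain V where "V \<in> seqs" "(gshift ^^ a) V = U" using surj_funpow_gshift by blast
      then show "U \<in> (gshift ^^ a) ` ?K (Suc a)" using U by auto
    qed
    show "finite (?K (Suc a))"
      by (rule finite_gshift_kernel[OF Suc.prems])
  qed (intro subgrp_kernel subgrp_seqs additive_ops)+
  moreover have "{U \<in> ?K (Suc a). (gshift ^^ a) U \<in> ?K 1} = ?K (Suc a)"
    by (auto simp: funpow_gshift_seqs)
  moreover have "{U \<in> ?K (Suc a). (gshift ^^ a) U = 0} = ?K a"
    by (auto simp: additive.zero[OF additive_gshift])
  ultimately show ?case
    using Suc.IH Suc.prems unfolding K1 by (simp only: power_Suc Suc_leD)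
qed

text \<open>Both sides count the sequences annihilated by \<open>Y\<^sup>p\<close> and by \<open>(g + Y)\<^sup>a Y\<^sup>p\<^sup>-\<^sup>b\<close>: apply one of the two
  factors, both of which are surjective on sequences, and use \<open>(g + Y)\<^sup>p = Y\<^sup>p\<close>.\<close>

lemma card_seq_kernel_dual:
  assumes "a \<le> p" "b \<le> p"
  shows "card (seq_kernel a b) * card A ^ (p - b) = card (seq_kernel (p - a) (p - b)) * card A ^ a"
proof -
  define R where "R = {U \<in> seqs. (shift ^^ p) U = 0}"
  have R: "finite R" "subgrp R"
    by (auto simp: R_def finite_seqs subgrp_kernel subgrp_seqs additive_ops)
  define Q where "Q = {U \<in> R. (gshift ^^ a) ((shift ^^ (p - b)) U) = 0}"
  have pow_p: "(gshift ^^ (p - a)) ((gshift ^^ a) U) = (shift ^^ p) U" if "U \<in> seqs" for U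
    using assms(1) funpow_gshift_prime[OF that] by (simp flip: funpow_add_apply)
  have pow_p': "(shift ^^ b) ((shift ^^ (p - b)) U) = (shift ^^ p) U" for U
    using assms(2) by (simp flip: funpow_add_apply)
  have comm: "(gshift ^^ i) ((shift ^^ j) U) = (shift ^^ j) ((gshift ^^ i) U)" for i j U
    by (rule funpow_commute) (rule gshift_shift)
  have "card {U \<in> R. (shift ^^ (p - b)) U \<in> seq_kernel a b} =
      card (seq_kernel a b) * card {U \<in> R. (shift ^^ (p - b)) U = 0}"
  proof (rule card_vimage_additive[OF R additive_ops(5) subgrp_seq_kernel], rule subsetI)
    fix U assume U: "U \<in> seq_kernel a b"
    then obtain V where V: "V \<in> seqs" "(shift ^^ (p - b)) V = U"
      using surj_funpow_shift by (auto simp: seq_kernel_def)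
    then have "V \<in> R" using U pow_p'[of V] by (auto simp: R_def seq_kernel_def)
    then show "U \<in> (shift ^^ (p - b)) ` R" using V by auto
  qed
  also have "{U \<in> R. (shift ^^ (p - b)) U \<in> seq_kernel a b} = Q"
    by (auto simp: Q_def R_def seq_kernel_def funpow_shift_seqs pow_p')
  also have "{U \<in> R. (shift ^^ (p - b)) U = 0} = {U \<in> seqs. (shift ^^ (p - b)) U = 0}"
    using funpow_zero_mono[OF additive_shift, of "p - b" _ p] by (auto simp: R_def)
  finally have 1: "card Q = card (seq_kernel a b) * card A ^ (p - b)"
    by (simp add: card_seqs)
  have "card {U \<in> R. (gshift ^^ a) U \<in> seq_kernel (p - a) (p - b)} =
      card (seq_kernel (p - a) (p - b)) * card {U \<in> R. (gshift ^^ a) U = 0}"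
  proof (rule card_vimage_additive[OF R additive_ops(7) subgrp_seq_kernel], rule subsetI)
    fix U assume U: "U \<in> seq_kernel (p - a) (p - b)"
    then obtain V where V: "V \<in> seqs" "(gshift ^^ a) V = U"
      using surj_funpow_gshift by (auto simp: seq_kernel_def)
    then have "V \<in> R" using U pow_p[of V] by (auto simp: R_def seq_kernel_def)
    then show "U \<in> (gshift ^^ a) ` R" using V by auto
  qed
  also have "{U \<in> R. (gshift ^^ a) U \<in> seq_kernel (p - a) (p - b)} = Q"
    by (auto simp: Q_def R_def seq_kernel_def funpow_gshift_seqs pow_p comm)
  also have "{U \<in> R. (gshift ^^ a) U = 0} = {U \<in> seqs. (gshift ^^ a) U = 0}"
    using gshift_kernel_imp[OF assms(1)] by (auto simp: R_def)
  finally have "card Q = card (seq_kernel (p - a) (p - b)) * card A ^ a"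
    by (simp add: card_gshift_kernel assms(1))
  with 1 show ?thesis by simp
qed

end

subsection \<open>The group of rationals modulo the integers\<close>

\<comment> \<open>A single type that contains a cyclic group of order \<open>p\<close> for every
  prime \<open>p\<close>, so that the characteristic may vary while the functions keep one
  type.\<close>
quotient_type qz = rat / "\<lambda>x y. x - y \<in> \<int>"
proof (rule equivpI)
  show "symp (\<lambda>x y::rat. x - y \<in> \<int>)"
    by (rule sympI) (metis Ints_minus minus_diff_eq)
  show "transp (\<lambda>x y::rat. x - y \<in> \<int>)"
  proof (rule transpI)
    fix x y z :: rat assume "x - y \<in> \<int>" "y - z \<in> \<int>"
    then have "(x - y) + (y - z) \<in> \<int>" by (rule Ints_add)
    then show "x - z \<in> \<int>" by simp
  qed
qed (simp add: reflp_def)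

instantiation qz :: ab_group_add
begin

lift_definition zero_qz :: qz is 0 .

lift_definition plus_qz :: "qz \<Rightarrow> qz \<Rightarrow> qz" is "(+)"
  by (metis Ints_add add_diff_add)

lift_definition uminus_qz :: "qz \<Rightarrow> qz" is uminus
  by (metis Ints_minus minus_diff_eq minus_diff_minus)

lift_definition minus_qz :: "qz \<Rightarrow> qz \<Rightarrow> qz" is "(-)"
proof -
  fix a b c e :: rat assume "a - b \<in> \<int>" "c - e \<in> \<int>"
  then have "(a - b) - (c - e) \<in> \<int>" by (rule Ints_diff)
  then show "a - c - (b - e) \<in> \<int>" by (simp add: algebra_simps)
qed

instance
  by standard (transfer; simp)+

end

lift_definition unit_fraction :: "nat \<Rightarrow> qz" is "\<lambda>p. 1 / of_nat p" .

lemma smul_qz: "smul k (abs_qz x) = abs_qz (of_nat k * x)"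
  by (induction k) (auto simp: zero_qz_def plus_qz.abs_eq algebra_simps)

lemma abs_qz_eq_zero_iff: "abs_qz x = 0 \<longleftrightarrow> x \<in> \<int>"
  by (simp add: zero_qz_def qz.abs_eq_iff)

lemma smul_unit_fraction_eq_zero_iff:
  assumes "p > 0"
  shows "smul k (unit_fraction p) = 0 \<longleftrightarrow> p dvd k"
proof -
  have "(of_nat k / of_nat p :: rat) \<in> \<int> \<longleftrightarrow> p dvd k"
    using of_nat_dvd_iff of_int_div_of_int_in_Ints_iff[of "int k" "int p", where 'a = rat] assms by auto
  then show ?thesis
    by (simp add: unit_fraction_def smul_qz abs_qz_eq_zero_iff)
qed

lemma torsion_qz:
  assumes "p > 0" "smul p z = 0"
  obtains k where "k < p" "z = smul k (unit_fraction p)"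
proof -
  obtain x where z: "z = abs_qz x" by (metis Quotient3_abs_rep[OF Quotient3_qz])
  then have "of_nat p * x \<in> \<int>"
    using assms(2) by (simp add: smul_qz abs_qz_eq_zero_iff)
  then obtain j where j: "of_nat p * x = of_int j" by (rule Ints_cases)
  define k where "k = nat (j mod int p)"
  have "int k = j mod int p" using assms(1) by (simp add: k_def)
  then have jk: "j = int p * (j div int p) + int k" by simp
  have "(of_int j :: rat) = of_nat p * of_int (j div int p) + of_nat k"
    by (subst jk) simp
  then have "x - of_nat k * (1 / of_nat p) = of_int (j div int p)"
    using j assms(1) by (simp add: field_simps)
  then have "z = smul k (unit_fraction p)"
    by (simp add: z unit_fraction_def smul_qz qz.abs_eq_iff)
  moreover have "k < p"
    using assms(1) by (simp add: k_def nat_less_iff)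
  ultimately show ?thesis using that by blast
qed

lemma card_torsion_qz:
  assumes "p > 0"
  shows "card {z::qz. smul p z = 0} = p" and "finite {z::qz. smul p z = 0}"
proof -
  let ?f = "\<lambda>k. smul k (unit_fraction p)"
  have "inj_on ?f {..<p}"
  proof (rule linorder_inj_onI')
    fix i j assume ij: "i \<in> {..<p}" "j \<in> {..<p}" "i < j"
    have "?f j = ?f (j - i) + ?f i" using ij(3) by (simp flip: smul_add)
    moreover have "?f (j - i) \<noteq> 0"
      using ij assms nat_dvd_not_less[of "j - i" p] by (auto simp: smul_unit_fraction_eq_zero_iff)
    ultimately show "?f i \<noteq> ?f j" by simp
  qed
  moreover have "{z::qz. smul p z = 0} = ?f ` {..<p}"
    using smul_unit_fraction_eq_zero_iff[OF assms]
    by (auto elim!: torsion_qz[OF assms] simp flip: smul_mult)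
  ultimately show "card {z::qz. smul p z = 0} = p" "finite {z::qz. smul p z = 0}"
    by (simp_all add: card_image)
qed

subsection \<open>Functions on a box of monomials\<close>

definition box :: "nat \<Rightarrow> nat \<Rightarrow> nat multiset set" where
  "box d q = {m. \<forall>i. count m i < (if i \<le> d then q else 1)}"

lemma box_D: "m \<in> box d q \<Longrightarrow> i \<le> d \<Longrightarrow> count m i < q"
  and box_D0: "m \<in> box d q \<Longrightarrow> \<not> i \<le> d \<Longrightarrow> count m i = 0"
  unfolding box_def mem_Collect_eq by (drule spec[of _ i]; simp del: count_eq_zero_iff)+

lemma box_I: "(\<And>i. i \<le> d \<Longrightarrow> count m i < q) \<Longrightarrow> (\<And>i. \<not> i \<le> d \<Longrightarrow> count m i = 0) \<Longrightarrow> m \<in> box d q"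
  by (auto simp: box_def)

lemma sum_apply: "(sum f I) m = (\<Sum>i\<in>I. f i m)"
  by (induction I rule: infinite_finite_induct) auto

lemma count_sum_replicate:
  "finite I \<Longrightarrow> count (\<Sum>i\<in>I. replicate_mset (f i) i) j = (if j \<in> I then f j else 0)"
  by (simp add: count_sum sum.delta)

lemma card_box: "card (box d q) = q ^ (d + 1)" and finite_box: "finite (box d q)"
proof -
  have bij: "bij_betw (\<lambda>f. \<Sum>i\<le>d. replicate_mset (f i) i) ({..d} \<rightarrow>\<^sub>E {..<q}) (box d q)"
    by (rule bij_betwI[where g = "\<lambda>m. restrict (count m) {..d}"])
       (auto simp: multiset_eq_iff count_sum_replicate PiE_def extensional_def fun_eq_iff
         box_D box_D0 intro!: box_I simp del: count_eq_zero_iff)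
  show "card (box d q) = q ^ (d + 1)"
    using bij_betw_same_card[OF bij] by (simp add: card_PiE)
  show "finite (box d q)"
    using bij_betw_finite[OF bij] by (simp add: finite_PiE)
qed

lemma box_downward: "m + b \<in> box d q \<Longrightarrow> m \<in> box d q"
  by (rule box_I) (auto dest: box_D box_D0 add_lessD1 simp del: count_eq_zero_iff)

text \<open>Macaulay's inverse system of \<open>(x_0^q, ..., x_d^q)\<close>: the
  \<open>F_p\<close>-dual of the quotient by this ideal.\<close>

definition dual_space :: "nat \<Rightarrow> nat \<Rightarrow> nat \<Rightarrow> (nat multiset \<Rightarrow> qz) set" where
  "dual_space d p q = {F. \<forall>m. smul p (F m) = 0 \<and> (m \<notin> box d q \<longrightarrow> F m = 0)}"

lemma dual_space_torsion: "F \<in> dual_space d p q \<Longrightarrow> smul p F = 0"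
  by (auto simp: dual_space_def fun_eq_iff smul_fun)

lemma subgrp_dual_space: "subgrp (dual_space d p q)"
  by (auto simp: subgrp_def dual_space_def smul_diff)

lemma card_dual_space:
  assumes "p > 0"
  shows "card (dual_space d p q) = p ^ (q ^ (d + 1))" and "finite (dual_space d p q)"
proof -
  have bij: "bij_betw (\<lambda>f m. if m \<in> box d q then f m else 0)
      (box d q \<rightarrow>\<^sub>E {z::qz. smul p z = 0}) (dual_space d p q)"
    by (rule bij_betwI[where g = "\<lambda>F. restrict F (box d q)"])
       (auto simp: dual_space_def PiE_def extensional_def fun_eq_iff)
  show "card (dual_space d p q) = p ^ (q ^ (d + 1))"
    using bij_betw_same_card[OF bij] assms
    by (simp add: card_PiE finite_box card_box card_torsion_qz)
  show "finite (dual_space d p q)"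
    using bij_betw_finite[OF bij] assms by (simp add: finite_PiE finite_box card_torsion_qz)
qed

definition translate :: "nat multiset \<Rightarrow> (nat multiset \<Rightarrow> qz) \<Rightarrow> nat multiset \<Rightarrow> qz" where
  "translate b F = (\<lambda>m. F (m + b))"

lemma additive_translate: "additive (translate b)"
  by unfold_locales (simp add: translate_def fun_eq_iff)

lemma translate_dual_space: "F \<in> dual_space d p q \<Longrightarrow> translate b F \<in> dual_space d p q"
  using box_downward[of _ b d q] unfolding dual_space_def translate_def by blast

text \<open>The action of \<open>x_0^n + x_1^2 + ... + x_d^2\<close>, each monomial acting by
  translation of the argument.\<close>

definition diag_op :: "nat \<Rightarrow> nat \<Rightarrow> (nat multiset \<Rightarrow> qz) \<Rightarrow> nat multiset \<Rightarrow> qz" where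
  "diag_op n d F = (\<lambda>m. F (m + replicate_mset n 0) + (\<Sum>i\<in>{1..d}. F (m + replicate_mset 2 i)))"

lemma additive_diag_op: "additive (diag_op n d)"
  by unfold_locales (simp add: diag_op_def fun_eq_iff sum.distrib algebra_simps)

lemma diag_op_Suc:
  "diag_op n (Suc d) = (\<lambda>F. diag_op n d F + translate (replicate_mset 2 (Suc d)) F)"
  by (auto simp: diag_op_def translate_def fun_eq_iff add.assoc)

lemma diag_op_translate: "diag_op n d (translate b F) = translate b (diag_op n d F)"
  by (simp add: diag_op_def translate_def add_ac)

lemma diag_op_dual_space: "F \<in> dual_space d p q \<Longrightarrow> diag_op n d' F \<in> dual_space d p q"
proof -
  assume F: "F \<in> dual_space d p q"
  have "diag_op n d' F = translate (replicate_mset n 0) F + (\<Sum>i\<in>{1..d'}. translate (replicate_mset 2 i) F)"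
    by (simp add: diag_op_def translate_def fun_eq_iff sum_apply)
  then show ?thesis
    using F by (simp add: subgrp_add[OF subgrp_dual_space] subgrp_sum[OF subgrp_dual_space] translate_dual_space)
qed

lemma funpow_diag_op_dual_space:
  "F \<in> dual_space d p q \<Longrightarrow> (diag_op n d ^^ a) F \<in> dual_space d p q"
  by (induction a) (auto simp: diag_op_dual_space)

lemma funpow_translate: "(translate b ^^ k) F = translate (repeat_mset k b) F"
  by (induction k) (auto simp: translate_def add_ac)

lemma repeat_replicate_mset: "repeat_mset k (replicate_mset j x) = replicate_mset (k * j) x"
  by (simp add: multiset_eq_iff)

text \<open>Induction over the variables, with \<open>funpow_prime_add\<close> for each new square:
  Frobenius moves the exponent \<open>p\<close> into the monomials.\<close>

lemma funpow_diag_op_prime: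
  assumes "Factorial_Ring.prime p" "smul p F = 0"
  shows "(diag_op n d ^^ p) F =
    (\<lambda>m. F (m + replicate_mset (p * n) 0) + (\<Sum>i\<in>{1..d}. F (m + replicate_mset (p * 2) i)))"
proof (induction d)
  case 0
  have eq: "diag_op n 0 = translate (replicate_mset n 0)"
    by (auto simp: diag_op_def translate_def)
  show ?case
    unfolding eq by (subst funpow_translate, subst repeat_replicate_mset, rule ext, unfold translate_def) simp
next
  case (Suc d)
  have "(diag_op n (Suc d) ^^ p) F = (diag_op n d ^^ p) F + (translate (replicate_mset 2 (Suc d)) ^^ p) F"
    unfolding diag_op_Suc
    by (intro funpow_prime_add[where f = "diag_op n d" and g = "translate (replicate_mset 2 (Suc d))"]
        additive_diag_op additive_translate diag_op_translate assms)
  also have "(translate (replicate_mset 2 (Suc d)) ^^ p) F = translate (replicate_mset (p * 2) (Suc d)) F"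
    by (subst funpow_translate, subst repeat_replicate_mset) (rule refl)
  finally show ?case
    unfolding Suc by (auto simp: translate_def fun_eq_iff add.assoc)
qed

definition diag_kernel :: "nat \<Rightarrow> nat \<Rightarrow> nat \<Rightarrow> nat \<Rightarrow> nat \<Rightarrow> (nat multiset \<Rightarrow> qz) set" where
  "diag_kernel n d p q a = {F \<in> dual_space d p q. (diag_op n d ^^ a) F = 0}"

lemma subgrp_diag_kernel: "subgrp (diag_kernel n d p q a)"
  unfolding diag_kernel_def
  by (intro subgrp_kernel subgrp_dual_space additive_funpow additive_diag_op)

lemma finite_diag_kernel: "p > 0 \<Longrightarrow> finite (diag_kernel n d p q a)"
  by (simp add: diag_kernel_def card_dual_space)

lemma diag_kernel_mono: "a \<le> b \<Longrightarrow> diag_kernel n d p q a \<subseteq> diag_kernel n d p q b"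
  using funpow_zero_mono[OF additive_diag_op] by (auto simp: diag_kernel_def)

lemma card_diag_kernel_pos: "p > 0 \<Longrightarrow> card (diag_kernel n d p q a) > 0"
  using finite_diag_kernel subgrp_zero[OF subgrp_diag_kernel, of n d p q a] by (auto simp: card_gt_0_iff)

subsection \<open>Frobenius\<close>

definition mset_div :: "nat \<Rightarrow> nat multiset \<Rightarrow> nat multiset" where
  "mset_div p m = (\<Sum>i\<in>set_mset m. replicate_mset (count m i div p) i)"

definition mset_mod :: "nat \<Rightarrow> nat multiset \<Rightarrow> nat multiset" where
  "mset_mod p m = (\<Sum>i\<in>set_mset m. replicate_mset (count m i mod p) i)"

lemma count_mset_div: "count (mset_div p m) i = count m i div p"
  unfolding mset_div_def by (simp add: count_sum_replicate not_in_iff)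

lemma count_mset_mod: "count (mset_mod p m) i = count m i mod p"
  unfolding mset_mod_def by (simp add: count_sum_replicate not_in_iff)

lemma mset_div_mod: "repeat_mset p (mset_div p m) + mset_mod p m = m"
  by (simp add: multiset_eq_iff count_mset_div count_mset_mod)

text \<open>For \<open>0 \<le> r < p\<close> the inequality \<open>p c + r < p q\<close> is
  equivalent to \<open>c < q\<close>.\<close>

lemma box_mult_iff:
  assumes "\<alpha> \<in> box d p"
  shows "repeat_mset p m + \<alpha> \<in> box d (p * q) \<longleftrightarrow> m \<in> box d q"
proof
  assume L: "repeat_mset p m + \<alpha> \<in> box d (p * q)"
  show "m \<in> box d q"
  proof (rule box_I)
    fix i assume "i \<le> d"
    then have "p * count m i + count \<alpha> i < p * q" using box_D[OF L] by simp
    then have "p * count m i < p * q" by linarith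
    then show "count m i < q" by simp
  next
    fix i assume i: "\<not> i \<le> d"
    have "p > 0" using box_D[OF assms, of 0] by auto
    then show "count m i = 0" using box_D0[OF L i] by (simp del: count_eq_zero_iff)
  qed
next
  assume R: "m \<in> box d q"
  show "repeat_mset p m + \<alpha> \<in> box d (p * q)"
  proof (rule box_I)
    fix i assume i: "i \<le> d"
    have "p * count m i + count \<alpha> i < p * count m i + p" using box_D[OF assms i] by simp
    also have "\<dots> = p * Suc (count m i)" by simp
    also have "\<dots> \<le> p * q" using box_D[OF R i] by (intro mult_le_mono2) simp
    finally show "count (repeat_mset p m + \<alpha>) i < p * q" by simp
  qed (simp add: box_D0[OF R] box_D0[OF assms] del: count_eq_zero_iff)
qed

lemma mset_mod_box:
  assumes "m \<in> box d (p * q)" "p > 0"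
  shows "mset_mod p m \<in> box d p"
  using assms by (intro box_I) (simp_all add: count_mset_mod box_D0[OF assms(1)] del: count_eq_zero_iff)

lemma mset_div_add:
  assumes "\<alpha> \<in> box d p"
  shows "mset_div p (repeat_mset p m + \<alpha>) = m" and "mset_mod p (repeat_mset p m + \<alpha>) = \<alpha>"
proof -
  have "count \<alpha> i < p" for i
    using box_D[OF assms, of i] box_D0[OF assms, of i] box_D[OF assms, of 0]
    by (cases "i \<le> d") (auto simp del: count_eq_zero_iff)
  moreover have "p > 0" using box_D[OF assms, of 0] by auto
  ultimately show "mset_div p (repeat_mset p m + \<alpha>) = m" "mset_mod p (repeat_mset p m + \<alpha>) = \<alpha>"
    by (simp_all add: multiset_eq_iff count_mset_div count_mset_mod)
qed

text \<open>The part with exponents congruent to \<open>\<alpha>\<close> modulo \<open>p\<close>.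
  Slicing is dual to the freeness of the power series ring over the series in the
  \<open>p\<close>-th powers of the variables, with the monomials of \<open>box d p\<close> as a
  basis.\<close>

definition slice :: "nat \<Rightarrow> nat multiset \<Rightarrow> (nat multiset \<Rightarrow> qz) \<Rightarrow> nat multiset \<Rightarrow> qz" where
  "slice p \<alpha> F = (\<lambda>m. F (repeat_mset p m + \<alpha>))"

lemma repeat_mset_add: "repeat_mset p (m + m') = repeat_mset p m + repeat_mset p m'"
  by (simp add: multiset_eq_iff algebra_simps)

text \<open>\<open>f^p\<close> is a series in the \<open>p\<close>-th powers of the variables, so it
  preserves the residues of exponents and acts on each slice as \<open>f\<close> does.\<close>

lemma slice_funpow_diag_op:
  assumes "Factorial_Ring.prime p" "F \<in> dual_space d p q"
  shows "slice p \<alpha> ((diag_op n d ^^ (p * a)) F) = (diag_op n d ^^ a) (slice p \<alpha> F)"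
proof (induction a)
  case (Suc a)
  let ?G = "(diag_op n d ^^ (p * a)) F"
  have G: "smul p ?G = 0"
    by (rule dual_space_torsion[OF funpow_diag_op_dual_space[OF assms(2)]])
  have "slice p \<alpha> ((diag_op n d ^^ (p * Suc a)) F) = slice p \<alpha> ((diag_op n d ^^ p) ?G)"
    by (simp add: funpow_add)
  also have "\<dots> = diag_op n d (slice p \<alpha> ?G)"
    unfolding funpow_diag_op_prime[OF assms(1) G]
    by (simp add: slice_def diag_op_def repeat_mset_add repeat_replicate_mset add_ac)
  finally show ?case by (simp add: Suc)
qed simp

text \<open>Slicing identifies the kernel with a product of kernels for \<open>q\<close> and
  \<open>a\<close>, one for each of the \<open>p^(d+1)\<close> residue monomials;
  \<open>mset_div\<close> and \<open>mset_mod\<close> reassemble the slices.\<close>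

lemma card_diag_kernel_frobenius:
  assumes "Factorial_Ring.prime p"
  shows "card (diag_kernel n d p (p * q) (p * a)) = card (diag_kernel n d p q a) ^ (p ^ (d + 1))"
proof -
  have p: "p > 0" using assms prime_gt_0_nat by blast
  let ?to = "\<lambda>F. restrict (\<lambda>\<alpha>. slice p \<alpha> F) (box d p)"
  let ?from = "\<lambda>G m. if m \<in> box d (p * q) then G (mset_mod p m) (mset_div p m) else (0::qz)"
  have slice_from: "slice p \<alpha> (?from G) = G \<alpha>"
    if "\<alpha> \<in> box d p" "G \<in> box d p \<rightarrow>\<^sub>E diag_kernel n d p q a" for \<alpha> G
  proof
    fix m
    have "G \<alpha> \<in> dual_space d p q"
      using that by (auto simp: diag_kernel_def PiE_def)
    then have "m \<notin> box d q \<Longrightarrow> G \<alpha> m = 0"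
      by (auto simp: dual_space_def)
    then show "slice p \<alpha> (?from G) m = G \<alpha> m"
      by (simp add: slice_def box_mult_iff[OF that(1)] mset_div_add[OF that(1)])
  qed
  have "bij_betw ?to (diag_kernel n d p (p * q) (p * a)) (box d p \<rightarrow>\<^sub>E diag_kernel n d p q a)"
  proof (rule bij_betwI[where g = ?from])
    show "?to \<in> diag_kernel n d p (p * q) (p * a) \<rightarrow> (box d p \<rightarrow>\<^sub>E diag_kernel n d p q a)"
    proof (intro Pi_I restrict_PiE_iff[THEN iffD2] ballI)
      fix F \<alpha> assume F: "F \<in> diag_kernel n d p (p * q) (p * a)" and \<alpha>: "\<alpha> \<in> box d p"
      then have FD: "F \<in> dual_space d p (p * q)" by (simp add: diag_kernel_def)
      have "slice p \<alpha> F \<in> dual_space d p q"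
        using FD box_mult_iff[OF \<alpha>] by (simp add: dual_space_def slice_def)
      moreover have "(diag_op n d ^^ a) (slice p \<alpha> F) = slice p \<alpha> 0"
        using slice_funpow_diag_op[OF assms FD, where \<alpha> = \<alpha> and n = n and a = a] F by (simp add: diag_kernel_def)
      ultimately show "slice p \<alpha> F \<in> diag_kernel n d p q a"
        by (simp add: diag_kernel_def slice_def fun_eq_iff)
    qed
  next
    show "?from \<in> (box d p \<rightarrow>\<^sub>E diag_kernel n d p q a) \<rightarrow> diag_kernel n d p (p * q) (p * a)"
    proof
      fix G assume G: "G \<in> box d p \<rightarrow>\<^sub>E diag_kernel n d p q a"
      have D: "?from G \<in> dual_space d p (p * q)"
        using G mset_mod_box[OF _ p]
        by (auto simp: dual_space_def diag_kernel_def PiE_def Pi_def)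
      let ?H = "(diag_op n d ^^ (p * a)) (?from G)"
      have HD: "?H \<in> dual_space d p (p * q)"
        by (rule funpow_diag_op_dual_space[OF D])
      have "?H m = 0" for m
      proof (cases "m \<in> box d (p * q)")
        case True
        then have \<alpha>: "mset_mod p m \<in> box d p" by (rule mset_mod_box[OF _ p])
        have "?H m = slice p (mset_mod p m) ?H (mset_div p m)"
          by (simp add: slice_def mset_div_mod)
        also have "\<dots> = (diag_op n d ^^ a) (G (mset_mod p m)) (mset_div p m)"
          by (simp only: slice_funpow_diag_op[OF assms D] slice_from[OF \<alpha> G])
        also have "\<dots> = 0"
          using \<alpha> G by (auto simp: diag_kernel_def PiE_def Pi_def)
        finally show ?thesis .
      qed (use HD in \<open>auto simp: dual_space_def\<close>)
      then have "?H = 0" by (simp only: fun_eq_iff zero_fun_apply) blast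
      then show "?from G \<in> diag_kernel n d p (p * q) (p * a)"
        using D by (simp add: diag_kernel_def)
    qed
  next
    fix F assume F: "F \<in> diag_kernel n d p (p * q) (p * a)"
    show "?from (?to F) = F"
    proof
      fix m show "?from (?to F) m = F m"
        using F mset_mod_box[OF _ p, of m d q]
        by (auto simp: slice_def mset_div_mod diag_kernel_def dual_space_def)
    qed
  next
    fix G assume G: "G \<in> box d p \<rightarrow>\<^sub>E diag_kernel n d p q a"
    show "?to (?from G) = G"
      using G by (intro ext) (auto simp: slice_from[OF _ G] PiE_def extensional_def)
  qed
  from bij_betw_same_card[OF this] show ?thesis
    by (simp add: card_PiE finite_box card_box)
qed

subsection \<open>Adding a variable\<close>

text \<open>Terms of the sequence vanish on monomials that involve the variable \<open>v\<close>, so that they are functions of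
  the remaining variables.\<close>

definition parity_part :: "nat \<Rightarrow> nat \<Rightarrow> (nat multiset \<Rightarrow> qz) \<Rightarrow> nat \<Rightarrow> nat multiset \<Rightarrow> qz" where
  "parity_part v \<epsilon> F = (\<lambda>j m. if v \<in># m then 0 else F (m + replicate_mset (2 * j + \<epsilon>) v))"

text \<open>Every monomial is one free of \<open>v\<close> times a power of \<open>v\<close>, whose
  exponent has the form \<open>2 j + \<epsilon>\<close>.\<close>

lemma parity_part_zero_imp:
  assumes "parity_part v 0 F = 0" "parity_part v 1 F = 0"
  shows "F = 0"
proof
  fix m
  define c where "c = count m v"
  define m' where "m' = filter_mset (\<lambda>i. i \<noteq> v) m"
  have m: "m' + replicate_mset (2 * (c div 2) + c mod 2) v = m"
    by (auto simp: c_def m'_def multiset_eq_iff)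
  have "c mod 2 = 0 \<or> c mod 2 = 1" by linarith
  then have "parity_part v (c mod 2) F (c div 2) m' = 0"
    using assms by auto
  then show "F m = 0 m"
    unfolding parity_part_def m by (simp add: m'_def)
qed

locale prime_box =
  fixes n d p :: nat
  assumes prime: "Factorial_Ring.prime p" and n_pos: "n > 0"
begin

lemma p_pos: "p > 0"
  using prime prime_gt_0_nat by blast

text \<open>Every monomial of \<open>f^p\<close> contains at least the \<open>p\<close>-th power of
  a variable (for \<open>x_0\<close> because \<open>n > 0\<close>), and so leads out of the
  box.\<close>

lemma nilpotent_diag_op:
  assumes "F \<in> dual_space d p p"
  shows "(diag_op n d ^^ p) F = 0"
proof -
  have z: "F (m + replicate_mset (p * k) i) = 0" if "i \<le> d" "k > 0" for m i k
  proof -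
    have "p \<le> p * k" using that(2) by simp
    then have nl: "\<not> count m i + p * k < p" by linarith
    have "m + replicate_mset (p * k) i \<notin> box d p"
    proof
      assume "m + replicate_mset (p * k) i \<in> box d p"
      from box_D[OF this that(1)] have "count m i + p * k < p" by simp
      with nl show False by (rule notE)
    qed
    then show ?thesis using assms by (auto simp: dual_space_def)
  qed
  show ?thesis
    using z[of 0 n] z[of _ 2] n_pos
    unfolding funpow_diag_op_prime[OF prime dual_space_torsion[OF assms]] by (simp add: fun_eq_iff)
qed

sublocale nilpotent_operator "dual_space d p p" "diag_op n d" p
  by standard
     (auto simp: prime card_dual_space p_pos subgrp_dual_space dual_space_torsion additive.add[OF additive_diag_op]
       diag_op_dual_space nilpotent_diag_op)

text \<open>The square of the new variable raises the exponent \<open>2 j + \<epsilon>\<close> to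
  \<open>2 (j + 1) + \<epsilon>\<close>, which is the shift, while the other terms act inside each
  entry.\<close>

lemma gshift_parity_part:
  "(gshift ^^ a) (parity_part (Suc d) \<epsilon> F) = parity_part (Suc d) \<epsilon> ((diag_op n (Suc d) ^^ a) F)"
proof (induction a)
  case (Suc a)
  have "gshift (parity_part (Suc d) \<epsilon> G) = parity_part (Suc d) \<epsilon> (diag_op n (Suc d) G)" for G
  proof (intro ext)
    fix j m
    show "gshift (parity_part (Suc d) \<epsilon> G) j m = parity_part (Suc d) \<epsilon> (diag_op n (Suc d) G) j m"
    proof (cases "Suc d \<in># m")
      case True
      then show ?thesis by (simp add: gshift_def diag_op_def parity_part_def)
    next
      case False
      have "replicate_mset (Suc (Suc (2 * j + \<epsilon>))) (Suc d) =
          replicate_mset (2 * j + \<epsilon>) (Suc d) + replicate_mset 2 (Suc d)"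
        by (simp add: multiset_eq_iff)
      then have 1: "m + replicate_mset (Suc (Suc (2 * j + \<epsilon>))) (Suc d) =
          m + replicate_mset (2 * j + \<epsilon>) (Suc d) + replicate_mset 2 (Suc d)"
        by (simp only: add.assoc)
      have "(\<Sum>i\<in>{1..d}. parity_part (Suc d) \<epsilon> G j (m + replicate_mset 2 i)) =
          (\<Sum>i\<in>{1..d}. G (m + replicate_mset (2 * j + \<epsilon>) (Suc d) + replicate_mset 2 i))"
        using False by (intro sum.cong) (auto simp: parity_part_def add_ac)
      moreover have "parity_part (Suc d) \<epsilon> G j (m + replicate_mset n 0) =
          G (m + replicate_mset (2 * j + \<epsilon>) (Suc d) + replicate_mset n 0)"
        using False by (auto simp: parity_part_def add_ac)
      moreover have "parity_part (Suc d) \<epsilon> G (Suc j) m =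
          G (m + replicate_mset (2 * j + \<epsilon>) (Suc d) + replicate_mset 2 (Suc d))"
        unfolding parity_part_def mult_Suc_right add_2_eq_Suc add_Suc 1 using False by simp
      moreover have "parity_part (Suc d) \<epsilon> (diag_op n (Suc d) G) j m =
          diag_op n (Suc d) G (m + replicate_mset (2 * j + \<epsilon>) (Suc d))"
        using False by (simp add: parity_part_def)
      ultimately show ?thesis
        unfolding gshift_def plus_fun_apply diag_op_Suc translate_def
        by (simp only: diag_op_def)
    qed
  qed
  then show ?case by (simp add: Suc)
qed simp

text \<open>Of the exponents below \<open>p = 2 h + 1\<close>, \<open>h + 1\<close> are even and
  \<open>h\<close> are odd. The parities do not mix, since the new variable occurs squared.\<close>

lemma card_diag_kernel_parity:
  assumes h: "p = 2 * h + 1"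
  shows "card (diag_kernel n (Suc d) p p a) = card (seq_kernel a (h + 1)) * card (seq_kernel a h)"
proof -
  let ?v = "Suc d"
  let ?to = "\<lambda>F. (parity_part ?v 0 F, parity_part ?v 1 F)"
  let ?from = "\<lambda>(U, V) m. (if even (count m ?v) then U else V) (count m ?v div 2) (filter_mset (\<lambda>i. i \<noteq> ?v) m)"
  have part_in: "parity_part ?v \<epsilon> F \<in> seq_kernel a (h + 1 - \<epsilon>)"
    if F: "F \<in> diag_kernel n (Suc d) p p a" and \<epsilon>: "\<epsilon> \<le> 1" for F \<epsilon>
  proof -
    have FD: "F \<in> dual_space (Suc d) p p" using F by (simp add: diag_kernel_def)
    have "parity_part ?v \<epsilon> F \<in> seqs"
    proof -
      have "m \<in> box d p" if "m + replicate_mset k ?v \<in> box (Suc d) p" "?v \<notin># m" for m k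
      proof (rule box_I)
        fix i assume "i \<le> d" then show "count m i < p"
          using box_D[OF that(1), of i] by simp
      next
        fix i assume "\<not> i \<le> d" then show "count m i = 0"
          using box_D0[OF that(1), of i] that(2) by (cases "i = ?v") (auto simp: not_in_iff)
      qed
      then show ?thesis
        using FD unfolding seqs_def by (auto simp: dual_space_def parity_part_def)
    qed
    moreover have "(gshift ^^ a) (parity_part ?v \<epsilon> F) = 0"
      using F unfolding gshift_parity_part by (auto simp: diag_kernel_def parity_part_def fun_eq_iff)
    moreover have "parity_part ?v \<epsilon> F j m = 0" if "j \<ge> h + 1 - \<epsilon>" for j m
    proof -
      have "\<not> 2 * j + \<epsilon> < p" using that \<epsilon> h by auto
      then have "m + replicate_mset (2 * j + \<epsilon>) ?v \<notin> box (Suc d) p"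
        using box_D[of "m + replicate_mset (2 * j + \<epsilon>) ?v" "Suc d" p ?v] by auto
      then show ?thesis using FD by (simp add: dual_space_def parity_part_def)
    qed
    ultimately show ?thesis
      unfolding seq_kernel_def funpow_shift_zero_iff by (auto simp: fun_eq_iff)
  qed
  have part_from: "parity_part ?v \<epsilon> (?from (U, V)) = (if \<epsilon> = 0 then U else V)"
    if UV: "U \<in> seq_kernel a (h + 1)" "V \<in> seq_kernel a h" and \<epsilon>: "\<epsilon> = 0 \<or> \<epsilon> = 1" for U V \<epsilon>
  proof (intro ext)
    fix j m
    have z: "W j m = 0" if "W \<in> seqs" "?v \<in># m" for W
    proof -
      have "m \<notin> box d p" using that(2) box_D0[of m d p ?v] by (metis Suc_n_not_le_n not_in_iff)
      then show ?thesis using that(1) unfolding seqs_def by (auto simp: dual_space_def)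
    qed
    have "filter_mset (\<lambda>i. i \<noteq> ?v) m = m" if "?v \<notin># m"
      using that by (auto simp: multiset_eq_iff not_in_iff)
    moreover have [simp]: "filter_mset (\<lambda>i. i \<noteq> ?v) (replicate_mset k ?v) = {#}" for k
      by (auto simp: multiset_eq_iff)
    ultimately show "parity_part ?v \<epsilon> (?from (U, V)) j m = (if \<epsilon> = 0 then U else V) j m"
      using z[of U] z[of V] UV \<epsilon> by (auto simp: parity_part_def seq_kernel_def not_in_iff)
  qed
  have "bij_betw ?to (diag_kernel n (Suc d) p p a) (seq_kernel a (h + 1) \<times> seq_kernel a h)"
  proof (rule bij_betwI[where g = ?from])
    show "?to \<in> diag_kernel n (Suc d) p p a \<rightarrow> seq_kernel a (h + 1) \<times> seq_kernel a h"
      using part_in[of _ 0] part_in[of _ 1] by auto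
  next
    show "?from \<in> seq_kernel a (h + 1) \<times> seq_kernel a h \<rightarrow> diag_kernel n (Suc d) p p a"
    proof (rule Pi_I)
      fix UV assume "UV \<in> seq_kernel a (h + 1) \<times> seq_kernel a h"
      then obtain U V where UV: "UV = (U, V)" "U \<in> seq_kernel a (h + 1)" "V \<in> seq_kernel a h" by auto
      let ?F = "?from (U, V)"
      \<comment> \<open>Support conditions for both parities at once: \<open>b\<close> is
        \<open>h + 1\<close> for even and \<open>h\<close> for odd exponents \<open>c\<close> of the
        new variable.\<close>
      have sup: "smul p (W (c div 2) (filter_mset (\<lambda>i. i \<noteq> ?v) m)) = 0 \<and>
          (m \<notin> box (Suc d) p \<longrightarrow> W (c div 2) (filter_mset (\<lambda>i. i \<noteq> ?v) m) = 0)"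
        if W: "W \<in> seq_kernel a b" and b: "c div 2 < b \<Longrightarrow> c < p" and c: "c = count m ?v" for W b c m
      proof -
        have WD: "W (c div 2) \<in> dual_space d p p" using W by (auto simp: seq_kernel_def seqs_def)
        have "filter_mset (\<lambda>i. i \<noteq> ?v) m \<notin> box d p" if "m \<notin> box (Suc d) p" "c < p"
        proof
          assume b: "filter_mset (\<lambda>i. i \<noteq> ?v) m \<in> box d p"
          have "m \<in> box (Suc d) p"
          proof (rule box_I)
            fix i assume "i \<le> Suc d" then show "count m i < p"
              using box_D[OF b, of i] that(2) c by (cases "i = ?v") auto
          next
            fix i assume "\<not> i \<le> Suc d" then show "count m i = 0"
              using box_D0[OF b, of i] by auto
          qed
          then show False using that by simp
        qed
        moreover have "W (c div 2) = 0" if "\<not> c div 2 < b"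
          using W that unfolding seq_kernel_def funpow_shift_zero_iff by auto
        ultimately show ?thesis
          using WD b by (cases "c div 2 < b") (auto simp: dual_space_def)
      qed
      have in_dual: "?F \<in> dual_space (Suc d) p p"
        unfolding dual_space_def
      proof (intro CollectI allI)
        fix m
        show "smul p (?F m) = 0 \<and> (m \<notin> box (Suc d) p \<longrightarrow> ?F m = 0)"
        proof (cases "even (count m ?v)")
          case True
          have "smul p (U (count m ?v div 2) (filter_mset (\<lambda>i. i \<noteq> ?v) m)) = 0 \<and>
              (m \<notin> box (Suc d) p \<longrightarrow> U (count m ?v div 2) (filter_mset (\<lambda>i. i \<noteq> ?v) m) = 0)"
            by (rule sup[OF UV(2)]) (use True h in auto)
          then show ?thesis using True by simp
        next
          case False
          have "smul p (V (count m ?v div 2) (filter_mset (\<lambda>i. i \<noteq> ?v) m)) = 0 \<and>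
              (m \<notin> box (Suc d) p \<longrightarrow> V (count m ?v div 2) (filter_mset (\<lambda>i. i \<noteq> ?v) m) = 0)"
            by (rule sup[OF UV(3)]) (use False h in \<open>auto elim!: oddE\<close>)
          then show ?thesis using False by simp
        qed
      qed
      have parts: "parity_part ?v 0 ?F = U" "parity_part ?v 1 ?F = V"
        using part_from[OF UV(2,3), of 0] part_from[OF UV(2,3), of 1] by simp_all
      have "(diag_op n (Suc d) ^^ a) ?F = 0"
      proof (rule parity_part_zero_imp)
        show "parity_part ?v 0 ((diag_op n (Suc d) ^^ a) ?F) = 0"
          unfolding gshift_parity_part[symmetric] parts
          using UV(2) by (simp add: seq_kernel_def)
        show "parity_part ?v 1 ((diag_op n (Suc d) ^^ a) ?F) = 0"
          unfolding gshift_parity_part[symmetric] parts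
          using UV(3) by (simp add: seq_kernel_def)
      qed
      with in_dual show "?from UV \<in> diag_kernel n (Suc d) p p a"
        unfolding UV(1) diag_kernel_def by blast
    qed
  next
    fix F assume F: "F \<in> diag_kernel n (Suc d) p p a"
    show "?from (?to F) = F"
    proof
      fix m
      let ?c = "count m ?v"
      have m: "filter_mset (\<lambda>i. i \<noteq> ?v) m + replicate_mset ?c ?v = m"
        by (auto simp: multiset_eq_iff)
      show "?from (?to F) m = F m"
        using m by (auto simp: parity_part_def elim: oddE)
    qed
  next
    fix UV assume "UV \<in> seq_kernel a (h + 1) \<times> seq_kernel a h"
    then obtain U V where UV: "UV = (U, V)" "U \<in> seq_kernel a (h + 1)" "V \<in> seq_kernel a h" by auto
    show "?to (?from UV) = UV"
      unfolding UV(1) using part_from[OF UV(2,3), of 0] part_from[OF UV(2,3), of 1] by simp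
  qed
  from bij_betw_same_card[OF this] show ?thesis
    by (simp add: card_cartesian_product)
qed

end

lemma card_diag_kernel_0:
  assumes "p > 0"
  shows "card (diag_kernel n 0 p q a) = p ^ (min (a * n) q)"
proof -
  have eq: "diag_op n 0 = translate (replicate_mset n 0)"
    by (auto simp: diag_op_def translate_def)
  have 1: "(diag_op n 0 ^^ a) F = translate (replicate_mset (a * n) 0) F" for F
    unfolding eq by (subst funpow_translate, subst repeat_replicate_mset) (rule refl)
  have "diag_kernel n 0 p q a = dual_space 0 p (min (a * n) q)"
  proof (intro subset_antisym subsetI)
    fix F assume F: "F \<in> diag_kernel n 0 p q a"
    show "F \<in> dual_space 0 p (min (a * n) q)"
      unfolding dual_space_def
    proof (intro CollectI allI conjI impI)
      fix m assume m: "m \<notin> box 0 (min (a * n) q)"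
      show "F m = 0"
      proof (cases "m \<in> box 0 q")
        case True
        then have "a * n \<le> count m 0"
          using m by (auto simp: box_def split: if_splits)
        \<comment> \<open>This exhibits \<open>F m\<close> as a value of the translate that
          vanishes.\<close>
        then have "m = m - replicate_mset (a * n) 0 + replicate_mset (a * n) 0"
          by (auto simp: multiset_eq_iff)
        then show ?thesis
          using F by (auto simp: diag_kernel_def 1 translate_def fun_eq_iff) metis
      qed (use F in \<open>auto simp: diag_kernel_def dual_space_def\<close>)
    qed (use F in \<open>auto simp: diag_kernel_def dual_space_def\<close>)
  next
    fix F assume F: "F \<in> dual_space 0 p (min (a * n) q)"
    have "box 0 (min (a * n) q) \<subseteq> box 0 q"
      by (auto simp: box_def split: if_splits)
    moreover have "m + replicate_mset (a * n) 0 \<notin> box 0 (min (a * n) q)" for m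
      using box_D[of "m + replicate_mset (a * n) 0" 0 "min (a * n) q" 0] by auto
    ultimately show "F \<in> diag_kernel n 0 p q a"
      using F by (auto simp: diag_kernel_def dual_space_def 1 translate_def fun_eq_iff)
  qed
  then show ?thesis by (simp add: card_dual_space assms)
qed

subsection \<open>The recursion for the lengths\<close>

text \<open>The dimension over \<open>F_p\<close>, read off from the number of elements.\<close>

definition kernel_dim :: "nat \<Rightarrow> nat \<Rightarrow> nat \<Rightarrow> nat \<Rightarrow> nat \<Rightarrow> real" where
  "kernel_dim n d p q a = log p (card (diag_kernel n d p q a))"

lemma kernel_dim_0:
  assumes "p > 1"
  shows "kernel_dim n 0 p q a = min (a * n) q"
  using assms by (simp add: kernel_dim_def card_diag_kernel_0)

lemma kernel_dim_mono:
  assumes "p > 1" "a \<le> b"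
  shows "kernel_dim n d p q a \<le> kernel_dim n d p q b"
  using assms card_diag_kernel_pos[of p n d q a] card_diag_kernel_pos[of p n d q b]
    card_mono[OF finite_diag_kernel diag_kernel_mono[OF assms(2)], of p n d q]
  by (simp add: kernel_dim_def)

lemma kernel_dim_frobenius:
  assumes "Factorial_Ring.prime p"
  shows "kernel_dim n d p (p * q) (p * a) = p ^ (d + 1) * kernel_dim n d p q a"
proof -
  have p: "p > 1" using assms prime_gt_1_nat by blast
  then show ?thesis
    using card_diag_kernel_pos[of p n d q a]
    by (simp add: kernel_dim_def card_diag_kernel_frobenius[OF assms] log_nat_power)
qed

lemma sum_even_odd: "(\<Sum>i<a. f (2 * i) + f (2 * i + 1)) = (\<Sum>j<2 * a. f j)"
  for f :: "nat \<Rightarrow> 'a::comm_monoid_add"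
  by (induction a) (simp_all add: add.assoc)

context prime_box
begin

definition seq_dim :: "nat \<Rightarrow> nat \<Rightarrow> real" where
  "seq_dim a b = log p (card (seq_kernel a b))"

lemma p_gt_1: "p > 1"
  using prime prime_gt_1_nat by blast

lemma card_seq_kernel_pos: "card (seq_kernel a b) > 0"
  using finite_seq_kernel subgrp_zero[OF subgrp_seq_kernel, of a b] by (auto simp: card_gt_0_iff)

lemma seq_dim_Suc:
  assumes "a + b < p"
  shows "seq_dim (Suc a) (Suc b) = kernel_dim n d p p (a + b + 1) + seq_dim a b"
  using card_diag_kernel_pos[OF p_pos, of n d p "a + b + 1"] card_seq_kernel_pos[of a b]
  unfolding seq_dim_def kernel_dim_def card_seq_kernel_Suc[OF assms] diag_kernel_def
  by (simp add: log_mult del: funpow.simps)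

text \<open>Each use of \<open>seq_dim_Suc\<close> lowers \<open>a\<close> and \<open>b\<close> by
  one: \<open>b - a\<close> stays, and the arguments \<open>a + b - 1, a + b - 3, ...\<close>
  descend to \<open>b - a + 1\<close>.\<close>

lemma seq_dim_sum:
  "a \<le> b \<Longrightarrow> a + b \<le> p + 1 \<Longrightarrow> seq_dim a b = (\<Sum>i<a. kernel_dim n d p p (b - a + 2 * i + 1))"
proof (induction a arbitrary: b)
  case 0
  then show ?case by (simp add: seq_dim_def seq_kernel_zero)
next
  case (Suc a)
  then obtain b' where b: "b = Suc b'" by (cases b) auto
  have "seq_dim (Suc a) b = kernel_dim n d p p (a + b' + 1) + seq_dim a b'"
    unfolding b using Suc.prems b by (intro seq_dim_Suc) simp
  also have "seq_dim a b' = (\<Sum>i<a. kernel_dim n d p p (b' - a + 2 * i + 1))"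
    using Suc.prems b by (intro Suc.IH) auto
  also have "a + b' + 1 = b' - a + 2 * a + 1"
    using Suc.prems b by simp
  finally show ?case
    by (simp add: b)
qed

lemma kernel_dim_Suc:
  assumes "p = 2 * h + 1"
  shows "kernel_dim n (Suc d) p p a = seq_dim a (h + 1) + seq_dim a h"
  using card_seq_kernel_pos[of a "h + 1"] card_seq_kernel_pos[of a h]
  unfolding kernel_dim_def card_diag_kernel_parity[OF assms] seq_dim_def
  by (simp add: log_mult)

text \<open>\<open>seq_dim a h\<close> contributes the arguments
  \<open>h - a + 1, h - a + 3, ...\<close> and \<open>seq_dim a (h + 1)\<close> their successors;
  together they exhaust \<open>h - a < j \<le> h + a\<close>.\<close>

lemma kernel_dim_Suc_low:
  assumes "p = 2 * h + 1" "a \<le> h"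
  shows "kernel_dim n (Suc d) p p a = (\<Sum>j<2 * a. kernel_dim n d p p (h - a + 1 + j))"
proof -
  let ?f = "\<lambda>j. kernel_dim n d p p (h - a + 1 + j)"
  have "seq_dim a h = (\<Sum>i<a. ?f (2 * i))"
    using assms by (subst seq_dim_sum) (auto intro!: sum.cong simp: add_ac)
  moreover have "seq_dim a (h + 1) = (\<Sum>i<a. ?f (2 * i + 1))"
    using assms by (subst seq_dim_sum) (auto intro!: sum.cong simp: add_ac Suc_diff_le)
  ultimately show ?thesis
    unfolding kernel_dim_Suc[OF assms(1)] sum_even_odd[symmetric] by (simp add: sum.distrib)
qed

lemma seq_dim_dual:
  assumes "a \<le> p" "b \<le> p"
  shows "seq_dim a b + (real p - real b) * p ^ (d + 1) = seq_dim (p - a) (p - b) + real a * p ^ (d + 1)"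
proof -
  define N where "N = p ^ (d + 1)"
  have "real (card (seq_kernel a b) * (p ^ N) ^ (p - b)) = real (card (seq_kernel (p - a) (p - b)) * (p ^ N) ^ a)"
    using card_seq_kernel_dual[OF assms] by (simp add: card_dual_space p_pos N_def)
  then have "log p (real (card (seq_kernel a b)) * real p ^ (N * (p - b))) =
      log p (real (card (seq_kernel (p - a) (p - b))) * real p ^ (N * a))"
    by (simp add: power_mult)
  then have "seq_dim a b + real (N * (p - b)) = seq_dim (p - a) (p - b) + real (N * a)"
    using card_seq_kernel_pos p_gt_1 by (simp add: log_mult log_nat_power seq_dim_def)
  then show ?thesis
    using assms by (simp add: N_def of_nat_diff mult.commute)
qed

text \<open>As \<open>p - (h + 1) = h\<close>, the duality interchanges the two summands of
  \<open>kernel_dim_Suc\<close>.\<close>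

lemma kernel_dim_Suc_dual:
  assumes "p = 2 * h + 1" "a \<le> p"
  shows "kernel_dim n (Suc d) p p a =
    kernel_dim n (Suc d) p p (p - a) + (2 * real a - real p) * p ^ (d + 1)"
proof -
  have "p - (h + 1) = h" "p - h = h + 1" "h + 1 \<le> p" "h \<le> p" "real p = 2 * real h + 1"
    using assms(1) by auto
  then show ?thesis
    using seq_dim_dual[OF assms(2), of "h + 1"] seq_dim_dual[OF assms(2), of h]
    unfolding kernel_dim_Suc[OF assms(1)] by (simp add: algebra_simps)
qed

end

subsection \<open>Euler polynomials\<close>

definition euler_number_fps :: "real fps" where
  "euler_number_fps = 2 * inverse (fps_exp 1 + 1)"

lemma euler_poly_altdef: "euler_poly k x = fact k * fps_nth (fps_exp x * euler_number_fps) k"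
proof -
  have "2 * fps_exp x / (fps_exp 1 + 1) = fps_exp x * euler_number_fps"
    by (subst fps_divide_unit) (simp_all add: euler_number_fps_def algebra_simps)
  then show ?thesis by (simp add: euler_poly_def)
qed

lemma euler_number_fps_mult: "euler_number_fps * (fps_exp 1 + 1) = 2"
proof -
  have "(fps_exp 1 + 1 :: real fps) * inverse (fps_exp 1 + 1) = 1"
    by (rule inverse_mult_eq_1') simp
  then show ?thesis
    unfolding euler_number_fps_def by (metis mult.assoc mult.commute mult.right_neutral)
qed

text \<open>Multiplication by \<open>e^z + 1\<close> clears the denominator of the generating
  function.\<close>

lemma euler_poly_add_one: "euler_poly k (x + 1) + euler_poly k x = 2 * x ^ k"
proof -
  have "fps_exp (x + 1) * euler_number_fps + fps_exp x * euler_number_fps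
      = fps_exp x * (euler_number_fps * (fps_exp 1 + 1))"
    by (simp add: fps_exp_add_mult algebra_simps)
  also have "\<dots> = 2 * fps_exp x"
    by (simp add: euler_number_fps_mult mult.commute)
  finally have "fps_nth (fps_exp (x + 1) * euler_number_fps) k + fps_nth (fps_exp x * euler_number_fps) k
      = fps_nth (2 * fps_exp x) k"
    by (metis fps_add_nth)
  also have "\<dots> = 2 * (x ^ k / fact k)"
    by (simp add: numeral_fps_const)
  finally have "fps_nth (fps_exp (x + 1) * euler_number_fps) k + fps_nth (fps_exp x * euler_number_fps) k
      = 2 * (x ^ k / fact k)" .
  then show ?thesis
    by (simp add: euler_poly_altdef distrib_left[symmetric])
qed

text \<open>Replacing \<open>z\<close> by \<open>- z\<close> in the generating function has the same
  effect as replacing \<open>x\<close> by \<open>1 - x\<close>.\<close>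

lemma euler_poly_reflect: "euler_poly k (1 - x) = (- 1) ^ k * euler_poly k x"
proof -
  define B where "B = (\<lambda>x. fps_exp x * euler_number_fps)"
  have B: "B x * (fps_exp 1 + 1) = 2 * fps_exp x" for x
    by (simp add: B_def euler_number_fps_mult mult.assoc mult.commute)
  have "(B x oo - fps_X) * (fps_exp (- 1) + 1) = 2 * fps_exp (- x)"
    using arg_cong[OF B[of x], of "\<lambda>f. f oo - fps_X"]
    by (simp add: fps_compose_mult_distrib fps_compose_add_distrib)
  \<comment> \<open>The factor \<open>e^z\<close> turns \<open>e^(-z) + 1\<close> into
    \<open>e^z + 1\<close>, which can then be cancelled.\<close>
  then have "(B x oo - fps_X) * ((fps_exp (- 1) + 1) * fps_exp 1) = 2 * (fps_exp (- x) * fps_exp 1)"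
    by (metis mult.assoc)
  then have "(B x oo - fps_X) * (fps_exp 1 + 1) = B (1 - x) * (fps_exp 1 + 1)"
    unfolding B by (simp add: distrib_right fps_exp_add_mult[symmetric] add.commute)
  moreover have "(fps_exp 1 + 1 :: real fps) \<noteq> 0"
  proof
    assume "(fps_exp 1 + 1 :: real fps) = 0"
    then have "fps_nth (fps_exp 1 + 1 :: real fps) 0 = 0" by simp
    then show False by simp
  qed
  ultimately have "B (1 - x) = B x oo - fps_X" by simp
  then have "fps_nth (B (1 - x)) k = (- 1) ^ k * fps_nth (B x) k"
    by (simp add: fps_compose_uminus')
  then show ?thesis
    by (simp add: euler_poly_altdef B_def)
qed

lemma euler_poly_sum:
  "euler_poly k x = (\<Sum>i\<le>k. fact k * fps_nth euler_number_fps (k - i) / fact i * x ^ i)"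
  unfolding euler_poly_altdef fps_mult_nth atLeast0AtMost sum_distrib_left
  by (intro sum.cong) simp_all

lemma DERIV_euler_poly:
  "(euler_poly (Suc k) has_real_derivative real (Suc k) * euler_poly k x) (at x)"
proof -
  have "((\<lambda>x. \<Sum>i\<le>Suc k. fact (Suc k) * fps_nth euler_number_fps (Suc k - i) / fact i * x ^ i)
      has_real_derivative
      (\<Sum>i\<le>Suc k. fact (Suc k) * fps_nth euler_number_fps (Suc k - i) / fact i * (real i * x ^ (i - 1)))) (at x)"
    using DERIV_pow[of _ x] by (intro DERIV_sum DERIV_cmult) simp
  moreover have "(\<Sum>i\<le>Suc k. fact (Suc k) * fps_nth euler_number_fps (Suc k - i) / fact i * (real i * x ^ (i - 1)))
      = (\<Sum>i\<le>k. fact (Suc k) * fps_nth euler_number_fps (k - i) / fact (Suc i) * (real (Suc i) * x ^ i))"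
    by (subst sum.atMost_Suc_shift) simp
  moreover have "\<dots> = real (Suc k) * euler_poly k x"
    unfolding euler_poly_sum sum_distrib_left
    by (intro sum.cong refl) (simp add: field_simps del: of_nat_Suc)
  moreover have "euler_poly (Suc k) =
      (\<lambda>x. \<Sum>i\<le>Suc k. fact (Suc k) * fps_nth euler_number_fps (Suc k - i) / fact i * x ^ i)"
    using euler_poly_sum by blast
  ultimately show ?thesis by simp
qed

lemma continuous_euler_poly [continuous_intros]: "continuous_on S (euler_poly k)"
  unfolding euler_poly_sum by (intro continuous_intros)

lemma euler_poly_1: "euler_poly 1 x = x - 1 / 2"
proof -
  have 0: "euler_poly 0 0 = 1"
    using euler_poly_add_one[of 0 0] by (simp add: euler_poly_sum)
  have 1: "euler_poly 1 x = fps_nth euler_number_fps 1 + euler_poly 0 0 * x" for x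
    by (simp add: euler_poly_sum)
  have "euler_poly 1 1 + euler_poly 1 0 = 0"
    using euler_poly_add_one[of 1 0] by simp
  then have "fps_nth euler_number_fps 1 = - 1 / 2"
    unfolding 1 0 by simp
  then show ?thesis unfolding 1 0 by simp
qed

text \<open>On \<open>[-1, 2]\<close> the next function is the continuous function which agrees with the Euler polynomial
  on \<open>[0, 1]\<close> and changes its sign under \<open>x \<mapsto> x + 1\<close>.\<close>

definition euler_periodic :: "nat \<Rightarrow> real \<Rightarrow> real" where
  "euler_periodic m x = euler_poly m x - 2 * min x 0 ^ m - 2 * max (x - 1) 0 ^ m"

lemma continuous_euler_periodic: "continuous_on S (euler_periodic m)"
  unfolding euler_periodic_def by (intro continuous_intros)

text \<open>On \<open>[-1, 1]\<close> the truncated powers that remain are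
  \<open>min x 0 ^ m\<close> and \<open>max x 0 ^ m\<close>; they add up to \<open>x ^ m\<close> and
  so cancel the right-hand side of \<open>euler_poly_add_one\<close>.\<close>

lemma euler_periodic_add_one:
  assumes "m > 0" "x \<in> {-1..1}"
  shows "euler_periodic m (x + 1) = - euler_periodic m x"
proof -
  have "min (x + 1) 0 = 0" "max (x - 1) 0 = 0" "max (x + 1 - 1) 0 = max x 0"
    using assms(2) by auto
  moreover have "min x 0 ^ m + max x 0 ^ m = x ^ m"
    using assms(1) by (cases "x \<le> 0") (auto simp: min_def max_def)
  ultimately show ?thesis
    using assms(1) euler_poly_add_one[of m x] by (simp add: euler_periodic_def)
qed

lemma euler_periodic_reflect: "euler_periodic m (1 - x) = (- 1) ^ m * euler_periodic m x"
proof -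
  have "min (1 - x) 0 = - 1 * max (x - 1) 0" "max (1 - x - 1) 0 = - 1 * min x 0"
    by (auto simp: min_def max_def)
  then show ?thesis
    unfolding euler_periodic_def euler_poly_reflect
    by (simp only: power_mult_distrib) (simp add: algebra_simps)
qed

text \<open>Only the point 0 needs care: the difference quotient there is
  \<open>max h 0 ^ m\<close>, which tends to 0 since \<open>m > 0\<close>.\<close>

lemma DERIV_max_power:
  assumes "m > 0"
  shows "((\<lambda>x::real. max x 0 ^ Suc m) has_real_derivative real (Suc m) * max x 0 ^ m) (at x)"
proof -
  consider "x > 0" | "x < 0" | "x = 0" by linarith
  then show ?thesis
  proof cases
    case 1
    have "((\<lambda>x::real. x ^ Suc m) has_real_derivative real (Suc m) * x ^ m) (at x)"
      using DERIV_pow[of "Suc m" x] by simp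
    then have "((\<lambda>x::real. max x 0 ^ Suc m) has_real_derivative real (Suc m) * x ^ m) (at x)"
      by (rule has_field_derivative_transform_within_open[of _ _ _ "{0<..}"]) (use 1 in auto)
    then show ?thesis using 1 by simp
  next
    case 2
    have "((\<lambda>x::real. 0) has_real_derivative 0) (at x)" by simp
    then have "((\<lambda>x::real. max x 0 ^ Suc m) has_real_derivative 0) (at x)"
      by (rule has_field_derivative_transform_within_open[of _ _ _ "{..<0}"]) (use 2 in auto)
    moreover have "max x 0 = 0" using 2 by simp
    ultimately show ?thesis using assms by (simp add: zero_power del: power_Suc)
  next
    case 3
    have "((\<lambda>h::real. max h 0 ^ m) \<longlongrightarrow> max 0 0 ^ m) (at 0)"
      by (intro tendsto_intros)
    moreover have "\<forall>\<^sub>F h in at 0. max h 0 ^ m = (max (0 + h) 0 ^ Suc m - max 0 0 ^ Suc m) / (h::real)"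
      using assms by (auto simp: eventually_at_filter max_def intro!: always_eventually)
    ultimately have "((\<lambda>h::real. (max (0 + h) 0 ^ Suc m - max 0 0 ^ Suc m) / h) \<longlongrightarrow> max 0 0 ^ m) (at 0)"
      by (rule Lim_transform_eventually)
    then show ?thesis
      using 3 assms by (simp add: DERIV_def zero_power)
  qed
qed

lemma DERIV_min_power:
  assumes "m > 0"
  shows "((\<lambda>x::real. min x 0 ^ Suc m) has_real_derivative real (Suc m) * min x 0 ^ m) (at x)"
proof -
  have eq: "min x 0 = - 1 * max (- x) 0" for x :: real
    by (auto simp: min_def max_def)
  have "((\<lambda>x. (- 1) ^ Suc m * max (- x) 0 ^ Suc m) has_real_derivative
      (- 1) ^ Suc m * (real (Suc m) * max (- x) 0 ^ m * (- 1))) (at x)"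
    by (intro DERIV_cmult DERIV_chain2[OF DERIV_max_power[OF assms]] DERIV_minus DERIV_ident)
  then show ?thesis
    unfolding eq power_mult_distrib by (simp add: mult_ac)
qed

lemma DERIV_euler_periodic:
  assumes "m > 0"
  shows "(euler_periodic (Suc m) has_real_derivative real (Suc m) * euler_periodic m x) (at x)"
proof -
  have "((\<lambda>x. max (x - 1) 0 ^ Suc m) has_real_derivative real (Suc m) * max (x - 1) 0 ^ m * 1) (at x)"
    by (intro DERIV_chain2[OF DERIV_max_power[OF assms]] derivative_eq_intros) auto
  then have "((\<lambda>x. euler_poly (Suc m) x - 2 * min x 0 ^ Suc m - 2 * max (x - 1) 0 ^ Suc m) has_real_derivative
      real (Suc m) * euler_poly m x - 2 * (real (Suc m) * min x 0 ^ m) - 2 * (real (Suc m) * max (x - 1) 0 ^ m * 1)) (at x)"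
    by (intro DERIV_diff DERIV_cmult DERIV_euler_poly DERIV_min_power assms)
  then show ?thesis
    unfolding euler_periodic_def by (simp add: algebra_simps)
qed

subsection \<open>The limit function\<close>

text \<open>One expression for all three pieces of the formula, with \<open>d + 1\<close> for
  \<open>m\<close>; \<open>limit_fun_pieces\<close> recovers them.\<close>

definition limit_fun :: "nat \<Rightarrow> nat \<Rightarrow> real \<Rightarrow> real" where
  "limit_fun m n x = x + c_const m n *
     (euler_periodic m (a_const m n + x) - euler_periodic m (a_const m n - x))"

lemma continuous_limit_fun: "continuous_on S (limit_fun m n)"
  unfolding limit_fun_def
  by (intro continuous_intros continuous_on_compose2[OF continuous_euler_periodic[of UNIV]]) auto

lemma a_const_bounds: "n \<ge> 2 \<Longrightarrow> 0 \<le> a_const m n" "n \<ge> 2 \<Longrightarrow> a_const m n \<le> 1 / 2"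
  by (auto simp: a_const_def field_simps)

lemma a_const_Suc: "a_const (Suc m) n = 1 / 2 - a_const m n"
  by (simp add: a_const_def)

lemma c_const_Suc: "c_const (Suc m) n = 2 * (- 1) ^ m * c_const m n / real (Suc m)"
proof -
  have "(- 1) ^ (Suc m div 2) = (- 1) ^ m * (- 1 :: real) ^ (m div 2)"
    by (cases "even m") (auto elim!: evenE oddE)
  moreover have "(2::real) powi (int (Suc m) - 3) = 2 * 2 powi (int m - 3)"
    using power_int_add[of "2::real" "int m - 3" 1] by (simp add: algebra_simps)
  ultimately show ?thesis
    unfolding c_const_def by (simp add: field_simps)
qed

text \<open>The limit form of \<open>kernel_dim_Suc_dual\<close>. A unit shift of the argument
  changes the sign of \<open>euler_periodic\<close>, so passing to \<open>1 - x\<close> leaves the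
  difference in \<open>limit_fun\<close> unchanged.\<close>

lemma limit_fun_reflect:
  assumes "n \<ge> 2" "m > 0" "x \<in> {0..1}"
  shows "limit_fun m n (1 - x) = limit_fun m n x + 1 - 2 * x"
  using euler_periodic_add_one[OF assms(2), of "a_const m n - x"]
    euler_periodic_add_one[OF assms(2), of "a_const m n + x - 1"] assms(3) a_const_bounds[OF assms(1), of m]
  by (simp add: limit_fun_def algebra_simps)

text \<open>The limit form of \<open>kernel_dim_Suc_low\<close>, the integral over
  \<open>[1/2 - x, 1/2 + x]\<close> being expressed by an antiderivative.\<close>

lemma limit_fun_antiderivative:
  assumes "n \<ge> 2" "m > 0"
  obtains H where "\<And>x. (H has_real_derivative limit_fun m n x) (at x)"
    "\<And>x. x \<in> {0..1/2} \<Longrightarrow> H (1 / 2 + x) - H (1 / 2 - x) = limit_fun (Suc m) n x"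
proof
  define a c where "a = a_const m n" and "c = c_const m n"
  define H where "H = (\<lambda>x. x ^ 2 / 2 + c / real (Suc m) *
    (euler_periodic (Suc m) (a + x) + euler_periodic (Suc m) (a - x)))"
  show "(H has_real_derivative limit_fun m n x) (at x)" for x
  proof -
    have "((\<lambda>x. euler_periodic (Suc m) (a + x)) has_real_derivative real (Suc m) * euler_periodic m (a + x) * 1) (at x)"
      by (rule DERIV_chain2[OF DERIV_euler_periodic[OF assms(2)]]) (auto intro!: derivative_eq_intros)
    moreover have "((\<lambda>x. euler_periodic (Suc m) (a - x)) has_real_derivative real (Suc m) * euler_periodic m (a - x) * (- 1)) (at x)"
      by (rule DERIV_chain2[OF DERIV_euler_periodic[OF assms(2)]]) (auto intro!: derivative_eq_intros)
    moreover have "((\<lambda>x. x ^ 2 / 2) has_real_derivative x) (at x)"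
      by (auto intro!: derivative_eq_intros)
    ultimately have "(H has_real_derivative x + c / real (Suc m) *
        (real (Suc m) * euler_periodic m (a + x) * 1 + real (Suc m) * euler_periodic m (a - x) * (- 1))) (at x)"
      unfolding H_def by (intro DERIV_add DERIV_cmult)
    moreover have "real (Suc m) * u * 1 + real (Suc m) * v * (- 1) = real (Suc m) * (u - v)" for u v
      by (simp add: algebra_simps)
    ultimately show ?thesis
      by (simp add: limit_fun_def a_def c_def del: of_nat_Suc)
  qed
  fix x :: real assume x: "x \<in> {0..1/2}"
  have a: "0 \<le> a" "a \<le> 1 / 2" using a_const_bounds[OF assms(1)] by (auto simp: a_def)
  \<comment> \<open>Since \<open>x\<close> and \<open>a\<close> lie in \<open>[0, 1/2]\<close>, the
    arguments on the left lie in \<open>[-1, 1]\<close>, where the sign change under a unit shift is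
    available.\<close>
  have 1: "euler_periodic (Suc m) (a - (1 / 2 + x)) = - euler_periodic (Suc m) (a + (1 / 2 - x))"
    using euler_periodic_add_one[of "Suc m" "a - (1 / 2 + x)"] x a by (simp add: algebra_simps)
  have 2: "euler_periodic (Suc m) (a - (1 / 2 - x)) = - euler_periodic (Suc m) (a + (1 / 2 + x))"
    using euler_periodic_add_one[of "Suc m" "a - (1 / 2 - x)"] x a by (simp add: algebra_simps)
  \<comment> \<open>With \<open>a' = 1/2 - a\<close>, the constant for \<open>Suc m\<close>, the
    argument is \<open>1 - (a' - x)\<close>; the reflection thus brings in the next
    constant.\<close>
  have 3: "euler_periodic (Suc m) (a + (1 / 2 + x)) = - ((- 1) ^ m) * euler_periodic (Suc m) (a_const (Suc m) n - x)"
    using euler_periodic_reflect[of "Suc m" "a_const (Suc m) n - x"]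
    by (simp add: a_const_Suc a_def algebra_simps)
  have 4: "euler_periodic (Suc m) (a + (1 / 2 - x)) = - ((- 1) ^ m) * euler_periodic (Suc m) (a_const (Suc m) n + x)"
    using euler_periodic_reflect[of "Suc m" "a_const (Suc m) n + x"]
    by (simp add: a_const_Suc a_def algebra_simps)
  show "H (1 / 2 + x) - H (1 / 2 - x) = limit_fun (Suc m) n x"
  proof -
    have sq: "(1 / 2 + x) ^ 2 / 2 - (1 / 2 - x) ^ 2 / 2 = x"
      by (simp add: power2_eq_square field_simps)
    have *: "A + c / S * (P + - Q) - (B + c / S * (Q + - P)) = (A - B) + 2 * c / S * (P - Q)"
      for A B P Q S :: real
      by (simp add: divide_inverse algebra_simps)
    have **: "2 * c / S * (- s * u - - s * v) = 2 * s * c / S * (v - u)" for s u v S :: real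
      by (simp add: divide_inverse algebra_simps)
    show ?thesis
      unfolding H_def 1 2 * sq unfolding 3 4 unfolding ** unfolding limit_fun_def c_const_Suc c_def ..
  qed
qed

text \<open>The pieces differ in the unit intervals that contain \<open>a + x\<close> and
  \<open>a - x\<close>; a unit shift with change of sign moves both arguments into
  \<open>[0, 1]\<close>.\<close>

lemma limit_fun_pieces:
  assumes n: "n \<ge> 2" and m: "m > 0" and a: "a = a_const m n" and c: "c = c_const m n"
  shows "x \<in> {0..a} \<Longrightarrow> limit_fun m n x = x + c * (euler_poly m (x + a) - euler_poly m (- x + a))"
    and "x \<in> {a..1 - a} \<Longrightarrow> limit_fun m n x = x + c * (euler_poly m (x + a) + euler_poly m (- x + 1 + a))"
    and "x \<in> {1 - a..1} \<Longrightarrow>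
      limit_fun m n x = x + c * (- euler_poly m (x - 1 + a) + euler_poly m (- x + 1 + a))"
proof -
  have ab: "0 \<le> a" "a \<le> 1 / 2" using a_const_bounds[OF n] by (auto simp: a)
  have mid: "euler_periodic m y = euler_poly m y" if "y \<in> {0..1}" for y
    using that m by (simp add: euler_periodic_def)
  have neg: "euler_periodic m y = - euler_poly m (y + 1)" if "y \<in> {-1..0}" for y
    using euler_periodic_add_one[OF m, of y] mid[of "y + 1"] that by simp
  have pos: "euler_periodic m y = - euler_poly m (y - 1)" if "y \<in> {1..2}" for y
    using euler_periodic_add_one[OF m, of "y - 1"] mid[of "y - 1"] that by simp
  show "limit_fun m n x = x + c * (euler_poly m (x + a) - euler_poly m (- x + a))" if "x \<in> {0..a}"
    using that ab mid[of "a + x"] mid[of "a - x"] by (simp add: limit_fun_def a c algebra_simps)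
  show "limit_fun m n x = x + c * (euler_poly m (x + a) + euler_poly m (- x + 1 + a))" if "x \<in> {a..1 - a}"
    using that ab mid[of "a + x"] neg[of "a - x"] by (simp add: limit_fun_def a c algebra_simps)
  show "limit_fun m n x = x + c * (- euler_poly m (x - 1 + a) + euler_poly m (- x + 1 + a))" if "x \<in> {1 - a..1}"
    using that ab pos[of "a + x"] neg[of "a - x"] by (simp add: limit_fun_def a c algebra_simps)
qed

text \<open>\<open>limit_fun 1 n x\<close> is \<open>x - 1/2\<close> plus half the symmetrization of
  \<open>min (n x) 1\<close>, the limit length in one variable. The term \<open>x - 1/2\<close>
  changes its sign under \<open>x \<mapsto> 1 - x\<close> and drops out of the sum.\<close>

lemma limit_fun_1_sum:
  assumes "n > 0" "x \<in> {0..1}"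
  shows "limit_fun 1 n x + limit_fun 1 n (1 - x) = min (real n * x) 1 + min (real n * (1 - x)) 1"
proof -
  have "limit_fun 1 n x = x - 1 / 2 + (min (real n * x) 1 + min (real n * (1 - x)) 1) / 2"
    if x: "x \<in> {0..1}" for x :: real
  proof -
    have n: "real n \<ge> 1" using assms by simp
    have 1: "max (1 / real n + x - 1) 0 = max (1 + real n * x - real n) 0 / real n"
      using n by (auto simp: max_def field_simps)
    have 2: "min (1 / real n - x) 0 = min (1 - real n * x) 0 / real n"
      using n by (auto simp: min_def field_simps)
    have 3: "1 / real n \<le> 1" "0 < 1 / real n" using n by auto
    have "1 / real n - x - 1 \<le> 0" "0 \<le> 1 / real n + x"
      using x 3 unfolding atLeastAtMost_iff by linarith+
    then have 4: "max (1 / real n - x - 1) 0 = 0" "min (1 / real n + x) 0 = 0"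
      by (simp_all only: max_absorb2 min_absorb2)
    \<comment> \<open>Here the constants are \<open>1 / n\<close> and \<open>n / 4\<close>, and the
      first Euler polynomial contributes \<open>2 x\<close>.\<close>
    have "limit_fun 1 n x = x + real n / 4 * (2 * x - 2 * (max (1 + real n * x - real n) 0 / real n)
        + 2 * (min (1 - real n * x) 0 / real n))"
      unfolding limit_fun_def euler_periodic_def euler_poly_1 a_const_def c_const_def power_one_right
      by (simp add: 1 2 4 power_int_minus)
    also have "\<dots> = x + (real n * x - max (1 + real n * x - real n) 0 + min (1 - real n * x) 0) / 2"
      using n by (simp add: field_simps)
    also have "max (1 + real n * x - real n) 0 = 1 - min (real n * (1 - x)) 1"
      by (auto simp: max_def min_def algebra_simps)
    also have "min (1 - real n * x) 0 = min (real n * x) 1 * (- 1) + 2 * min (real n * x) 1 - real n * x"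
      by (auto simp: min_def)
    finally show ?thesis by (simp add: field_simps)
  qed
  note eq = this
  have "limit_fun 1 n (1 - x) = (1 - x) - 1 / 2 + (min (real n * (1 - x)) 1 + min (real n * x) 1) / 2"
    using eq[of "1 - x"] assms(2) by simp
  moreover have "p = x - 1 / 2 + (u + v) / 2 \<Longrightarrow> q = 1 - x - 1 / 2 + (v + u) / 2 \<Longrightarrow> p + q = u + v"
    for p q u v :: real by (simp add: field_simps)
  ultimately show ?thesis using eq[OF assms(2)] by blast
qed

subsection \<open>Asymptotics of the recursion\<close>

text \<open>The points are the midpoints of \<open>2 a\<close> cells of width \<open>1 / p\<close>,
  where \<open>p = 2 h + 1\<close>, that tile \<open>[1/2 - a/p, 1/2 + a/p]\<close>. The mean value
  theorem on each cell and the uniform continuity of \<open>g\<close> make the bound uniform in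
  \<open>a\<close>.\<close>

lemma midpoint_rule:
  fixes g H :: "real \<Rightarrow> real"
  assumes cont: "continuous_on {0..1} g" and deriv: "\<And>x. (H has_real_derivative g x) (at x)"
    and e: "e > 0"
  shows "\<exists>P. \<forall>h a. 2 * h + 1 \<ge> P \<longrightarrow> a \<le> h \<longrightarrow>
    \<bar>(\<Sum>j<2 * a. g (real (h - a + 1 + j) / real (2 * h + 1))) / real (2 * h + 1)
      - (H (1 / 2 + real a / real (2 * h + 1)) - H (1 / 2 - real a / real (2 * h + 1)))\<bar> \<le> e"
proof -
  have "uniformly_continuous_on {0..1} g"
    by (rule compact_uniformly_continuous[OF cont]) simp
  then obtain \<delta> where \<delta>: "\<delta> > 0"
    "\<And>x y. x \<in> {0..1} \<Longrightarrow> y \<in> {0..1} \<Longrightarrow> \<bar>y - x\<bar> < \<delta> \<Longrightarrow> \<bar>g y - g x\<bar> < e"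
    using e unfolding uniformly_continuous_on_def dist_real_def by metis
  obtain P where P: "1 / \<delta> < real P" using reals_Archimedean2 by blast
  show ?thesis
  proof (intro exI[of _ P] allI impI)
    fix h a :: nat assume hP: "2 * h + 1 \<ge> P" and a: "a \<le> h"
    define p where "p = real (2 * h + 1)"
    have p: "p > 0" "p = 2 * real h + 1" by (simp_all add: p_def)
    have "1 / \<delta> < p"
      using P hP unfolding p_def by (meson less_le_trans of_nat_le_iff)
    then have p\<delta>: "1 / p < \<delta>"
      using \<delta>(1) p by (simp add: field_simps)
    \<comment> \<open>The left end of cell \<open>j\<close>; as \<open>p = 2 h + 1\<close>, the
      offset \<open>1 / 2\<close> places the outer ends exactly at \<open>1/2 - a/p\<close> and
      \<open>1/2 + a/p\<close>.\<close>
    define v where "v = (\<lambda>j. (real (h - a + j) + 1 / 2) / p)"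
    define w where "w = (\<lambda>j. real (h - a + 1 + j) / p)"
    have vw: "w j \<in> {0..1}" "v j \<ge> 0" "v (Suc j) \<le> 1" "v j < w j" "w j < v (Suc j)"
      if "j < 2 * a" for j
      using that a p by (auto simp: v_def w_def of_nat_diff field_simps)
    have vdiff: "v (Suc j) - v j = 1 / p" for j
      by (simp add: v_def add_divide_distrib)
    have cell: "\<bar>g (w j) / p - (H (v (Suc j)) - H (v j))\<bar> \<le> e / p" if j: "j < 2 * a" for j
    proof -
      have "v j < v (Suc j)" using vw[OF j] by linarith
      then obtain z where z: "v j < z" "z < v (Suc j)" "H (v (Suc j)) - H (v j) = (v (Suc j) - v j) * g z"
        using MVT2[of "v j" "v (Suc j)" H g] deriv by blast
      have "\<bar>w j - z\<bar> < \<delta>" "z \<in> {0..1}"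
        using vw[OF j] vdiff[of j] z(1,2) p\<delta> by auto
      then have "\<bar>g (w j) - g z\<bar> < e"
        using \<delta>(2) vw[OF j] by blast
      then show ?thesis
        using p z(3) vdiff[of j] by (simp flip: diff_divide_distrib add: abs_divide divide_right_mono)
    qed
    have v0: "v 0 = 1 / 2 - real a / p" and v2a: "v (2 * a) = 1 / 2 + real a / p"
      using a p by (auto simp: v_def of_nat_diff field_simps)
    have "(\<Sum>j<2 * a. H (v (Suc j)) - H (v j)) = H (v (2 * a)) - H (v 0)"
      by (rule sum_lessThan_telescope)
    then have "(\<Sum>j<2 * a. g (w j)) / p - (H (v (2 * a)) - H (v 0)) =
        (\<Sum>j<2 * a. g (w j) / p - (H (v (Suc j)) - H (v j)))"
      by (simp only: sum_subtractf sum_divide_distrib)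
    then have "\<bar>(\<Sum>j<2 * a. g (w j)) / p - (H (v (2 * a)) - H (v 0))\<bar> \<le> (\<Sum>j<2 * a. e / p)"
      using cell by (simp only:) (rule sum_abs[THEN order_trans], rule sum_mono, auto)
    also have "\<dots> = e * (2 * real a / p)" by simp
    also have "\<dots> \<le> e * 1"
      using e a p by (intro mult_left_mono) auto
    finally show "\<bar>(\<Sum>j<2 * a. g (real (h - a + 1 + j) / real (2 * h + 1))) / real (2 * h + 1)
      - (H (1 / 2 + real a / real (2 * h + 1)) - H (1 / 2 - real a / real (2 * h + 1)))\<bar> \<le> e"
      unfolding v0 v2a w_def p_def by simp
  qed
qed

text \<open>\<open>\<psi>\<close> stands for the normalized lengths in one variable fewer, or for
  any function with the same sums over the symmetric ranges; this freedom serves the start of the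
  induction.\<close>

lemma kernel_dim_asymptotic_step:
  fixes \<psi> :: "nat \<Rightarrow> nat \<Rightarrow> real"
  assumes n: "n \<ge> 2"
    and approx: "\<And>e. e > 0 \<Longrightarrow> \<exists>P. \<forall>p\<ge>P. Factorial_Ring.prime p \<longrightarrow>
      (\<forall>j\<le>p. \<bar>\<psi> p j - limit_fun (Suc d) n (real j / real p)\<bar> \<le> e)"
    and sum_eq: "\<And>p h a. Factorial_Ring.prime p \<Longrightarrow> p = 2 * h + 1 \<Longrightarrow> a \<le> h \<Longrightarrow>
      (\<Sum>j<2 * a. kernel_dim n d p p (h - a + 1 + j)) / real p ^ (d + 1) =
      (\<Sum>j<2 * a. \<psi> p (h - a + 1 + j))"
    and e: "e > 0"
  shows "\<exists>P. \<forall>p\<ge>P. Factorial_Ring.prime p \<longrightarrow>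
    (\<forall>a\<le>p. \<bar>kernel_dim n (Suc d) p p a / real p ^ (d + 2) - limit_fun (d + 2) n (real a / real p)\<bar> \<le> e)"
proof -
  obtain H where H: "\<And>x. (H has_real_derivative limit_fun (Suc d) n x) (at x)"
    "\<And>x. x \<in> {0..1/2} \<Longrightarrow> H (1 / 2 + x) - H (1 / 2 - x) = limit_fun (d + 2) n x"
    using limit_fun_antiderivative[OF n, of "Suc d"] by auto
  obtain P1 where P1: "\<And>p j. p \<ge> P1 \<Longrightarrow> Factorial_Ring.prime p \<Longrightarrow> j \<le> p \<Longrightarrow>
      \<bar>\<psi> p j - limit_fun (Suc d) n (real j / real p)\<bar> \<le> e / 2"
    using approx[of "e / 2"] e by auto
  obtain P2 where P2: "\<And>h a. 2 * h + 1 \<ge> P2 \<Longrightarrow> a \<le> h \<Longrightarrow>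
    \<bar>(\<Sum>j<2 * a. limit_fun (Suc d) n (real (h - a + 1 + j) / real (2 * h + 1))) / real (2 * h + 1)
      - (H (1 / 2 + real a / real (2 * h + 1)) - H (1 / 2 - real a / real (2 * h + 1)))\<bar> \<le> e / 2"
    using midpoint_rule[OF continuous_limit_fun H(1), of "e / 2"] e by auto
  show ?thesis
  \<comment> \<open>The bound 3 excludes the prime 2, so that \<open>p = 2 h + 1\<close>.\<close>
  proof (intro exI[of _ "Max {P1, P2, 3}"] allI impI)
    fix p a :: nat assume p: "p \<ge> Max {P1, P2, 3}" and prime: "Factorial_Ring.prime p" and ap: "a \<le> p"
    interpret prime_box n d p
      by standard (use n prime in auto)
    have "odd p" using p prime prime_odd_nat[of p] by auto
    then obtain h where h: "p = 2 * h + 1" by (auto elim!: oddE)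
    have p0: "real p > 0" using p_pos by simp
    have low: "\<bar>kernel_dim n (Suc d) p p a / real p ^ (d + 2) - limit_fun (d + 2) n (real a / real p)\<bar> \<le> e"
      if a: "a \<le> h" for a
    proof -
      let ?g = "\<lambda>j. limit_fun (Suc d) n (real (h - a + 1 + j) / real p)"
      have "kernel_dim n (Suc d) p p a / real p ^ (d + 2) =
          (\<Sum>j<2 * a. kernel_dim n d p p (h - a + 1 + j)) / real p ^ (d + 1) / real p"
        unfolding kernel_dim_Suc_low[OF h a] by simp
      also have "\<dots> = (\<Sum>j<2 * a. \<psi> p (h - a + 1 + j)) / real p"
        by (simp only: sum_eq[OF prime h a])
      finally have 1: "kernel_dim n (Suc d) p p a / real p ^ (d + 2) = (\<Sum>j<2 * a. \<psi> p (h - a + 1 + j)) / real p" .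
      have "\<bar>(\<Sum>j<2 * a. \<psi> p (h - a + 1 + j)) - (\<Sum>j<2 * a. ?g j)\<bar> \<le> (\<Sum>j<2 * a. e / 2)"
        unfolding sum_subtractf[symmetric]
        by (rule sum_abs[THEN order_trans], rule sum_mono, rule P1) (use p prime a h in auto)
      also have "\<dots> \<le> e / 2 * real p"
        using a h e by simp
      finally have 2: "\<bar>(\<Sum>j<2 * a. \<psi> p (h - a + 1 + j)) / real p - (\<Sum>j<2 * a. ?g j) / real p\<bar> \<le> e / 2"
        using p0 by (simp flip: diff_divide_distrib add: abs_divide pos_divide_le_eq)
      have "real a / real p \<in> {0..1/2}"
        using a h by (auto simp: field_simps)
      then have 3: "\<bar>(\<Sum>j<2 * a. ?g j) / real p - limit_fun (d + 2) n (real a / real p)\<bar> \<le> e / 2"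
        using P2[of h a] H(2)[of "real a / real p"] p a by (simp add: h)
      show ?thesis
        using 2 3 unfolding 1 by linarith
    qed
    show "\<bar>kernel_dim n (Suc d) p p a / real p ^ (d + 2) - limit_fun (d + 2) n (real a / real p)\<bar> \<le> e"
    proof (cases "a \<le> h")
      \<comment> \<open>Beyond the midpoint, the duality for lengths and the reflection of
        \<open>limit_fun\<close> add the same correction, which reduces the estimate to
        \<open>p - a\<close>.\<close>
      case False
      have a': "p - a \<le> h" using False h by simp
      have "kernel_dim n (Suc d) p p a / real p ^ (d + 2) =
          kernel_dim n (Suc d) p p (p - a) / real p ^ (d + 2) + (2 * real a - real p) / real p"
        unfolding kernel_dim_Suc_dual[OF h ap] using p0 by (simp add: add_divide_distrib)
      moreover have "limit_fun (d + 2) n (real a / real p) =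
          limit_fun (d + 2) n (real (p - a) / real p) + (2 * real a - real p) / real p"
      proof -
        have "real (p - a) / real p = 1 - real a / real p"
          using ap p0 by (simp add: of_nat_diff field_simps)
        moreover have "(2 * real a - real p) / real p = 2 * (real a / real p) - 1"
          using p0 by (simp add: field_simps)
        moreover have "real a / real p \<in> {0..1}" using ap p0 by simp
        ultimately show ?thesis
          using limit_fun_reflect[OF n, of "d + 2" "real a / real p"] by simp
      qed
      ultimately show ?thesis
        using low[OF a'] by simp
    qed (rule low)
  qed
qed

text \<open>The range \<open>h - a < k \<le> h + a\<close> is symmetric under
  \<open>k \<mapsto> p - k\<close>, so only symmetrized values enter, and for these
  \<open>limit_fun_1_sum\<close> applies.\<close>

lemma kernel_dim_0_sum:
  assumes n: "n \<ge> 2" and prime: "Factorial_Ring.prime p" and h: "p = 2 * h + 1" and a: "a \<le> h"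
  shows "(\<Sum>j<2 * a. kernel_dim n 0 p p (h - a + 1 + j)) / real p ^ (0 + 1) =
    (\<Sum>j<2 * a. limit_fun 1 n (real (h - a + 1 + j) / real p))"
proof -
  have p: "p > 1" using prime prime_gt_1_nat by blast
  let ?k = "\<lambda>j. h - a + 1 + j"
  let ?f = "\<lambda>j. min (real n * (real (?k j) / real p)) 1"
  let ?g = "\<lambda>j. limit_fun 1 n (real (?k j) / real p)"
  have rev: "real (?k (2 * a - 1 - j)) / real p = 1 - real (?k j) / real p" if "j < 2 * a" for j
    using that a h p by (simp add: of_nat_diff field_simps)
  have pair: "?g j + ?g (2 * a - 1 - j) = ?f j + ?f (2 * a - 1 - j)" if "j < 2 * a" for j
    unfolding rev[OF that] by (rule limit_fun_1_sum) (use n a h that p in auto)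
  have sym: "(\<Sum>j<2 * a. F j) = (\<Sum>j<2 * a. F (2 * a - 1 - j))" for F :: "nat \<Rightarrow> real"
    by (rule sum.reindex_bij_witness[of _ "\<lambda>j. 2 * a - 1 - j" "\<lambda>j. 2 * a - 1 - j"]) auto
  have "2 * (\<Sum>j<2 * a. ?g j) = (\<Sum>j<2 * a. ?g j + ?g (2 * a - 1 - j))"
    using sym[of ?g] by (simp add: sum.distrib)
  also have "\<dots> = (\<Sum>j<2 * a. ?f j + ?f (2 * a - 1 - j))"
    by (intro sum.cong refl pair) simp
  also have "\<dots> = 2 * (\<Sum>j<2 * a. ?f j)"
    using sym[of ?f] by (simp add: sum.distrib)
  finally have "(\<Sum>j<2 * a. ?g j) = (\<Sum>j<2 * a. ?f j)" by simp
  also have "\<dots> = (\<Sum>j<2 * a. kernel_dim n 0 p p (?k j) / real p)"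
  proof (rule sum.cong[OF refl])
    fix j
    have "min (real n * (real k / real p)) 1 = real (min (k * n) p) / real p" for k
      using p by (auto simp: min_def field_simps simp flip: of_nat_mult)
    then show "?f j = kernel_dim n 0 p p (?k j) / real p"
      by (simp only: kernel_dim_0[OF p])
  qed
  finally show ?thesis
    by (simp add: sum_divide_distrib)
qed

lemma kernel_dim_asymptotic:
  assumes n: "n \<ge> 2" and e: "e > 0"
  shows "\<exists>P. \<forall>p\<ge>P. Factorial_Ring.prime p \<longrightarrow>
    (\<forall>a\<le>p. \<bar>kernel_dim n (Suc d) p p a / real p ^ (d + 2) - limit_fun (d + 2) n (real a / real p)\<bar> \<le> e)"
  using e
proof (induction d arbitrary: e)
  case 0
  show ?case
    by (rule kernel_dim_asymptotic_step[OF n _ _ 0, where \<psi> = "\<lambda>p j. limit_fun 1 n (real j / real p)"])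
       (use kernel_dim_0_sum[OF n] in auto)
next
  case (Suc d)
  show ?case
    by (rule kernel_dim_asymptotic_step[OF n _ _ Suc.prems,
          where \<psi> = "\<lambda>p j. kernel_dim n (Suc d) p p j / real p ^ (d + 2)"])
       (use Suc.IH in \<open>auto simp: sum_divide_distrib\<close>)
qed

subsection \<open>Power series over the integers and over their residue rings\<close>

text \<open>Convolution over the integers; products over the residue rings are obtained by reducing
  its values.\<close>

definition conv :: "('v multiset \<Rightarrow> int) \<Rightarrow> ('v multiset \<Rightarrow> int) \<Rightarrow> 'v multiset \<Rightarrow> int" where
  "conv F G m = (\<Sum>a\<in>{a. a \<subseteq># m}. F a * G (m - a))"

definition monomial :: "'v multiset \<Rightarrow> 'v multiset \<Rightarrow> int" where
  "monomial b = (\<lambda>m. if m = b then 1 else 0)"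

lemma finite_submultisets: "finite {a. a \<subseteq># m}" for m :: "'v multiset"
proof (induction m)
  case (add x m)
  have "{a. a \<subseteq># add_mset x m} \<subseteq> {a. a \<subseteq># m} \<union> add_mset x ` {a. a \<subseteq># m}"
  proof
    fix a assume a: "a \<in> {a. a \<subseteq># add_mset x m}"
    show "a \<in> {a. a \<subseteq># m} \<union> add_mset x ` {a. a \<subseteq># m}"
    proof (cases "x \<in># a")
      case True
      then obtain a' where "a = add_mset x a'" by (metis multi_member_split)
      then show ?thesis using a by auto
    next
      case False
      then have "count a i \<le> count m i" for i
        using a by (cases "i = x") (auto simp: subseteq_mset_def not_in_iff dest: spec[of _ i])
      then show ?thesis by (simp add: subseteq_mset_def)
    qed
  qed
  then show ?case using add by (meson finite_UnI finite_imageI finite_subset)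
qed simp

lemma conv_commute: "conv F G m = conv G F m"
  unfolding conv_def
  by (rule sum.reindex_bij_witness[of _ "\<lambda>a. m - a" "\<lambda>a. m - a"])
     (auto simp: mult.commute subset_mset.diff_diff_right)

lemma add_subset_mset:
  assumes "b \<subseteq># m" "e \<subseteq># m - b"
  shows "b + e \<subseteq># m"
  unfolding subseteq_mset_def
proof
  fix i
  have "count b i \<le> count m i" "count e i \<le> count m i - count b i"
    using assms mset_subset_eq_count by fastforce+
  then show "count (b + e) i \<le> count m i" by simp
qed

lemma diff_subset_mset: "a \<subseteq># m \<Longrightarrow> a - b \<subseteq># m - b"
  by (simp add: subseteq_mset_def diff_le_mono)

text \<open>Both sides sum over the factorizations of \<open>m\<close> into three monomials.\<close>

lemma conv_assoc: "conv (conv F G) H m = conv F (conv G H) m"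
proof -
  have "conv (conv F G) H m =
      (\<Sum>(a, b)\<in>(SIGMA a:{a. a \<subseteq># m}. {b. b \<subseteq># a}). F b * G (a - b) * H (m - a))"
    unfolding conv_def sum_distrib_right by (rule sum.Sigma) (auto simp: finite_submultisets)
  also have "\<dots> = (\<Sum>(b, e)\<in>(SIGMA b:{b. b \<subseteq># m}. {e. e \<subseteq># m - b}). F b * (G e * H (m - b - e)))"
    by (rule sum.reindex_bij_witness[of _ "\<lambda>(b, e). (b + e, b)" "\<lambda>(a, b). (b, a - b)"])
       (auto simp: add_subset_mset diff_subset_mset intro: subset_mset.order_trans)
  also have "\<dots> = conv F (conv G H) m"
    unfolding conv_def sum_distrib_left by (rule sum.Sigma[symmetric]) (auto simp: finite_submultisets)
  finally show ?thesis .
qed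

lemma conv_add_left: "conv (\<lambda>m. F m + F' m) G m = conv F G m + conv F' G m"
  by (simp add: conv_def distrib_right sum.distrib)

lemma conv_sum_left: "conv (\<lambda>m. \<Sum>i\<in>I. F i m) G m = (\<Sum>i\<in>I. conv (F i) G m)"
  by (simp add: conv_def sum_distrib_right sum.swap[of _ I])

lemma conv_monomial: "conv (monomial b) G m = (if b \<subseteq># m then G (m - b) else 0)"
proof -
  have "conv (monomial b) G m = (\<Sum>a\<in>{a. a \<subseteq># m}. if a = b then G (m - b) else 0)"
    unfolding conv_def monomial_def by (intro sum.cong) auto
  then show ?thesis by (simp add: finite_submultisets)
qed

lemma conv_mod_left: "conv (\<lambda>m. F m mod c) G m mod c = conv F G m mod c"
  unfolding conv_def by (subst (1 2) mod_sum_eq[symmetric]) (simp add: mod_mult_left_eq)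

lemma conv_mod_right: "conv F (\<lambda>m. G m mod c) m mod c = conv F G m mod c"
  by (metis conv_commute conv_mod_left)

text \<open>The modulus \<open>c = 0\<close> covers the ring of integers.\<close>

locale power_series_mod =
  fixes c :: int and R :: "(int, 'b) ring_scheme" and V :: "'v set"
  assumes c: "c = 0 \<or> c > 1"
    and carrier_R: "carrier R = {x. x mod c = x}"
    and mult_R: "\<And>x y. x \<otimes>\<^bsub>R\<^esub> y = x * y mod c"
    and add_R: "\<And>x y. x \<oplus>\<^bsub>R\<^esub> y = (x + y) mod c"
    and one_R: "\<one>\<^bsub>R\<^esub> = 1" and zero_R: "\<zero>\<^bsub>R\<^esub> = 0"
begin

lemma one_mod: "1 mod c = 1"
  using c by auto

lemma comm_monoid_add_R: "abelian_monoid R"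
  by (rule abelian_monoidI)
     (auto simp: carrier_R add_R zero_R mod_add_left_eq mod_add_right_eq algebra_simps)

lemma finsum_R: "f \<in> A \<rightarrow> carrier R \<Longrightarrow> finsum R f A = sum f A mod c"
proof (induction A rule: infinite_finite_induct)
  case (insert x A)
  interpret abelian_monoid R by (rule comm_monoid_add_R)
  have "f x \<in> carrier R" "f \<in> A \<rightarrow> carrier R" using insert.prems by auto
  then show ?case
    using insert by (simp add: finsum_insert add_R mod_add_right_eq)
next
  case (infinite A)
  interpret abelian_monoid R by (rule comm_monoid_add_R)
  show ?case using infinite by (simp add: finsum_infinite zero_R)
next
  case empty
  interpret abelian_monoid R by (rule comm_monoid_add_R)
  show ?case by (simp add: zero_R)
qed

abbreviation P where "P \<equiv> power_series_ring R V"

lemma carrier_P: "carrier P = {F. (\<forall>m. F m mod c = F m) \<and> (\<forall>m. \<not> set_mset m \<subseteq> V \<longrightarrow> F m = 0)}"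
  by (simp add: power_series_ring_def carrier_R zero_R)

lemma mult_P: "F \<otimes>\<^bsub>P\<^esub> G = (\<lambda>m. conv F G m mod c)"
proof
  fix m
  have "(F \<otimes>\<^bsub>P\<^esub> G) m = finsum R (\<lambda>a. F a * G (m - a) mod c) {a. a \<subseteq># m}"
    by (simp add: power_series_ring_def mult_R)
  also have "\<dots> = (\<Sum>a\<in>{a. a \<subseteq># m}. F a * G (m - a) mod c) mod c"
    by (rule finsum_R) (simp add: carrier_R)
  finally show "(F \<otimes>\<^bsub>P\<^esub> G) m = conv F G m mod c"
    by (simp add: conv_def mod_sum_eq)
qed

lemma add_P: "F \<oplus>\<^bsub>P\<^esub> G = (\<lambda>m. (F m + G m) mod c)"
  and zero_P: "\<zero>\<^bsub>P\<^esub> = (\<lambda>m. 0)"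
  and one_P: "\<one>\<^bsub>P\<^esub> = monomial {#}"
  by (auto simp: power_series_ring_def add_R zero_R one_R monomial_def)

lemma conv_support:
  assumes "\<And>m. \<not> set_mset m \<subseteq> V \<Longrightarrow> F m = 0" "\<And>m. \<not> set_mset m \<subseteq> V \<Longrightarrow> G m = 0"
    and "\<not> set_mset m \<subseteq> V"
  shows "conv F G m = 0"
  unfolding conv_def
proof (rule sum.neutral, rule ballI)
  fix a assume "a \<in> {a. a \<subseteq># m}"
  then have "m = a + (m - a)" by simp
  then have "set_mset m = set_mset a \<union> set_mset (m - a)" by (metis set_mset_union)
  then have "\<not> set_mset a \<subseteq> V \<or> \<not> set_mset (m - a) \<subseteq> V" using assms(3) by auto
  then show "F a * G (m - a) = 0" using assms(1,2) by auto
qed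

lemma monomial_closed: "set_mset b \<subseteq> V \<Longrightarrow> monomial b \<in> carrier P"
  by (auto simp: carrier_P monomial_def one_mod)

lemma mult_closed: "F \<in> carrier P \<Longrightarrow> G \<in> carrier P \<Longrightarrow> F \<otimes>\<^bsub>P\<^esub> G \<in> carrier P"
  using conv_support[of F G] by (auto simp: mult_P carrier_P)

lemma cring_P: "cring P"
proof (rule cringI)
  show "abelian_group P"
  proof (rule abelian_groupI)
    fix F assume F: "F \<in> carrier P"
    show "\<exists>G\<in>carrier P. G \<oplus>\<^bsub>P\<^esub> F = \<zero>\<^bsub>P\<^esub>"
      by (rule bexI[of _ "\<lambda>m. (- F m) mod c"])
         (use F in \<open>auto simp: carrier_P add_P zero_P mod_add_left_eq\<close>)
  qed (auto simp: carrier_P add_P zero_P mod_add_left_eq mod_add_right_eq algebra_simps)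
  show "comm_monoid P"
  proof (rule comm_monoidI)
    fix F G H
    show "F \<otimes>\<^bsub>P\<^esub> G \<otimes>\<^bsub>P\<^esub> H = F \<otimes>\<^bsub>P\<^esub> (G \<otimes>\<^bsub>P\<^esub> H)"
      by (simp add: mult_P conv_mod_left conv_mod_right) (simp add: conv_assoc[abs_def])
    show "F \<otimes>\<^bsub>P\<^esub> G = G \<otimes>\<^bsub>P\<^esub> F"
      by (simp add: mult_P conv_commute[of F])
  next
    fix F assume "F \<in> carrier P"
    then show "\<one>\<^bsub>P\<^esub> \<otimes>\<^bsub>P\<^esub> F = F"
      by (simp add: mult_P one_P conv_monomial carrier_P)
  qed (auto simp: mult_closed one_P monomial_closed)
  fix F G H
  show "(F \<oplus>\<^bsub>P\<^esub> G) \<otimes>\<^bsub>P\<^esub> H = F \<otimes>\<^bsub>P\<^esub> H \<oplus>\<^bsub>P\<^esub> G \<otimes>\<^bsub>P\<^esub> H"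
    by (simp add: mult_P add_P conv_mod_left conv_add_left mod_add_eq)
qed

lemma ps_var_eq: "ps_var R i = monomial {#i#}"
  by (auto simp: ps_var_def monomial_def one_R zero_R)

lemma ps_var_power: "ps_var R i [^]\<^bsub>P\<^esub> (k::nat) = monomial (replicate_mset k i)"
proof (induction k)
  case 0
  interpret cring P by (rule cring_P)
  show ?case by (simp add: one_P)
next
  case (Suc k)
  interpret cring P by (rule cring_P)
  have "ps_var R i [^]\<^bsub>P\<^esub> Suc k = monomial (replicate_mset k i) \<otimes>\<^bsub>P\<^esub> monomial {#i#}"
    by (simp only: nat_pow_Suc Suc) (simp only: ps_var_eq)
  also have "\<dots> = monomial (replicate_mset (Suc k) i)"
  proof
    fix m
    have "(replicate_mset k i \<subseteq># m \<and> m - replicate_mset k i = {#i#}) = (m = replicate_mset (Suc k) i)"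
    proof
      assume "replicate_mset k i \<subseteq># m \<and> m - replicate_mset k i = {#i#}"
      then have "replicate_mset k i + {#i#} = m"
        using subset_mset.add_diff_inverse[of "replicate_mset k i" m] by simp
      then show "m = replicate_mset (Suc k) i" by simp
    qed simp
    then show "(monomial (replicate_mset k i) \<otimes>\<^bsub>P\<^esub> monomial {#i#}) m = monomial (replicate_mset (Suc k) i) m"
      using one_mod by (auto simp: mult_P conv_monomial) (auto simp: monomial_def)
  qed
  finally show ?case .
qed

lemma finsum_P:
  assumes "finite I" "\<And>i. i \<in> I \<Longrightarrow> F i \<in> carrier P"
  shows "finsum P F I = (\<lambda>m. (\<Sum>i\<in>I. F i m) mod c)"
  using assms
proof (induction I rule: finite_induct)
  case empty
  interpret cring P by (rule cring_P)
  show ?case by (simp add: zero_P)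
next
  case (insert x I)
  interpret cring P by (rule cring_P)
  have "finsum P F (insert x I) = F x \<oplus>\<^bsub>P\<^esub> finsum P F I"
    using insert by (intro finsum_insert) auto
  then show ?case
    using insert by (simp add: add_P mod_add_right_eq)
qed

end

lemma power_series_mod_int: "power_series_mod 0 \<Z>"
  by standard auto

lemma power_series_mod_residue: "p > 1 \<Longrightarrow> power_series_mod p (residue_ring p)"
proof
  assume p: "p > 1"
  have "x mod p = x \<longleftrightarrow> 0 \<le> x \<and> x < p" for x
  proof -
    have b: "0 \<le> x mod p" "x mod p < p" using p by simp_all
    show ?thesis
    proof
      assume e: "x mod p = x"
      show "0 \<le> x \<and> x < p" using b unfolding e by blast
    qed (simp add: mod_pos_pos_trivial)
  qed
  note eq = this
  show "carrier (residue_ring p) = {x. x mod p = x}"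
    unfolding eq residue_ring_def by auto
qed (auto simp: residue_ring_def)

definition diag_series :: "nat \<Rightarrow> nat \<Rightarrow> nat multiset \<Rightarrow> int" where
  "diag_series n d m = monomial (replicate_mset n 0) m + (\<Sum>i\<in>{1..d}. monomial (replicate_mset 2 i) m)"

lemma diag_series_eq:
  fixes n d :: nat
  defines "S \<equiv> power_series_ring \<Z> {..d}"
  shows "ps_var \<Z> 0 [^]\<^bsub>S\<^esub> n \<oplus>\<^bsub>S\<^esub> (\<Oplus>\<^bsub>S\<^esub>i \<in> {1..d}. ps_var \<Z> i [^]\<^bsub>S\<^esub> (2::nat)) = diag_series n d"
proof -
  interpret power_series_mod 0 \<Z> "{..d}" by (rule power_series_mod_int)
  have "(\<Oplus>\<^bsub>P\<^esub>i \<in> {1..d}. ps_var \<Z> i [^]\<^bsub>P\<^esub> (2::nat)) = (\<lambda>m. (\<Sum>i\<in>{1..d}. monomial (replicate_mset 2 i) m) mod 0)"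
    unfolding ps_var_power by (rule finsum_P) (auto intro!: monomial_closed)
  then show ?thesis
    unfolding S_def ps_var_power add_P by (simp add: diag_series_def fun_eq_iff)
qed

subsection \<open>The quotient ring as a dual space\<close>

text \<open>Induces the isomorphism from the residues modulo \<open>p\<close> to the
  \<open>p\<close>-torsion of \<open>qz\<close>.\<close>

lift_definition qfrac :: "nat \<Rightarrow> int \<Rightarrow> qz" is "\<lambda>p k. of_int k / of_nat p" .

lemma qfrac_add: "qfrac p (a + b) = qfrac p a + qfrac p b"
  by transfer (simp add: add_divide_distrib)

lemma qfrac_zero [simp]: "qfrac p 0 = 0"
  by transfer simp

lemma qfrac_sum: "qfrac p (sum f A) = (\<Sum>i\<in>A. qfrac p (f i))"
  by (induction A rule: infinite_finite_induct) (auto simp: qfrac_add)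

lemma qfrac_of_nat: "qfrac p (int k) = smul k (unit_fraction p)"
proof -
  have "qfrac p 1 = unit_fraction p" by transfer simp
  then show ?thesis by (induction k) (auto simp: qfrac_add)
qed

lemma qfrac_mult: "qfrac p (int k * a) = smul k (qfrac p a)"
  by (induction k) (auto simp: qfrac_add distrib_right)

lemma qfrac_mod:
  assumes "p > 0"
  shows "qfrac p (a mod int p) = qfrac p a"
proof -
  have "(of_int (a mod int p) :: rat) = of_int a - of_nat p * of_int (a div int p)"
    by (metis minus_mult_div_eq_mod of_int_diff of_int_mult of_int_of_nat_eq)
  then have "of_int (a mod int p) / of_nat p - of_int a / of_nat p = (of_int (- (a div int p)) :: rat)"
    using assms by (simp add: field_simps)
  then have "(of_int (a mod int p) / of_nat p - of_int a / of_nat p :: rat) \<in> \<int>"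
    by (simp only: Ints_of_int)
  then show ?thesis
    by transfer
qed

lemma qfrac_eq_zero_iff:
  assumes "p > 0"
  shows "qfrac p a = 0 \<longleftrightarrow> int p dvd a"
proof -
  have "qfrac p a = qfrac p (int (nat (a mod int p)))"
    using qfrac_mod[OF assms, of a] assms by simp
  also have "\<dots> = smul (nat (a mod int p)) (unit_fraction p)"
    by (rule qfrac_of_nat)
  finally have "qfrac p a = 0 \<longleftrightarrow> int p dvd int (nat (a mod int p))"
    using smul_unit_fraction_eq_zero_iff[OF assms] by (simp only: int_dvd_int_iff)
  then show ?thesis using assms by (simp add: dvd_mod_iff)
qed

lemma smul_qfrac: "p > 0 \<Longrightarrow> smul p (qfrac p a) = 0"
  by (simp flip: qfrac_mult add: qfrac_eq_zero_iff)

locale residue_box =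
  fixes n d p q :: nat
  assumes prime: "Factorial_Ring.prime p" and q_pos: "q > 0"
begin

lemma p_pos: "p > 0"
  using prime prime_gt_0_nat by blast

abbreviation R where "R \<equiv> residue_ring (int p)"

sublocale power_series_mod "int p" R "{..d}"
  by (rule power_series_mod_residue) (use prime prime_gt_1_nat in simp)

sublocale cring P
  by (rule cring_P)

text \<open>The exponent of the socle generator of the quotient by
  \<open>(x_0^q, ..., x_d^q)\<close>.\<close>

definition corner :: "nat multiset" where
  "corner = (\<Sum>i\<in>{..d}. replicate_mset (q - 1) i)"

lemma count_corner: "count corner i = (if i \<le> d then q - 1 else 0)"
  unfolding corner_def by (simp add: count_sum_replicate)

lemma box_iff: "m \<in> box d q \<longleftrightarrow> m \<subseteq># corner"
proof
  assume m: "m \<in> box d q"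
  show "m \<subseteq># corner"
    unfolding subseteq_mset_def
  proof
    fix i show "count m i \<le> count corner i"
      using box_D[OF m, of i] box_D0[OF m, of i] by (cases "i \<le> d") (auto simp: count_corner)
  qed
next
  assume m: "m \<subseteq># corner"
  have le: "count m i \<le> (if i \<le> d then q - 1 else 0)" for i
    using mset_subset_eq_count[OF m] by (simp only: count_corner)
  show "m \<in> box d q"
  proof (rule box_I)
    fix i assume "i \<le> d"
    then show "count m i < q" using le[of i] q_pos by simp
  next
    fix i assume "\<not> i \<le> d"
    then show "count m i = 0" using le[of i] by simp
  qed
qed

lemma corner_subset: "set_mset corner \<subseteq> {..d}"
proof
  fix i assume "i \<in># corner"
  then have "count corner i > 0" by simp
  then show "i \<in> {..d}" by (simp add: count_corner split: if_splits)
qed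

text \<open>The value at \<open>m\<close> is the coefficient of the socle monomial
  \<open>corner\<close> in \<open>x^m G\<close>: the perfect pairing that makes the quotient
  self-dual.\<close>

definition to_dual :: "(nat multiset \<Rightarrow> int) \<Rightarrow> nat multiset \<Rightarrow> qz" where
  "to_dual G = (\<lambda>m. if m \<in> box d q then qfrac p (G (corner - m)) else 0)"

lemma to_dual_in: "to_dual G \<in> dual_space d p q"
  by (auto simp: to_dual_def dual_space_def smul_qfrac p_pos)

lemma to_dual_mod: "to_dual (\<lambda>m. G m mod int p) = to_dual G"
  by (simp add: to_dual_def qfrac_mod p_pos fun_eq_iff)

lemma to_dual_add: "to_dual (F \<oplus>\<^bsub>P\<^esub> G) = to_dual F + to_dual G"
  unfolding add_P to_dual_mod by (auto simp: to_dual_def qfrac_add fun_eq_iff)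

lemma to_dual_zero: "to_dual \<zero>\<^bsub>P\<^esub> = 0"
  by (auto simp: to_dual_def zero_P fun_eq_iff)

lemma to_dual_minus:
  assumes "F \<in> carrier P" "G \<in> carrier P"
  shows "to_dual (F \<ominus>\<^bsub>P\<^esub> G) = to_dual F - to_dual G"
proof -
  have "to_dual (F \<ominus>\<^bsub>P\<^esub> G) + to_dual G = to_dual ((F \<ominus>\<^bsub>P\<^esub> G) \<oplus>\<^bsub>P\<^esub> G)"
    by (simp add: to_dual_add)
  also have "(F \<ominus>\<^bsub>P\<^esub> G) \<oplus>\<^bsub>P\<^esub> G = F"
    using assms by (simp add: minus_eq a_assoc l_neg)
  finally show ?thesis by (simp only: eq_diff_eq)
qed

lemma to_dual_sum: "to_dual (\<lambda>m. \<Sum>i\<in>I. F i m) = (\<Sum>i\<in>I. to_dual (F i))"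
  by (auto simp: to_dual_def qfrac_sum fun_eq_iff sum_apply)

lemma to_dual_plus: "to_dual (\<lambda>m. F m + G m) = to_dual F + to_dual G"
  by (auto simp: to_dual_def qfrac_add fun_eq_iff)

text \<open>Multiplication turns into translation because
  \<open>corner - m - b = corner - (m + b)\<close>.\<close>

lemma to_dual_conv_monomial: "to_dual (conv (monomial b) G) = translate b (to_dual G)"
proof
  fix m
  have "b \<subseteq># corner - m \<longleftrightarrow> m + b \<subseteq># corner" if "m \<subseteq># corner"
    using that add_subset_mset diff_subset_mset[of "m + b" corner m] by auto
  moreover have "m + b \<subseteq># corner \<Longrightarrow> m \<subseteq># corner"
    using subset_mset.add_increasing2 by (metis mset_subset_eq_add_left subset_mset.order_trans)
  ultimately show "to_dual (conv (monomial b) G) m = translate b (to_dual G) m"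
    by (auto simp: to_dual_def translate_def conv_monomial box_iff diff_diff_add_mset)
qed

text \<open>By linearity from monomials. Translation by a monomial outside the box kills the dual
  space, which leaves a finite sum.\<close>

lemma to_dual_mult:
  assumes "a \<in> carrier P"
  shows "to_dual (a \<otimes>\<^bsub>P\<^esub> G) = (\<Sum>b\<in>box d q. smul (nat (a b)) (translate b (to_dual G)))"
proof
  fix m
  have a: "a b \<ge> 0" for b
    using assms p_pos by (auto simp: carrier_P) (metis pos_mod_sign of_nat_0_less_iff)
  show "to_dual (a \<otimes>\<^bsub>P\<^esub> G) m = (\<Sum>b\<in>box d q. smul (nat (a b)) (translate b (to_dual G))) m"
  proof (cases "m \<in> box d q")
    case True
    then have m: "m \<subseteq># corner" by (simp add: box_iff)
    have "to_dual (a \<otimes>\<^bsub>P\<^esub> G) m = qfrac p (conv a G (corner - m))"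
      unfolding mult_P to_dual_mod by (simp add: to_dual_def True)
    also have "\<dots> = (\<Sum>b\<in>{b. b \<subseteq># corner - m}. qfrac p (a b * G (corner - m - b)))"
      by (simp add: conv_def qfrac_sum)
    also have "\<dots> = (\<Sum>b\<in>{b. b \<subseteq># corner - m}. smul (nat (a b)) (translate b (to_dual G) m))"
    proof (rule sum.cong[OF refl])
      fix b assume "b \<in> {b. b \<subseteq># corner - m}"
      then have "m + b \<in> box d q" using m by (simp add: box_iff add_subset_mset)
      then have "translate b (to_dual G) m = qfrac p (G (corner - m - b))"
        by (simp add: translate_def to_dual_def diff_diff_add_mset)
      then show "qfrac p (a b * G (corner - m - b)) = smul (nat (a b)) (translate b (to_dual G) m)"
        using a[of b] by (simp flip: qfrac_mult)
    qed
    also have "\<dots> = (\<Sum>b\<in>box d q. smul (nat (a b)) (translate b (to_dual G) m))"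
    proof (rule sum.mono_neutral_left[OF finite_box])
      show "{b. b \<subseteq># corner - m} \<subseteq> box d q"
        by (auto simp: box_iff intro: subset_mset.order_trans[OF _ diff_subset_eq_self])
      show "\<forall>b\<in>box d q - {b. b \<subseteq># corner - m}. smul (nat (a b)) (translate b (to_dual G) m) = 0"
      proof
        fix b assume "b \<in> box d q - {b. b \<subseteq># corner - m}"
        then have "\<not> m + b \<subseteq># corner"
          using diff_subset_mset[of "m + b" corner m] by auto
        then show "smul (nat (a b)) (translate b (to_dual G) m) = 0"
          by (simp add: translate_def to_dual_def box_iff)
      qed
    qed
    finally show ?thesis by (simp add: sum_apply smul_fun)
  next
    case False
    have "translate b (to_dual G) \<in> dual_space d p q" for b
      by (rule translate_dual_space[OF to_dual_in])
    then have "translate b (to_dual G) m = 0" for b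
      using False by (simp add: dual_space_def)
    then show ?thesis
      using False by (simp add: sum_apply smul_fun) (simp add: to_dual_def)
  qed
qed

lemma to_dual_surj:
  assumes "F \<in> dual_space d p q"
  obtains G where "G \<in> carrier P" "to_dual G = F"
proof -
  have "\<exists>k<p. F m = qfrac p (int k)" for m
    using assms torsion_qz[OF p_pos, of "F m"] by (auto simp: dual_space_def qfrac_of_nat)
  then obtain k where k: "\<And>m. k m < p" "\<And>m. F m = qfrac p (int (k m))" by metis
  define G where "G = (\<lambda>m. if m \<subseteq># corner then int (k (corner - m)) else 0)"
  have "G m = 0" if "\<not> set_mset m \<subseteq> {..d}" for m
    using that corner_subset set_mset_mono[of m corner] by (auto simp: G_def)
  then have "G \<in> carrier P"
    using k(1) by (auto simp: carrier_P G_def)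
  moreover have "to_dual G = F"
  proof
    fix m show "to_dual G m = F m"
    proof (cases "m \<in> box d q")
      case True
      then have "corner - (corner - m) = m"
        by (simp add: box_iff subset_mset.diff_diff_right)
      then show ?thesis
        using True k(2)[of m] by (simp add: to_dual_def G_def)
    next
      case False
      then show ?thesis using assms by (auto simp: to_dual_def dual_space_def)
    qed
  qed
  ultimately show ?thesis using that by blast
qed

text \<open>The kernel of \<open>to_dual\<close> consists of series that vanish on the box; with
  \<open>to_dual_surj\<close> this identifies the quotient with the dual space.\<close>

lemma to_dual_eq_zero:
  assumes "G \<in> carrier P" "to_dual G = 0" "m \<in> box d q"
  shows "G m = 0"
proof -
  have "m \<subseteq># corner" using assms(3) by (simp add: box_iff)
  then have "corner - m \<in> box d q" "corner - (corner - m) = m"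
    by (simp_all add: box_iff subset_mset.diff_diff_right)
  then have "qfrac p (G m) = 0"
    using fun_cong[OF assms(2), of "corner - m"] by (simp add: to_dual_def)
  then have "int p dvd G m" by (simp add: qfrac_eq_zero_iff p_pos)
  then show ?thesis using assms(1) by (auto simp: carrier_P) (metis mod_0_imp_dvd dvd_imp_mod_0)
qed

definition diag_red :: "nat multiset \<Rightarrow> int" where
  "diag_red = reduce_mod p (diag_series n d)"

lemma diag_red_closed: "diag_red \<in> carrier P"
proof -
  have "diag_series n d m = 0" if "\<not> set_mset m \<subseteq> {..d}" for m
  proof -
    have "m \<noteq> replicate_mset n 0" using that by (auto split: if_splits)
    moreover have "m \<noteq> replicate_mset 2 i" if "i \<in> {1..d}" for i
      using \<open>\<not> set_mset m \<subseteq> {..d}\<close> that by auto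
    ultimately show ?thesis
      by (simp add: diag_series_def monomial_def)
  qed
  then show ?thesis by (auto simp: diag_red_def reduce_mod_def carrier_P)
qed

lemma to_dual_diag_red: "to_dual (diag_red \<otimes>\<^bsub>P\<^esub> G) = diag_op n d (to_dual G)"
proof -
  have "to_dual (diag_red \<otimes>\<^bsub>P\<^esub> G) = to_dual (conv diag_red G)"
    by (simp add: mult_P to_dual_mod)
  also have "\<dots> = to_dual (conv (diag_series n d) G)"
    by (subst (1 2) to_dual_mod[symmetric]) (simp add: diag_red_def reduce_mod_def conv_mod_left)
  also have "conv (diag_series n d) G =
      (\<lambda>m. conv (monomial (replicate_mset n 0)) G m + (\<Sum>i\<in>{1..d}. conv (monomial (replicate_mset 2 i)) G m))"
    unfolding diag_series_def[abs_def] by (simp add: conv_add_left conv_sum_left fun_eq_iff)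
  also have "to_dual \<dots> = translate (replicate_mset n 0) (to_dual G)
      + (\<Sum>i\<in>{1..d}. translate (replicate_mset 2 i) (to_dual G))"
    unfolding to_dual_plus to_dual_sum to_dual_conv_monomial ..
  also have "\<dots> = diag_op n d (to_dual G)"
    by (simp add: diag_op_def translate_def fun_eq_iff sum_apply)
  finally show ?thesis .
qed

lemma to_dual_diag_red_power:
  assumes "G \<in> carrier P"
  shows "to_dual (diag_red [^]\<^bsub>P\<^esub> (a::nat) \<otimes>\<^bsub>P\<^esub> G) = (diag_op n d ^^ a) (to_dual G)"
  using assms
proof (induction a arbitrary: G)
  case (Suc a)
  have "diag_red [^]\<^bsub>P\<^esub> Suc a \<otimes>\<^bsub>P\<^esub> G = diag_red [^]\<^bsub>P\<^esub> a \<otimes>\<^bsub>P\<^esub> (diag_red \<otimes>\<^bsub>P\<^esub> G)"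
    using Suc.prems diag_red_closed by (simp add: m_assoc)
  then show ?case
    using Suc diag_red_closed by (simp only: m_closed to_dual_diag_red funpow_Suc_right o_apply)
qed simp

lemma to_dual_var_power:
  assumes "i \<le> d"
  shows "to_dual (ps_var R i [^]\<^bsub>P\<^esub> q) = 0"
proof
  fix m
  have "corner - m \<noteq> replicate_mset q i"
  proof
    assume "corner - m = replicate_mset q i"
    then have "count (corner - m) i = q" by simp
    then show False using assms q_pos by (simp add: count_corner)
  qed
  then show "to_dual (ps_var R i [^]\<^bsub>P\<^esub> q) m = 0 m"
    unfolding ps_var_power by (simp add: to_dual_def monomial_def)
qed

end

subsection \<open>Chains of submodules\<close>

text \<open>For \<open>v\<close> in \<open>B\<close> outside \<open>A\<close> the cosets
  \<open>k v + A\<close> with \<open>k < p\<close> are disjoint: otherwise \<open>A\<close> would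
  contain a multiple of \<open>v\<close> by a unit modulo \<open>p\<close>, and hence
  \<open>v\<close>.\<close>

lemma card_subgrp_mult_le:
  assumes p: "Factorial_Ring.prime p" and A: "subgrp A" and B: "subgrp B" "finite B"
    and AB: "A \<subset> B" and tors: "\<And>x. x \<in> B \<Longrightarrow> smul p x = 0"
  shows "p * card A \<le> card B"
proof -
  obtain v where v: "v \<in> B" "v \<notin> A" using AB by auto
  have *: "k = k'" if "k < p" "k' < p" "k \<le> k'" "x \<in> A" "x' \<in> A" "smul k v + x = smul k' v + x'" for k k' x x'
  proof (rule ccontr)
    assume "k \<noteq> k'"
    then have "0 < k' - k" "k' - k < p" using that by auto
    then have "coprime (k' - k) p"
      using p by (metis coprime_commute nat_dvd_not_less prime_imp_coprime)
    then obtain c where c: "smul c (smul (k' - k) v) = v"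
      using smul_inverse tors[OF v(1)] by blast
    have "smul k' v = smul (k' - k) v + smul k v"
      using that(3) by (simp flip: smul_add)
    then have "smul (k' - k) v = x - x'"
      using that(6) by (simp add: algebra_simps)
    then have "v \<in> A"
      using c subgrp_smul[OF A subgrp_diff[OF A that(4,5)], of c] by simp
    then show False using v(2) by simp
  qed
  have "inj_on (\<lambda>(k, x). smul k v + x) ({..<p} \<times> A)"
  proof (rule inj_onI)
    fix y y' assume "y \<in> {..<p} \<times> A" "y' \<in> {..<p} \<times> A"
      "(case y of (k, x) \<Rightarrow> smul k v + x) = (case y' of (k, x) \<Rightarrow> smul k v + x)"
    then obtain k x k' x' where h: "y = (k, x)" "y' = (k', x')" "k < p" "k' < p" "x \<in> A" "x' \<in> A"
      "smul k v + x = smul k' v + x'"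
      by auto
    then have "k = k'" using *[of k k' x x'] *[of k' k x' x] by (cases "k \<le> k'") auto
    then show "y = y'" using h by simp
  qed
  moreover have "(\<lambda>(k, x). smul k v + x) ` ({..<p} \<times> A) \<subseteq> B"
    using AB v(1) by (auto intro!: subgrp_add[OF B(1)] subgrp_smul[OF B(1)])
  ultimately have "card ({..<p} \<times> A) \<le> card B"
    using card_inj_on_le B(2) by blast
  then show ?thesis by (simp add: card_cartesian_product)
qed

text \<open>For subgroups of the dual space this amounts to being a submodule, as the coefficients
  of a series act by natural multiples.\<close>

definition translation_stable :: "(nat multiset \<Rightarrow> qz) set \<Rightarrow> bool" where
  "translation_stable N \<longleftrightarrow> (\<forall>F\<in>N. \<forall>b. translate b F \<in> N)"

lemma translation_stableD: "translation_stable N \<Longrightarrow> F \<in> N \<Longrightarrow> translate b F \<in> N"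
  by (simp add: translation_stable_def)

lemma stable_image_diag_op: "translation_stable ((diag_op n d ^^ a) ` dual_space d p q)"
proof -
  have "translate b ((diag_op n d ^^ a) F) = (diag_op n d ^^ a) (translate b F)" for b F
    using funpow_commute[of "diag_op n d" "translate b" a 1 F] by (simp add: diag_op_translate)
  then show ?thesis
    by (auto simp: translation_stable_def translate_dual_space)
qed

context residue_box
begin

lemma finite_D: "finite (dual_space d p q)"
  by (rule card_dual_space(2)[OF p_pos])

text \<open>Nilpotency of the variables enters through the choice of a function \<open>v\<close> outside \<open>A\<close> that is
  supported in minimal degree: its proper translates lie in \<open>A\<close>.\<close>

lemma extend_stable:
  assumes A: "subgrp A" "translation_stable A" "A \<subset> dual_space d p q"
  shows "\<exists>B. subgrp B \<and> translation_stable B \<and> A \<subset> B \<and> B \<subseteq> dual_space d p q \<and> card B = p * card A"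
proof -
  let ?D = "dual_space d p q"
  let ?small = "\<lambda>k v. v \<in> ?D - A \<and> (\<forall>m. size m \<ge> k \<longrightarrow> v m = 0)"
  have ex: "\<exists>k v. ?small k v"
  proof -
    obtain v where v: "v \<in> ?D - A" using A(3) by auto
    define k where "k = Suc (Max (size ` box d q))"
    have "v m = 0" if "size m \<ge> k" for m
    proof -
      have "m \<notin> box d q"
      proof
        assume "m \<in> box d q"
        then have "size m \<le> Max (size ` box d q)"
          by (intro Max_ge finite_imageI finite_box imageI)
        then show False using that by (simp add: k_def)
      qed
      then show ?thesis using v by (simp add: dual_space_def)
    qed
    then show ?thesis using v by blast
  qed
  define k where "k = (LEAST k. \<exists>v. ?small k v)"
  have "\<exists>v. ?small k v" unfolding k_def by (rule LeastI_ex[OF ex])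
  then obtain v where v: "v \<in> ?D - A" "\<And>m. size m \<ge> k \<Longrightarrow> v m = 0" by blast
  have shifted: "translate b v \<in> A" if "b \<noteq> {#}" for b
  proof (rule ccontr)
    assume "translate b v \<notin> A"
    then have "translate b v \<in> ?D - A"
      using v(1) by (simp add: translate_dual_space)
    moreover have "size b > 0" using that by (simp add: nonempty_has_size)
    then have "translate b v m = 0" if "size m \<ge> k - 1" for m
      using that v(2)[of "m + b"] by (simp add: translate_def)
    ultimately have "?small (k - 1) (translate b v)" by blast
    \<comment> \<open>With truncated subtraction this leaves \<open>k = 0\<close>, and then
      \<open>v\<close> vanishes everywhere.\<close>
    then have "k \<le> k - 1"
      unfolding k_def by (intro Least_le) blast
    then have "k = 0" by simp
    then have "v = 0" using v(2) by auto
    then show False using v(1) subgrp_zero[OF A(1)] by simp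
  qed
  define B where "B = (\<lambda>(k, x). smul k v + x) ` ({..<p} \<times> A)"
  have vt: "smul p v = 0" using v(1) dual_space_torsion[of v d p q] by simp
  have in_B: "smul k v + x \<in> B" if "x \<in> A" for k x
    unfolding B_def using that p_pos smul_mod[OF vt, of k]
    by (intro image_eqI[of _ _ "(k mod p, x)"]) auto
  have neg: "- smul k v = smul (k * (p - 1)) v" for k
  proof -
    have "smul (k * (p - 1)) v + smul k v = smul (k * (p - 1) + k) v" by (simp only: smul_add)
    also have "k * (p - 1) + k = k * p"
      using p_pos by (cases p) auto
    also have "smul (k * p) v = 0" by (simp add: smul_mult vt)
    finally have "smul k v + smul (k * (p - 1)) v = 0" by (simp only: add.commute)
    then show ?thesis by (rule Groups.minus_unique)
  qed
  have sub: "subgrp B"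
    unfolding subgrp_def
  proof (intro conjI ballI)
    show "0 \<in> B" using in_B[OF subgrp_zero[OF A(1)], of 0] by simp
  next
    fix y y' assume "y \<in> B" "y' \<in> B"
    then obtain i x j x' where y: "x \<in> A" "x' \<in> A" "y = smul i v + x" "y' = smul j v + x'"
      by (auto simp: B_def)
    have "y - y' = smul i v + - smul j v + (x - x')"
      using y by (simp add: algebra_simps)
    also have "\<dots> = smul (i + j * (p - 1)) v + (x - x')"
      unfolding neg smul_add ..
    finally show "y - y' \<in> B" using in_B subgrp_diff[OF A(1) y(1,2)] by simp
  qed
  have AB: "A \<subseteq> B" using in_B[of _ 0] by auto
  have "v \<in> B" using in_B[OF subgrp_zero[OF A(1)], of 1] by simp
  then have ABs: "A \<subset> B" using AB v(1) by auto
  have stab: "translation_stable B"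
    unfolding translation_stable_def
  proof (intro ballI allI)
    fix F b assume "F \<in> B"
    then obtain i x where F: "x \<in> A" "F = smul i v + x" by (auto simp: B_def)
    show "translate b F \<in> B"
    proof (cases "b = {#}")
      case True
      then show ?thesis using \<open>F \<in> B\<close> by (simp add: translate_def)
    next
      case False
      have "translate b F = smul i (translate b v) + translate b x"
        by (simp add: F additive.add[OF additive_translate] additive_smul[OF additive_translate])
      also have "\<dots> \<in> A"
        by (rule subgrp_add[OF A(1) subgrp_smul[OF A(1) shifted[OF False]] translation_stableD[OF A(2) F(1)]])
      finally show ?thesis using AB by auto
    qed
  qed
  have BD: "B \<subseteq> ?D"
    using v(1) A(3) unfolding B_def
    by (auto intro!: subgrp_add[OF subgrp_dual_space] subgrp_smul[OF subgrp_dual_space])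
  have fB: "finite B" using BD finite_D by (rule finite_subset)
  \<comment> \<open>The size of \<open>B\<close> is bounded above as that of an image of
    \<open>{..<p} \<times> A\<close> and below by the disjoint cosets of \<open>A\<close>.\<close>
  have "card B \<le> card ({..<p} \<times> A)"
    unfolding B_def using A(3) finite_D by (intro card_image_le) (auto intro: finite_subset)
  moreover have "p * card A \<le> card B"
    by (rule card_subgrp_mult_le[OF prime A(1) sub fB ABs]) (use BD dual_space_torsion in blast)
  ultimately have "card B = p * card A"
    by (simp add: card_cartesian_product)
  then show ?thesis using sub stab ABs BD by blast
qed

text \<open>Repeating \<open>extend_stable\<close> from \<open>A\<close> upwards gives a chain whose
  steps all have index \<open>p\<close>; it ends because the dual space is finite.\<close>

lemma stable_chain:
  assumes "subgrp A" "translation_stable A" "A \<subseteq> dual_space d p q"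
  shows "\<exists>k N. N 0 = A \<and> N k = dual_space d p q \<and> (\<forall>i<k. N i \<subset> N (Suc i)) \<and>
    (\<forall>i\<le>k. subgrp (N i) \<and> translation_stable (N i)) \<and> card (dual_space d p q) = p ^ k * card A"
  using assms
proof (induction "card (dual_space d p q) - card A" arbitrary: A rule: less_induct)
  case less
  let ?D = "dual_space d p q"
  show ?case
  proof (cases "A = ?D")
    case True
    then show ?thesis using less.prems
      by (intro exI[of _ "0::nat"] exI[of _ "\<lambda>_. A"]) simp
  next
    case False
    then obtain B where B: "subgrp B" "translation_stable B" "A \<subset> B" "B \<subseteq> ?D" "card B = p * card A"
      using extend_stable[of A] less.prems by blast
    have "card A < card B"
      using B(3,4) finite_D by (meson finite_subset psubset_card_mono)
    moreover have "card B \<le> card ?D"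
      using B(4) finite_D by (rule card_mono[rotated])
    ultimately have "card ?D - card B < card ?D - card A" by simp
    from less.hyps[OF this B(1,2,4)] obtain k N where N: "N 0 = B" "N k = ?D" "\<And>i. i < k \<Longrightarrow> N i \<subset> N (Suc i)"
      "\<And>i. i \<le> k \<Longrightarrow> subgrp (N i) \<and> translation_stable (N i)" "card ?D = p ^ k * card B"
      by auto
    show ?thesis
    proof (intro exI conjI)
      let ?N = "case_nat A N"
      show "?N 0 = A" "?N (Suc k) = ?D" by (simp_all add: N)
      show "\<forall>i<Suc k. ?N i \<subset> ?N (Suc i)"
        using N(1,3) B(3) by (auto split: nat.split)
      show "\<forall>i\<le>Suc k. subgrp (?N i) \<and> translation_stable (?N i)"
        using N(4) less.prems by (auto split: nat.split)
      show "card ?D = p ^ Suc k * card A"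
        using N(5) B(5) by simp
    qed
  qed
qed

subsection \<open>The length of the quotient ring\<close>

text \<open>Transports the additive group of the factor ring to \<open>quotient_module\<close>; the
  two records share the group operations but differ in type.\<close>

lemma group_cong:
  assumes "group G" "carrier H = carrier G" "monoid.mult H = monoid.mult G" "one H = one G"
  shows "group H"
proof -
  interpret group G by (rule assms(1))
  show ?thesis
    by (rule groupI) (auto simp: assms(2-4) m_assoc intro: bexI[of _ "inv\<^bsub>G\<^esub> _"])
qed

definition image_power :: "nat \<Rightarrow> (nat multiset \<Rightarrow> qz) set" where
  "image_power a = (diag_op n d ^^ a) ` dual_space d p q"

lemma image_power_sub: "image_power a \<subseteq> dual_space d p q"
  and subgrp_image_power: "subgrp (image_power a)"
  and stable_image_power: "translation_stable (image_power a)"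
  by (auto simp: image_power_def funpow_diag_op_dual_space stable_image_diag_op
      intro!: subgrp_image subgrp_dual_space additive_funpow additive_diag_op)

text \<open>The ideal \<open>(f^a, x_0^q, ..., x_d^q)\<close> seen from the dual side;
  \<open>h_ideal_eq\<close> proves the equality.\<close>

definition dual_ideal :: "nat \<Rightarrow> (nat multiset \<Rightarrow> int) set" where
  "dual_ideal a = {G \<in> carrier P. to_dual G \<in> image_power a}"

lemma to_dual_mult_stable:
  assumes "subgrp N" "translation_stable N" "to_dual G \<in> N" "s \<in> carrier P"
  shows "to_dual (s \<otimes>\<^bsub>P\<^esub> G) \<in> N"
  unfolding to_dual_mult[OF assms(4)]
  using assms by (intro subgrp_sum subgrp_smul translation_stableD)

lemma ideal_dual_ideal: "ideal (dual_ideal a) P"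
proof (rule idealI)
  show "ring P" by (rule ring_axioms)
  show "subgroup (dual_ideal a) (add_monoid P)"
  proof (rule add.subgroupI)
    show "dual_ideal a \<subseteq> carrier P" by (auto simp: dual_ideal_def)
    have "\<zero>\<^bsub>P\<^esub> \<in> dual_ideal a"
      using subgrp_zero[OF subgrp_image_power] by (simp add: dual_ideal_def to_dual_zero)
    then show "dual_ideal a \<noteq> {}" by auto
  next
    fix G assume G: "G \<in> dual_ideal a"
    then have "\<ominus>\<^bsub>P\<^esub> G = \<zero>\<^bsub>P\<^esub> \<ominus>\<^bsub>P\<^esub> G" by (simp add: dual_ideal_def minus_eq)
    then show "\<ominus>\<^bsub>P\<^esub> G \<in> dual_ideal a"
      using G to_dual_minus[of "\<zero>\<^bsub>P\<^esub>" G] subgrp_uminus[OF subgrp_image_power]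
      by (simp add: dual_ideal_def to_dual_zero)
  next
    fix G H assume "G \<in> dual_ideal a" "H \<in> dual_ideal a"
    then show "G \<oplus>\<^bsub>P\<^esub> H \<in> dual_ideal a"
      by (simp add: dual_ideal_def to_dual_add subgrp_add[OF subgrp_image_power])
  qed
  fix G s assume "G \<in> dual_ideal a" "s \<in> carrier P"
  then show "s \<otimes>\<^bsub>P\<^esub> G \<in> dual_ideal a"
    by (simp add: dual_ideal_def to_dual_mult_stable[OF subgrp_image_power stable_image_power])
  then show "G \<otimes>\<^bsub>P\<^esub> s \<in> dual_ideal a"
    using \<open>G \<in> dual_ideal a\<close> \<open>s \<in> carrier P\<close> by (simp add: dual_ideal_def m_comm)
qed

text \<open>Each remaining monomial is a multiple of some \<open>x_i^q\<close>. There may be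
  infinitely many of them, so the series is split into finitely many multiples of the
  \<open>x_i^q\<close>, one variable at a time.\<close>

lemma vanishing_in_ideal:
  assumes I: "ideal I P" and vars: "\<And>i. i \<le> d \<Longrightarrow> ps_var R i [^]\<^bsub>P\<^esub> q \<in> I"
    and G: "G \<in> carrier P" and k: "k \<le> d + 1"
    and zero: "\<And>m. (\<forall>i<k. count m i < q) \<Longrightarrow> G m = 0"
  shows "G \<in> I"
  using G k zero
proof (induction k arbitrary: G)
  case 0
  then have "G = \<zero>\<^bsub>P\<^esub>" by (simp add: zero_P fun_eq_iff)
  then show ?case
    using additive_subgroup.zero_closed[OF ideal.axioms(1)[OF I]] by simp
next
  case (Suc k)
  let ?x = "replicate_mset q k"
  \<comment> \<open>\<open>G'\<close> collects the terms in which the exponent of \<open>x_k\<close>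
    is below \<open>q\<close>; the others form \<open>x_k^q H\<close>.\<close>
  define G' where "G' = (\<lambda>m. if count m k < q then G m else 0)"
  define H where "H = (\<lambda>m. G (m + ?x))"
  have kd: "k \<le> d" using Suc.prems(2) by simp
  have G'P: "G' \<in> carrier P"
    using Suc.prems(1) by (auto simp: G'_def carrier_P)
  have HP: "H \<in> carrier P"
    using Suc.prems(1) by (auto simp: H_def carrier_P)
  have G'I: "G' \<in> I"
  proof (rule Suc.IH[OF G'P])
    fix m assume "\<forall>i<k. count m i < q"
    then show "G' m = 0"
      using Suc.prems(3)[of m] by (auto simp: G'_def less_Suc_eq)
  qed (use Suc.prems(2) in simp)
  have "?x \<subseteq># m \<longleftrightarrow> \<not> count m k < q" for m
    by (auto simp: subseteq_mset_def dest: spec[of _ k])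
  then have "G = G' \<oplus>\<^bsub>P\<^esub> (ps_var R k [^]\<^bsub>P\<^esub> q \<otimes>\<^bsub>P\<^esub> H)"
    using Suc.prems(1) unfolding ps_var_power
    by (auto simp: add_P mult_P conv_monomial G'_def H_def carrier_P fun_eq_iff)
  moreover have "ps_var R k [^]\<^bsub>P\<^esub> q \<otimes>\<^bsub>P\<^esub> H \<in> I"
    by (rule ideal.I_r_closed[OF I vars[OF kd] HP])
  ultimately show ?case
    using additive_subgroup.a_closed[OF ideal.axioms(1)[OF I] G'I] by simp
qed

text \<open>The generators map into the image of \<open>f^a\<close>, the \<open>x_i^q\<close> to 0.
  Conversely, if \<open>G\<close> maps to \<open>f^a F\<close>, lift \<open>F\<close> to
  \<open>H\<close>; then \<open>G - f^a H\<close> has dual 0, so it vanishes on the box and lies in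
  the ideal of the \<open>x_i^q\<close>.\<close>

lemma h_ideal_eq: "h_ideal R d diag_red a q = dual_ideal (nat a)"
proof -
  let ?gens = "{diag_red [^]\<^bsub>P\<^esub> nat a} \<union> (\<lambda>i. ps_var R i [^]\<^bsub>P\<^esub> q) ` {..d}"
  have vars: "ps_var R i [^]\<^bsub>P\<^esub> q \<in> carrier P" if "i \<le> d" for i
    unfolding ps_var_power using that by (intro monomial_closed) auto
  have gens: "?gens \<subseteq> carrier P"
    using vars diag_red_closed by auto
  have I: "ideal (genideal P ?gens) P"
    by (rule genideal_ideal[OF gens])
  have self: "?gens \<subseteq> genideal P ?gens"
    by (rule genideal_self[OF gens])
  have "genideal P ?gens = dual_ideal (nat a)"
  proof (intro subset_antisym genideal_minimal[OF ideal_dual_ideal] subsetI)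
    fix G assume "G \<in> ?gens"
    then consider "G = diag_red [^]\<^bsub>P\<^esub> nat a" | i where "i \<le> d" "G = ps_var R i [^]\<^bsub>P\<^esub> q" by auto
    then show "G \<in> dual_ideal (nat a)"
    proof cases
      case 1
      then have "to_dual G = (diag_op n d ^^ nat a) (to_dual \<one>\<^bsub>P\<^esub>)"
        using to_dual_diag_red_power[of "\<one>\<^bsub>P\<^esub>" "nat a"] diag_red_closed by simp
      then show ?thesis
        using 1 gens to_dual_in by (auto simp: dual_ideal_def image_power_def)
    next
      case 2
      then show ?thesis
        using vars to_dual_var_power subgrp_zero[OF subgrp_image_power] by (simp add: dual_ideal_def)
    qed
  next
    fix G assume "G \<in> dual_ideal (nat a)"
    then obtain F where F: "G \<in> carrier P" "F \<in> dual_space d p q" "to_dual G = (diag_op n d ^^ nat a) F"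
      by (auto simp: dual_ideal_def image_power_def)
    obtain H where H: "H \<in> carrier P" "to_dual H = F"
      using to_dual_surj[OF F(2)] by blast
    let ?fH = "diag_red [^]\<^bsub>P\<^esub> nat a \<otimes>\<^bsub>P\<^esub> H"
    have fH: "?fH \<in> carrier P" using H(1) diag_red_closed by simp
    have fHI: "?fH \<in> genideal P ?gens"
      by (rule ideal.I_r_closed[OF I _ H(1)]) (use self in auto)
    have "to_dual (G \<ominus>\<^bsub>P\<^esub> ?fH) = 0"
      using F(3) H(2) by (simp only: to_dual_minus[OF F(1) fH] to_dual_diag_red_power[OF H(1)]) simp
    then have van: "(G \<ominus>\<^bsub>P\<^esub> ?fH) m = 0" if "m \<in> box d q" for m
      using to_dual_eq_zero[OF _ _ that] F(1) fH by simp
    have "G \<ominus>\<^bsub>P\<^esub> ?fH \<in> genideal P ?gens"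
    proof (rule vanishing_in_ideal[OF I, where k = "d + 1"])
      show "ps_var R i [^]\<^bsub>P\<^esub> q \<in> genideal P ?gens" if "i \<le> d" for i
        using self that by auto
      show C: "G \<ominus>\<^bsub>P\<^esub> ?fH \<in> carrier P" using F(1) fH by simp
      fix m assume m: "\<forall>i<d + 1. count m i < q"
      show "(G \<ominus>\<^bsub>P\<^esub> ?fH) m = 0"
      proof (cases "set_mset m \<subseteq> {..d}")
        case True
        then have "m \<in> box d q"
          using m by (intro box_I) (auto simp: not_in_iff[symmetric])
        then show ?thesis by (rule van)
      next
        case False
        then show ?thesis using C unfolding carrier_P by blast
      qed
    qed simp
    then have "(G \<ominus>\<^bsub>P\<^esub> ?fH) \<oplus>\<^bsub>P\<^esub> ?fH \<in> genideal P ?gens"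
      using additive_subgroup.a_closed[OF ideal.axioms(1)[OF I] _ fHI] by blast
    moreover have "(G \<ominus>\<^bsub>P\<^esub> ?fH) \<oplus>\<^bsub>P\<^esub> ?fH = G"
      using F(1) fH by (simp add: minus_eq a_assoc l_neg)
    ultimately show "G \<in> genideal P ?gens" by simp
  qed
  then show ?thesis by (simp add: h_ideal_def)
qed

section \<open>Submodules of the quotient and stable subgroups of the dual space\<close>

context
  fixes a :: nat
begin

interpretation J: ideal "dual_ideal a" P
  by (rule ideal_dual_ideal)

abbreviation coset where "coset G \<equiv> dual_ideal a +>\<^bsub>P\<^esub> G"
abbreviation M where "M \<equiv> quotient_module P (dual_ideal a)"

lemma add_M: "G \<in> carrier P \<Longrightarrow> H \<in> carrier P \<Longrightarrow> coset G \<oplus>\<^bsub>M\<^esub> coset H = coset (G \<oplus>\<^bsub>P\<^esub> H)"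
  by (simp add: quotient_module_def FactRing_def J.a_rcos_sum)

lemma smult_M: "s \<in> carrier P \<Longrightarrow> G \<in> carrier P \<Longrightarrow> s \<odot>\<^bsub>M\<^esub> coset G = coset (s \<otimes>\<^bsub>P\<^esub> G)"
  by (simp add: quotient_module_def FactRing_def J.rcoset_mult_add)

lemma zero_M: "\<zero>\<^bsub>M\<^esub> = coset \<zero>\<^bsub>P\<^esub>"
  using a_coset_join2[OF zero_closed J.is_additive_subgroup[THEN additive_subgroup.a_subgroup] J.zero_closed]
  by (simp add: quotient_module_def FactRing_def)

lemma carrier_M: "carrier M = coset ` carrier P"
  by (auto simp: quotient_module_def FactRing_def A_RCOSETS_defs a_r_coset_def r_coset_def)

lemma coset_eq_iff:
  assumes "G \<in> carrier P" "H \<in> carrier P"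
  shows "coset G = coset H \<longleftrightarrow> to_dual G - to_dual H \<in> image_power a"
proof -
  have "coset G = coset H \<longleftrightarrow> G \<ominus>\<^bsub>P\<^esub> H \<in> dual_ideal a"
    by (rule quotient_eq_iff_same_a_r_cos[OF ideal_dual_ideal assms, symmetric])
  also have "\<dots> \<longleftrightarrow> to_dual (G \<ominus>\<^bsub>P\<^esub> H) \<in> image_power a"
    using minus_closed[OF assms] by (simp only: dual_ideal_def mem_Collect_eq simp_thms)
  finally show ?thesis
    by (simp only: to_dual_minus[OF assms])
qed

text \<open>One half of the correspondence between submodules of the quotient and subgroups that lie
  between the image of \<open>f^a\<close> and the dual space.\<close>

lemma submodule_imp_subgrp:
  assumes N: "submodule N P M"
  defines "N' \<equiv> {to_dual G | G. G \<in> carrier P \<and> coset G \<in> N}"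
  shows "subgrp N'" "image_power a \<subseteq> N'" "N' \<subseteq> dual_space d p q"
    "G \<in> carrier P \<Longrightarrow> to_dual G \<in> N' \<longleftrightarrow> coset G \<in> N"
proof -
  interpret N: submodule N P M by (rule N)
  have zero: "coset \<zero>\<^bsub>P\<^esub> \<in> N" using N.one_closed zero_M by simp
  have add: "coset (G \<oplus>\<^bsub>P\<^esub> H) \<in> N" if "G \<in> carrier P" "H \<in> carrier P" "coset G \<in> N" "coset H \<in> N" for G H
    using N.m_closed[OF that(3,4)] add_M[OF that(1,2)] by simp
  have uminus: "coset (\<ominus>\<^bsub>P\<^esub> G) \<in> N" if "G \<in> carrier P" "coset G \<in> N" for G
  proof -
    have "(\<ominus>\<^bsub>P\<^esub> \<one>\<^bsub>P\<^esub>) \<odot>\<^bsub>M\<^esub> coset G \<in> N"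
      by (rule N.smult_closed) (use that in auto)
    then show ?thesis using that by (simp add: smult_M l_minus)
  qed
  show mem: "to_dual G \<in> N' \<longleftrightarrow> coset G \<in> N" if "G \<in> carrier P" for G
  proof
    assume "to_dual G \<in> N'"
    then obtain H where H: "H \<in> carrier P" "coset H \<in> N" "to_dual G = to_dual H"
      unfolding N'_def by auto
    then have "coset G = coset H"
      using coset_eq_iff[OF that H(1)] subgrp_zero[OF subgrp_image_power] by simp
    then show "coset G \<in> N" using H(2) by simp
  qed (use that N'_def in auto)
  show "N' \<subseteq> dual_space d p q"
    using to_dual_in by (auto simp: N'_def)
  show "subgrp N'"
    unfolding subgrp_def
  proof (intro conjI ballI)
    show "0 \<in> N'" using mem[of "\<zero>\<^bsub>P\<^esub>"] zero by (simp add: to_dual_zero)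
  next
    fix x y assume "x \<in> N'" "y \<in> N'"
    then obtain G H where GH: "G \<in> carrier P" "H \<in> carrier P" "coset G \<in> N" "coset H \<in> N"
      "x = to_dual G" "y = to_dual H" unfolding N'_def by auto
    have "coset (G \<ominus>\<^bsub>P\<^esub> H) \<in> N"
      using add[of G "\<ominus>\<^bsub>P\<^esub> H"] uminus[of H] GH by (simp add: minus_eq)
    then show "x - y \<in> N'"
      using mem[of "G \<ominus>\<^bsub>P\<^esub> H"] GH by (simp add: to_dual_minus)
  qed
  show "image_power a \<subseteq> N'"
  proof
    fix F assume F: "F \<in> image_power a"
    then obtain G where G: "G \<in> carrier P" "to_dual G = F"
      using image_power_sub to_dual_surj by blast
    have "coset G = coset \<zero>\<^bsub>P\<^esub>"
      using coset_eq_iff[OF G(1) zero_closed] F G(2) by (simp add: to_dual_zero)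
    then show "F \<in> N'" using mem[OF G(1)] G(2) zero by simp
  qed
qed

lemma subgrp_imp_submodule:
  assumes N: "subgrp N" "translation_stable N"
  shows "submodule (coset ` {G \<in> carrier P. to_dual G \<in> N}) P M"
proof -
  let ?N = "coset ` {G \<in> carrier P. to_dual G \<in> N}"
  have grp: "group (add_monoid M)"
  proof -
    have "abelian_group (P Quot dual_ideal a)"
      using J.quotient_is_ring by (rule ring.is_abelian_group)
    then have "group (add_monoid (P Quot dual_ideal a))"
      by (rule abelian_group.a_group)
    then show ?thesis
      by (rule group_cong) (simp_all add: quotient_module_def)
  qed
  have "subgroup ?N (add_monoid M)"
  proof (rule group.subgroupI[OF grp])
    show "?N \<subseteq> carrier (add_monoid M)" by (auto simp: carrier_M)
    have "\<zero>\<^bsub>P\<^esub> \<in> {G \<in> carrier P. to_dual G \<in> N}" by (simp add: to_dual_zero subgrp_zero[OF N(1)])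
    then show "?N \<noteq> {}" by blast
  next
    fix y assume "y \<in> ?N"
    then obtain G where G: "y = coset G" "G \<in> carrier P" "to_dual G \<in> N" by auto
    have "inv\<^bsub>add_monoid M\<^esub> y = coset (\<ominus>\<^bsub>P\<^esub> G)"
    proof (rule group.inv_equality[OF grp])
      show "coset (\<ominus>\<^bsub>P\<^esub> G) \<otimes>\<^bsub>add_monoid M\<^esub> y = \<one>\<^bsub>add_monoid M\<^esub>"
        using add_M[of "\<ominus>\<^bsub>P\<^esub> G" G] G(2) by (simp add: G(1) zero_M l_neg)
    qed (use G carrier_M in auto)
    moreover have "to_dual (\<ominus>\<^bsub>P\<^esub> G) = - to_dual G"
      using to_dual_minus[of "\<zero>\<^bsub>P\<^esub>" G] G(2) by (simp add: to_dual_zero minus_eq)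
    ultimately show "inv\<^bsub>add_monoid M\<^esub> y \<in> ?N"
      using G subgrp_uminus[OF N(1)] by auto
  next
    fix y z assume "y \<in> ?N" "z \<in> ?N"
    then obtain G H where GH: "y = coset G" "z = coset H" "G \<in> carrier P" "H \<in> carrier P"
      "to_dual G \<in> N" "to_dual H \<in> N" by auto
    have "y \<otimes>\<^bsub>add_monoid M\<^esub> z = coset (G \<oplus>\<^bsub>P\<^esub> H)"
      using add_M[OF GH(3,4)] GH(1,2) by simp
    moreover have "G \<oplus>\<^bsub>P\<^esub> H \<in> {G \<in> carrier P. to_dual G \<in> N}"
      using GH subgrp_add[OF N(1)] by (simp add: to_dual_add)
    ultimately show "y \<otimes>\<^bsub>add_monoid M\<^esub> z \<in> ?N" by blast
  qed
  moreover have "s \<odot>\<^bsub>M\<^esub> y \<in> ?N" if "s \<in> carrier P" "y \<in> ?N" for s y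
  proof -
    from that(2) obtain G where G: "y = coset G" "G \<in> carrier P" "to_dual G \<in> N" by auto
    have "s \<otimes>\<^bsub>P\<^esub> G \<in> {G \<in> carrier P. to_dual G \<in> N}"
      using to_dual_mult_stable[OF N G(3) that(1)] G(2) that(1) by simp
    then show ?thesis using smult_M[OF that(1) G(2)] G(1) by blast
  qed
  ultimately show ?thesis
    by (intro submodule.intro submodule_axioms.intro) auto
qed

text \<open>Under the correspondence each strict inclusion multiplies the cardinality by at least
  \<open>p\<close>.\<close>

lemma chain_length_le:
  assumes N: "\<And>i. i \<le> k \<Longrightarrow> submodule (N i) P M" and strict: "\<And>i. i < k \<Longrightarrow> N i \<subset> N (Suc i)"
  shows "p ^ k * card (image_power a) \<le> card (dual_space d p q)"
proof -
  define N' where "N' i = {to_dual G | G. G \<in> carrier P \<and> coset G \<in> N i}" for i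
  note N'I = submodule_imp_subgrp[OF N, folded N'_def]
  have fin: "finite (N' i)" if "i \<le> k" for i
    using N'I(3)[OF that] finite_D by (rule finite_subset)
  have "p ^ i * card (image_power a) \<le> card (N' i)" if "i \<le> k" for i
    using that
  proof (induction i)
    case 0
    then show ?case using card_mono[OF fin N'I(2)] by simp
  next
    case (Suc i)
    have "N' i \<subset> N' (Suc i)"
    proof
      show "N' i \<subseteq> N' (Suc i)" using strict[of i] Suc.prems by (auto simp: N'_def)
      obtain Y where Y: "Y \<in> N (Suc i)" "Y \<notin> N i" using strict[of i] Suc.prems by auto
      have "Y \<in> carrier M"
        using Y(1) submodule.axioms(1)[OF N[OF Suc.prems]] subgroup.subset by fastforce
      then obtain G where G: "G \<in> carrier P" "Y = coset G" by (auto simp: carrier_M)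
      then show "N' i \<noteq> N' (Suc i)"
        using Y N'I(4)[of i G] N'I(4)[of "Suc i" G] Suc.prems by auto
    qed
    then have "p * card (N' i) \<le> card (N' (Suc i))"
      using Suc.prems N'I(3)[of "Suc i"] dual_space_torsion
      by (intro card_subgrp_mult_le[OF prime N'I(1) N'I(1) fin]) auto
    moreover have "p * (p ^ i * card (image_power a)) \<le> p * card (N' i)"
      using Suc by simp
    ultimately show ?case
      by (simp only: power_Suc mult.assoc)
  qed
  from this[of k] show ?thesis
    using card_mono[OF finite_D N'I(3)[of k]] by simp
qed

text \<open>The quotient corresponds to the cokernel of \<open>f^a\<close> on the dual space, which
  has as many elements as the kernel. By \<open>chain_length_le\<close> no chain is longer than the
  logarithm of this number, and \<open>stable_chain\<close> attains it.\<close>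

lemma module_length_quotient:
  "\<exists>L. module_length P M = enat L \<and> card (diag_kernel n d p q a) = p ^ L"
proof -
  let ?D = "dual_space d p q"
  have cD: "card ?D = card (image_power a) * card (diag_kernel n d p q a)"
    unfolding image_power_def diag_kernel_def
    by (intro card_image_times_kernel finite_D subgrp_dual_space additive_funpow additive_diag_op)
  have fI: "finite (image_power a)" using image_power_sub finite_D by (rule finite_subset)
  then have cI: "card (image_power a) > 0"
    using subgrp_zero[OF subgrp_image_power] by (auto simp: card_gt_0_iff)
  obtain L N where chain: "N 0 = image_power a \<and> N L = ?D \<and> (\<forall>i<L. N i \<subset> N (Suc i)) \<and>
    (\<forall>i\<le>L. subgrp (N i) \<and> translation_stable (N i)) \<and> card ?D = p ^ L * card (image_power a)"
    using stable_chain[OF subgrp_image_power[of a] stable_image_power image_power_sub] by blast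
  then have N: "N 0 = image_power a" "N L = ?D" "\<And>i. i < L \<Longrightarrow> N i \<subset> N (Suc i)"
    "\<And>i. i \<le> L \<Longrightarrow> subgrp (N i) \<and> translation_stable (N i)" "card ?D = p ^ L * card (image_power a)"
    by simp_all
  have card: "card (diag_kernel n d p q a) = p ^ L"
    using N(5) cD cI by simp
  have upper: "k \<le> L"
    if "\<forall>i\<le>k. submodule (K i) P M" "\<forall>i<k. K i \<subset> K (Suc i)" for k K
  proof -
    have "p ^ k * card (image_power a) \<le> p ^ L * card (image_power a)"
      using chain_length_le[of k K] that N(5) by simp
    then have "p ^ k \<le> p ^ L" using cI by simp
    then show ?thesis
      by (rule power_le_imp_le_exp[OF prime_gt_1_nat[OF prime]])
  qed
  define K where "K i = coset ` {G \<in> carrier P. to_dual G \<in> N i}" for i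
  have subm: "\<forall>i\<le>L. submodule (K i) P M"
    unfolding K_def using subgrp_imp_submodule N(4) by blast
  have mono: "i \<le> L \<Longrightarrow> image_power a \<subseteq> N i" for i
  proof (induction i)
    case (Suc i)
    then show ?case using N(3)[of i] by auto
  qed (simp add: N(1))
  have DN: "i \<le> L \<Longrightarrow> N i \<subseteq> ?D" for i
  proof (induction i rule: inc_induct)
    case (step i)
    then show ?case using N(3)[of i] by auto
  qed (simp add: N(2))
  have strict: "K i \<subset> K (Suc i)" if "i < L" for i
  proof
    show "K i \<subseteq> K (Suc i)" using N(3)[OF that] by (auto simp: K_def)
    from N(3)[OF that] obtain F where F: "F \<in> N (Suc i)" "F \<notin> N i" by auto
    from that DN[of "Suc i"] F(1) have "F \<in> ?D" by auto
    then obtain G where G: "G \<in> carrier P" "to_dual G = F"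
      by (rule to_dual_surj)
    have "coset G \<notin> K i"
    proof
      assume "coset G \<in> K i"
      then obtain H where H: "H \<in> carrier P" "to_dual H \<in> N i" "coset G = coset H" by (auto simp: K_def)
      then have "to_dual G - to_dual H \<in> N i"
        using coset_eq_iff[OF G(1) H(1)] mono[of i] that by auto
      then have "to_dual G - to_dual H + to_dual H \<in> N i"
        using N(4)[of i] that H(2) by (intro subgrp_add) auto
      then show False using F(2) G(2) by simp
    qed
    then show "K i \<noteq> K (Suc i)" using F(1) G by (auto simp: K_def)
  qed
  have "module_length P M = enat L"
    unfolding module_length_def
  proof (rule antisym)
    show "Sup {enat n |n. \<exists>N. (\<forall>i\<le>n. submodule (N i) P M) \<and> (\<forall>i<n. N i \<subset> N (Suc i))} \<le> enat L"
      by (rule Sup_least) (use upper in auto)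
    show "enat L \<le> Sup {enat n |n. \<exists>N. (\<forall>i\<le>n. submodule (N i) P M) \<and> (\<forall>i<n. N i \<subset> N (Suc i))}"
      by (rule Sup_upper) (use subm strict in auto)
  qed
  then show ?thesis using card by blast
qed

end

end

subsection \<open>The h-function\<close>

lemma ring_characteristic_residue_ring:
  assumes "p > 1"
  shows "ring_characteristic (residue_ring (int p)) = p"
proof -
  interpret residues "int p" "residue_ring (int p)"
    by unfold_locales (use assms in auto)
  let ?G = "add_monoid (residue_ring (int p))"
  have grp: "group ?G" by (rule a_group)
  have one: "\<one>\<^bsub>residue_ring (int p)\<^esub> \<in> carrier ?G" by simp
  have pow: "\<one>\<^bsub>residue_ring (int p)\<^esub> [^]\<^bsub>?G\<^esub> (k::nat) = int k mod int p" for k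
  proof (induction k)
    case 0
    then show ?case by (simp add: residue_ring_def nat_pow_def)
  next
    case (Suc k)
    then show ?case
      by (simp add: monoid.nat_pow_Suc[OF group.is_monoid[OF grp]] res_add_eq res_one_eq)
         (simp add: mod_simps add.commute)
  qed
  have "group.ord ?G \<one>\<^bsub>residue_ring (int p)\<^esub> dvd k \<longleftrightarrow> p dvd k" for k
  proof -
    have "group.ord ?G \<one>\<^bsub>residue_ring (int p)\<^esub> dvd k \<longleftrightarrow> int k mod int p = 0"
      using group.pow_eq_id[OF grp one, of k] unfolding pow by (simp add: residue_ring_def)
    then show ?thesis by (simp add: mod_eq_0_iff_dvd)
  qed
  then show ?thesis
    unfolding ring_characteristic_def by (metis dvd_antisym dvd_refl)
qed

lemma kernel_dim_nonneg: "p > 1 \<Longrightarrow> kernel_dim n d p q a \<ge> 0"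
  using card_diag_kernel_pos[of p n d q a] by (simp add: kernel_dim_def)

lemma kernel_dim_frobenius_power:
  assumes "Factorial_Ring.prime p"
  shows "kernel_dim n d p (p ^ e * q) (p ^ e * a) = real p ^ (e * (d + 1)) * kernel_dim n d p q a"
proof (induction e)
  case (Suc e)
  have "kernel_dim n d p (p ^ Suc e * q) (p ^ Suc e * a) = kernel_dim n d p (p * (p ^ e * q)) (p * (p ^ e * a))"
    by (simp only: power_Suc mult.assoc)
  also have "\<dots> = real p ^ (d + 1) * kernel_dim n d p (p ^ e * q) (p ^ e * a)"
    by (rule kernel_dim_frobenius[OF assms])
  also have "\<dots> = real p ^ (Suc e * (d + 1)) * kernel_dim n d p q a"
    unfolding Suc by (simp add: power_add)
  finally show ?case .
qed simp

lemma h_function_diag: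
  assumes prime: "Factorial_Ring.prime p"
  shows "h_function (residue_ring (int p)) d (reduce_mod p (diag_series n d)) x =
    lim (\<lambda>e. kernel_dim n d p (p ^ e) (nat \<lceil>x * real p ^ e\<rceil>) / real p ^ (e * (d + 1)))"
proof -
  have p: "p > 1" using prime prime_gt_1_nat by blast
  have "real (the_enat (module_length (power_series_ring (residue_ring (int p)) {..d})
        (quotient_module (power_series_ring (residue_ring (int p)) {..d})
          (h_ideal (residue_ring (int p)) d (reduce_mod p (diag_series n d)) a (p ^ e)))))
      = kernel_dim n d p (p ^ e) (nat a)" for e a
  proof -
    interpret residue_box n d p "p ^ e"
      by standard (use prime p in auto)
    obtain L where "module_length P (quotient_module P (dual_ideal (nat a))) = enat L"
      "card (diag_kernel n d p (p ^ e) (nat a)) = p ^ L"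
      using module_length_quotient by blast
    then show ?thesis
      using p h_ideal_eq[of a] by (simp add: diag_red_def kernel_dim_def log_nat_power)
  qed
  then show ?thesis
    by (simp add: h_function_def Let_def ring_characteristic_residue_ring[OF p])
qed

text \<open>The normalized lengths decrease in \<open>e\<close>, as
  \<open>\<lceil>p y\<rceil> \<le> p \<lceil>y\<rceil>\<close>, so the term \<open>e = 1\<close>
  bounds the limit from above. From below, \<open>p^e (\<lceil>x p\<rceil> - 1) \<le> \<lceil>x
  p^(e+1)\<rceil>\<close> and Frobenius bound all terms from \<open>e = 1\<close> on by the same
  number.\<close>

lemma h_function_bounds:
  fixes n d p :: nat and x :: real
  assumes prime: "Factorial_Ring.prime p" and x: "x \<in> {0..1}"
  defines "h \<equiv> h_function (residue_ring (int p)) d (reduce_mod p (diag_series n d)) x"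
  shows "kernel_dim n d p p (nat \<lceil>x * real p\<rceil> - 1) / real p ^ (d + 1) \<le> h"
    and "h \<le> kernel_dim n d p p (nat \<lceil>x * real p\<rceil>) / real p ^ (d + 1)"
proof -
  have p: "p > 1" using prime prime_gt_1_nat by blast
  define s where "s e = kernel_dim n d p (p ^ e) (nat \<lceil>x * real p ^ e\<rceil>) / real p ^ (e * (d + 1))" for e
  have frob: "kernel_dim n d p q b / real p ^ k = kernel_dim n d p (p ^ e * q) (p ^ e * b) / real p ^ (e * (d + 1) + k)"
    for q b k e
    using p by (simp add: kernel_dim_frobenius_power[OF prime] power_add)
  have step: "s (Suc e) \<le> s e" for e
  proof -
    have "x * real p ^ Suc e \<le> of_int (int p * \<lceil>x * real p ^ e\<rceil>)"
      using mult_left_mono[OF le_of_int_ceiling[of "x * real p ^ e"], of "real p"] by (simp add: mult_ac)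
    then have "nat \<lceil>x * real p ^ Suc e\<rceil> \<le> nat (int p * \<lceil>x * real p ^ e\<rceil>)"
      by (intro nat_mono) (simp only: ceiling_le_iff)
    also have "\<dots> = p * nat \<lceil>x * real p ^ e\<rceil>"
      by (simp add: nat_mult_distrib)
    finally have "kernel_dim n d p (p ^ Suc e) (nat \<lceil>x * real p ^ Suc e\<rceil>) \<le>
        kernel_dim n d p (p ^ Suc e) (p * nat \<lceil>x * real p ^ e\<rceil>)"
      by (intro kernel_dim_mono[OF p])
    then have "s (Suc e) \<le> kernel_dim n d p (p ^ Suc e) (p * nat \<lceil>x * real p ^ e\<rceil>) / real p ^ (Suc e * (d + 1))"
      unfolding s_def by (rule divide_right_mono) simp
    also have "\<dots> = s e"
      unfolding s_def using frob[of "p ^ e" "nat \<lceil>x * real p ^ e\<rceil>" "e * (d + 1)" 1]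
      by (simp add: add.commute add.left_commute)
    finally show ?thesis .
  qed
  then have dec: "decseq s" by (rule decseq_SucI)
  have nonneg: "\<forall>e. 0 \<le> s e"
    unfolding s_def using kernel_dim_nonneg[OF p] by simp
  obtain L where L: "s \<longlonglongrightarrow> L" "\<forall>e. L \<le> s e"
    using decseq_convergent[OF dec nonneg] by blast
  have h: "h = L"
    unfolding h_def h_function_diag[OF prime] using limI[OF L(1)] by (simp add: s_def[abs_def])
  show "h \<le> kernel_dim n d p p (nat \<lceil>x * real p\<rceil>) / real p ^ (d + 1)"
    using L(2)[rule_format, of 1] by (simp add: h s_def)
  \<comment> \<open>The subtraction is truncated only at \<open>x = 0\<close>, where
    \<open>?b = 0\<close> and the comparison of exponents is trivial.\<close>
  let ?b = "nat \<lceil>x * real p\<rceil> - 1"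
  have "kernel_dim n d p p ?b / real p ^ (d + 1) \<le> s (Suc e)" for e
  proof -
    have "p ^ e * ?b \<le> nat \<lceil>x * real p ^ Suc e\<rceil>"
    proof (cases "nat \<lceil>x * real p\<rceil> = 0")
      case False
      then have "real ?b \<le> x * real p"
        by linarith
      then have "real p ^ e * real ?b \<le> real p ^ e * (x * real p)"
        by (intro mult_left_mono) auto
      moreover have "real p ^ e * (x * real p) = x * real p ^ Suc e" by simp
      moreover have "real p ^ e * real ?b = real_of_int (int (p ^ e * ?b))" by simp
      ultimately have "real_of_int (int (p ^ e * ?b)) \<le> of_int \<lceil>x * real p ^ Suc e\<rceil>"
        using le_of_int_ceiling[of "x * real p ^ Suc e"] by linarith
      then have "int (p ^ e * ?b) \<le> \<lceil>x * real p ^ Suc e\<rceil>"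
        by (simp only: of_int_le_iff)
      then have "nat (int (p ^ e * ?b)) \<le> nat \<lceil>x * real p ^ Suc e\<rceil>"
        by (rule nat_mono)
      then show ?thesis by (simp only: nat_int)
    qed simp
    then have "kernel_dim n d p (p ^ Suc e) (p ^ e * ?b) \<le> kernel_dim n d p (p ^ Suc e) (nat \<lceil>x * real p ^ Suc e\<rceil>)"
      by (intro kernel_dim_mono[OF p])
    then have "kernel_dim n d p (p ^ Suc e) (p ^ e * ?b) / real p ^ (Suc e * (d + 1)) \<le> s (Suc e)"
      unfolding s_def by (rule divide_right_mono) simp
    moreover have "p ^ Suc e = p ^ e * p" "Suc e * (d + 1) = e * (d + 1) + (d + 1)" by simp_all
    ultimately show ?thesis
      using frob[of p ?b "d + 1" e] by (simp only:)
  qed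
  then show "kernel_dim n d p p ?b / real p ^ (d + 1) \<le> h"
    unfolding h by (intro LIMSEQ_le_const[OF LIMSEQ_Suc[OF L(1)]]) auto
qed

text \<open>Infinitude of the primes makes limits along this filter unique.\<close>

lemma primes_at_top_neq_bot: "primes_at_top \<noteq> bot"
proof
  assume "primes_at_top = bot"
  then have "eventually (\<lambda>p::nat. False) primes_at_top" by simp
  then have "eventually (\<lambda>p::nat. \<not> Factorial_Ring.prime p) at_top"
    by (simp add: eventually_inf_principal)
  then obtain N where "\<And>p::nat. p \<ge> N \<Longrightarrow> \<not> Factorial_Ring.prime p"
    by (auto simp: eventually_at_top_linorder)
  then show False using bigger_prime[of N] by (meson less_imp_le)
qed

text \<open>Both bounds of \<open>h_function_bounds\<close> are lengths at integers within distance
  1 of \<open>x p\<close>. The uniform asymptotics and the continuity of \<open>limit_fun\<close> at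
  \<open>x\<close> complete the squeeze.\<close>

lemma h_function_tendsto:
  assumes n: "n \<ge> 2" and d: "d \<ge> 1" and x: "x \<in> {0..1}"
  shows "((\<lambda>p. h_function (residue_ring (int p)) d (reduce_mod p (diag_series n d)) x)
    \<longlongrightarrow> limit_fun (d + 1) n x) primes_at_top"
proof (rule tendstoI)
  fix e :: real assume e: "e > 0"
  obtain d' where d': "d = Suc d'" using d by (cases d) auto
  obtain P where P: "\<And>p a. p \<ge> P \<Longrightarrow> Factorial_Ring.prime p \<Longrightarrow> a \<le> p \<Longrightarrow>
      \<bar>kernel_dim n d p p a / real p ^ (d + 1) - limit_fun (d + 1) n (real a / real p)\<bar> \<le> e / 3"
    using kernel_dim_asymptotic[OF n, of "e / 3" d'] e d' by auto
  have "isCont (limit_fun (d + 1) n) x"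
    using continuous_limit_fun[of UNIV] by (simp add: continuous_on_eq_continuous_at)
  then obtain \<delta> where \<delta>: "\<delta> > 0" "\<And>y. \<bar>y - x\<bar> < \<delta> \<Longrightarrow> \<bar>limit_fun (d + 1) n y - limit_fun (d + 1) n x\<bar> < e / 3"
    using e unfolding continuous_at_eps_delta dist_real_def
    by (metis divide_pos_pos zero_less_numeral)
  obtain Q where Q: "1 / \<delta> < real Q" using reals_Archimedean2 by blast
  have "\<bar>h_function (residue_ring (int p)) d (reduce_mod p (diag_series n d)) x - limit_fun (d + 1) n x\<bar> < e"
    if p: "p \<ge> max P (Suc Q)" and prime: "Factorial_Ring.prime p" for p
  proof -
    have p0: "real p > 0" using p by simp
    have "1 / \<delta> < real p" using Q p by linarith
    then have p\<delta>: "1 / real p < \<delta>" using \<delta>(1) p0 by (simp add: field_simps)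
    let ?a = "nat \<lceil>x * real p\<rceil>"
    have near: "\<bar>kernel_dim n d p p a / real p ^ (d + 1) - limit_fun (d + 1) n x\<bar> < e"
      if a: "a \<le> p" "\<bar>real a - x * real p\<bar> \<le> 1" for a
    proof -
      have "real a / real p - x = (real a - x * real p) / real p"
        using p0 by (simp add: field_simps)
      then have "\<bar>real a / real p - x\<bar> \<le> 1 / real p"
        using a(2) p0 by (simp add: abs_divide divide_right_mono)
      then have "\<bar>limit_fun (d + 1) n (real a / real p) - limit_fun (d + 1) n x\<bar> < e / 3"
        using p\<delta> by (intro \<delta>(2)) linarith
      moreover have "\<bar>kernel_dim n d p p a / real p ^ (d + 1) - limit_fun (d + 1) n (real a / real p)\<bar> \<le> e / 3"
        using p prime a by (intro P) auto
      ultimately show ?thesis using e by linarith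
    qed
    have xp: "0 \<le> x * real p" "x * real p \<le> real p"
      using x p0 by (auto intro: mult_left_le_one_le)
    have ap: "?a \<le> p" using xp(2) by (simp add: nat_le_iff ceiling_le_iff)
    have a1: "\<bar>real ?a - x * real p\<bar> \<le> 1" and a2: "\<bar>real (?a - 1) - x * real p\<bar> \<le> 1"
      using xp(1) by linarith+
    have "?a - 1 \<le> p" by (rule le_trans[OF diff_le_self ap])
    from near[OF ap a1] near[OF this a2] h_function_bounds[OF prime x, where n = n and d = d]
    show ?thesis by linarith
  qed
  then show "eventually (\<lambda>p. dist (h_function (residue_ring (int p)) d (reduce_mod p (diag_series n d)) x)
      (limit_fun (d + 1) n x) < e) primes_at_top"
    unfolding eventually_inf_principal eventually_at_top_linorder dist_real_def
    by (intro exI[of _ "max P (Suc Q)"]) auto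
qed

theorem theorem1p4:
  fixes n d :: nat
    and S :: "(nat multiset \<Rightarrow> int) ring"
    and f :: "nat multiset \<Rightarrow> int"
    and a c x :: real
  assumes n: "n \<ge> 2" and d: "d \<ge> 1"
    and S: "S = power_series_ring \<Z> {..d}"
    and f: "f = ps_var \<Z> 0 [^]\<^bsub>S\<^esub> n \<oplus>\<^bsub>S\<^esub> (\<Oplus>\<^bsub>S\<^esub>i \<in> {1..d}. ps_var \<Z> i [^]\<^bsub>S\<^esub> (2::nat))"
    and a: "a = a_const (d + 1) n"
    and c: "c = c_const (d + 1) n"
    and x: "x \<in> {0..1}"
  shows "((\<lambda>p. h_function (residue_ring (int p)) d (reduce_mod p f) x)
            \<longlongrightarrow> limit_h_function d f x) primes_at_top
    \<and> (x \<in> {0..a} \<longrightarrow> limit_h_function d f x =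
          x + c * (euler_poly (d + 1) (x + a) - euler_poly (d + 1) (- x + a)))
    \<and> (x \<in> {a..1 - a} \<longrightarrow> limit_h_function d f x =
          x + c * (euler_poly (d + 1) (x + a) + euler_poly (d + 1) (- x + 1 + a)))
    \<and> (x \<in> {1 - a..1} \<longrightarrow> limit_h_function d f x =
          x + c * (- euler_poly (d + 1) (x - 1 + a) + euler_poly (d + 1) (- x + 1 + a)))"
proof -
  have f_eq: "f = diag_series n d"
    unfolding f S by (rule diag_series_eq)
  note lim = h_function_tendsto[OF n d x, folded f_eq]
  \<comment> \<open>The convergence determines the value of \<open>Lim\<close> and is at the same
    time the claimed existence of the limit.\<close>
  have "limit_h_function d f x = limit_fun (d + 1) n x"
    unfolding limit_h_function_def by (rule tendsto_Lim[OF primes_at_top_neq_bot lim])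
  then show ?thesis
    using lim limit_fun_pieces[OF n _ a c] by simp
qed

end
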